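(* Let $0\le\delta<\rho\le1$. An operator $U\in\mathrm{Op}(S^\mu_{\rho,\delta}(\hbar\mathbb{Z}^n\times\mathbb{T}^n))$ is elliptic if and only if there exists $V\in\mathrm{Op}(S^{-\mu}_{\rho,\delta}(\hbar\mathbb{Z}^n\times\mathbb{T}^n))$ such that $$VU\sim I\sim UV\quad\text{modulo}\quad\mathrm{Op}(S^{-\infty}(\hbar\mathbb{Z}^n\times\mathbb{T}^n)),$$ i.e. the operator $V$ is a left and right parametrix of $U$. Moreover, let $U\sim\sum_{l=0}^\infty U_l$ be an expansion of the operator $U$, where $U_l\in\mathrm{Op}(S^{\mu-(\rho-\delta)l}_{\rho,\delta}(\hbar\mathbb{Z}^n\times\mathbb{T}^n))$. Then the corresponding asymptotic expansion of the operator $V$, $V\sim\sum_{j=0}^\infty V_j$ with $V_j\in\mathrm{Op}(S^{-\mu-(\rho-\delta)j}_{\rho,\delta}(\hbar\mathbb{Z}^n\times\mathbb{T}^n))$, can be obtained by setting $\sigma_{\hbar,V_0}:=\dfrac1{\sigma_{\hbar,U_0}}$, and then recursively $$\sigma_{\hbar,V_N}(k,\theta)=\frac{-1}{\sigma_{\hbar,U_0}(k,\theta)}\sum_{j=0}^{N-1}\sum_{l=0}^{N-1}\sum_{|\gamma|=N-j-l}\frac1{\gamma!}\Big[D^{(\gamma)}_{\hbar,\theta}\sigma_{\hbar,V_j}(k,\theta)\Big]\Delta^\gamma_{\hbar,k}\sigma_{\hbar,U_l}(k,\theta).$$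
   Context: Fix $n\ge1$, $\hbar\in(0,1]$ and $\mu\in\mathbb{R}$. $\hbar\mathbb{Z}^n=\{\hbar\bar k:\bar k\in\mathbb{Z}^n\}\subset\mathbb{R}^n$, $|k|$ is the Euclidean norm, $\mathbb{T}^n=\mathbb{R}^n/\mathbb{Z}^n$, $k\cdot\theta=\sum_jk_j\theta_j$, $\mathbb{N}_0=\{0,1,2,\dots\}$. Semi-classical Fourier transform: $\widehat f(\theta)=\sum_{k\in\hbar\mathbb{Z}^n}e^{-2\pi\frac{i}{\hbar}k\cdot\theta}f(k)$. $I$ is the identity operator. Difference operators: with $v_j$ the $j$-th standard unit vector, $\Delta_{\hbar,j}g(k)=\frac{g(k+\hbar v_j)-g(k)}{\hbar}$ and $\Delta_\hbar^\alpha=\Delta_{\hbar,1}^{\alpha_1}\cdots\Delta_{\hbar,n}^{\alpha_n}$ (written $\Delta^\alpha_{\hbar,k}$ when acting in $k$). Toroidal operators: $D_{\hbar,\theta}^{(\beta)}=\hbar^{|\beta|}\prod_{j=1}^n\prod_{\ell=0}^{\beta_j-1}\big(\frac{1}{2\pi i}\frac{\partial}{\partial\theta_j}-\ell\big)$. Symbol class: $\sigma_\hbar:\hbar\mathbb{Z}^n\times\mathbb{T}^n\to\mathbb{C}$ belongs to $S^\mu_{\rho,\delta}(\hbar\mathbb{Z}^n\times\mathbb{T}^n)$ if $\sigma_\hbar(k,\cdot)\in C^\infty(\mathbb{T}^n)$ for all $k$ and for all $\alpha,\beta\in\mathbb{N}_0^n$ there is $C_{\alpha,\beta}>0$ with $|D^{(\beta)}_{\hbar,\theta}\Delta^\alpha_{\hbar,k}\sigma_\hbar(k,\theta)|\le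 C_{\alpha,\beta}(1+|k|)^{\mu-\rho|\alpha|+\delta|\beta|}$ for all $(k,\theta)$; $S^{-\infty}=\bigcap_{\mu\in\mathbb{R}}S^\mu_{1,0}$. Quantization: $\mathrm{Op}_\hbar(\sigma_\hbar)f(k)=\int_{\mathbb{T}^n}e^{2\pi\frac{i}{\hbar}k\cdot\theta}\sigma_\hbar(k,\theta)\widehat f(\theta)\,d\theta$; $\mathrm{Op}(S)$ is the set of operators $\mathrm{Op}_\hbar(\sigma_\hbar)$ with $\sigma_\hbar\in S$, and $\sigma_{\hbar,A}$ denotes the symbol of $A$. Ellipticity: $\sigma_\hbar\in S^\mu_{\rho,\delta}$ (and the operator $\mathrm{Op}_\hbar(\sigma_\hbar)$) is elliptic of order $\mu$ if there are $C,M>0$ with $|\sigma_\hbar(k,\theta)|\ge C(1+|k|)^\mu$ for all $\theta\in\mathbb{T}^n$ and all $k\in\hbar\mathbb{Z}^n$ with $|k|\ge M$. Parametrix: $T$ is a right (resp. left) parametrix of $S$ if $ST-I$ (resp. $TS-I$) belongs to $\mathrm{Op}(S^{-\infty}(\hbar\mathbb{Z}^n\times\mathbb{T}^n))$; $A\sim B$ modulo $\mathrm{Op}(S^{-\infty})$ means $A-B\in\mathrm{Op}(S^{-\infty})$. An expansion $A\sim\sum_{l\ge0}A_l$ with $A_l\in\mathrm{Op}(S^{m-(\rho-\delta)l}_{\rho,\delta})$ means $A-\sum_{l<N}A_l\in\mathrm{Op}(S^{m-(\rho-\delta)N}_{\rho,\delta})$ for every $N\in\mathbb{N}$.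
   Formalization: In the recursion the sum over l runs to N instead of N−1 (as printed the term with j=0, l=N, γ=0 is missing and the claim fails), and the formulas are imposed only for |k|≥M, where σ_{U_0} does not vanish, with arbitrary smooth values at the other k. *)

theory Defs
  imports "HOL-Analysis.Analysis"
begin

text \<open>
  Functions on the lattice are represented by functions on the whole of \<open>real ^ 'n\<close> of which
  only the values at lattice points matter: all conditions below are restricted to
  \<open>hlattice h\<close>. Functions on the torus are \<open>\<int>\<^sup>n\<close>-periodic functions on \<open>real ^ 'n\<close>.
\<close>

definition hlattice :: "real \<Rightarrow> (real ^ 'n) set" where
  "hlattice h = {h *\<^sub>R m | m. \<forall>j. m $ j \<in> \<int>}"

definition periodic :: "(real ^ 'n \<Rightarrow> complex) \<Rightarrow> bool" where
  "periodic f \<longleftrightarrow> (\<forall>\<theta> m. (\<forall>j. m $ j \<in> \<int>) \<longrightarrow> f (\<theta> + m) = f \<theta>)"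

definition partial :: "'n::finite \<Rightarrow> (real ^ 'n \<Rightarrow> complex) \<Rightarrow> real ^ 'n \<Rightarrow> complex" where
  "partial j f \<theta> = vector_derivative (\<lambda>t. f (\<theta> + t *\<^sub>R axis j 1)) (at 0)"

primrec Ck :: "nat \<Rightarrow> (real ^ 'n::finite \<Rightarrow> complex) \<Rightarrow> bool" where
  "Ck 0 f \<longleftrightarrow> continuous_on UNIV f"
| "Ck (Suc m) f \<longleftrightarrow> (\<forall>\<theta>. f differentiable (at \<theta>)) \<and> (\<forall>j. Ck m (partial j f))"

definition torus_smooth :: "(real ^ 'n::finite \<Rightarrow> complex) \<Rightarrow> bool" where
  "torus_smooth f \<longleftrightarrow> periodic f \<and> (\<forall>m. Ck m f)"

text \<open>
  Multi-indices are functions \<open>'n \<Rightarrow> nat\<close>. The index type carries no order, so products of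
  operators over the coordinates are taken along a fixed enumeration; the difference operators
  commute, and so do the toroidal operators on smooth functions, so the choice is immaterial.
\<close>

definition coords :: "'n::finite list" where
  "coords = (SOME js. distinct js \<and> set js = UNIV)"

definition mlen :: "('n::finite \<Rightarrow> nat) \<Rightarrow> nat" where
  "mlen \<alpha> = (\<Sum>j\<in>UNIV. \<alpha> j)"

definition mfact :: "('n::finite \<Rightarrow> nat) \<Rightarrow> nat" where
  "mfact \<alpha> = (\<Prod>j\<in>UNIV. fact (\<alpha> j))"

definition diff1 :: "real \<Rightarrow> 'n::finite \<Rightarrow> (real ^ 'n \<Rightarrow> complex) \<Rightarrow> real ^ 'n \<Rightarrow> complex" where
  "diff1 h j g k = (g (k + h *\<^sub>R axis j 1) - g k) / of_real h"

definition diff_op ::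
    "real \<Rightarrow> ('n::finite \<Rightarrow> nat) \<Rightarrow> (real ^ 'n \<Rightarrow> complex) \<Rightarrow> real ^ 'n \<Rightarrow> complex" where
  "diff_op h \<alpha> g = foldr (\<lambda>j. diff1 h j ^^ \<alpha> j) coords g"

definition tor1 :: "'n::finite \<Rightarrow> nat \<Rightarrow> (real ^ 'n \<Rightarrow> complex) \<Rightarrow> real ^ 'n \<Rightarrow> complex" where
  "tor1 j l f \<theta> = 1 / (2 * of_real pi * \<i>) * partial j f \<theta> - of_nat l * f \<theta>"

definition tor_op ::
    "real \<Rightarrow> ('n::finite \<Rightarrow> nat) \<Rightarrow> (real ^ 'n \<Rightarrow> complex) \<Rightarrow> real ^ 'n \<Rightarrow> complex" where
  "tor_op h \<beta> f \<theta> =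
     of_real (h ^ mlen \<beta>) * foldr (\<lambda>j. foldr (tor1 j) [0..<\<beta> j]) coords f \<theta>"

type_synonym 'n sym = "real ^ 'n \<Rightarrow> real ^ 'n \<Rightarrow> complex"
type_synonym 'n opr = "(real ^ 'n \<Rightarrow> complex) \<Rightarrow> real ^ 'n \<Rightarrow> complex"

definition symbols :: "real \<Rightarrow> real \<Rightarrow> real \<Rightarrow> real \<Rightarrow> 'n::finite sym set" where
  "symbols h \<rho> \<delta> \<mu> =
     {\<sigma>. (\<forall>k\<in>hlattice h. torus_smooth (\<sigma> k)) \<and>
          (\<forall>\<alpha> \<beta>. \<exists>C>0. \<forall>k\<in>hlattice h. \<forall>\<theta>.
             norm (tor_op h \<beta> (\<lambda>\<phi>. diff_op h \<alpha> (\<lambda>\<kappa>. \<sigma> \<kappa> \<phi>) k) \<theta>)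
               \<le> C * (1 + norm k) powr (\<mu> - \<rho> * real (mlen \<alpha>) + \<delta> * real (mlen \<beta>)))}"

definition smoothing_symbols :: "real \<Rightarrow> 'n::finite sym set" where
  "smoothing_symbols h = (\<Inter>\<mu>. symbols h 1 0 \<mu>)"

definition sfourier :: "real \<Rightarrow> (real ^ 'n::finite \<Rightarrow> complex) \<Rightarrow> real ^ 'n \<Rightarrow> complex" where
  "sfourier h f \<theta> =
     (\<Sum>\<^sub>\<infinity>k\<in>hlattice h. exp (- 2 * of_real pi * (\<i> / of_real h) * of_real (k \<bullet> \<theta>)) * f k)"

definition Op :: "real \<Rightarrow> 'n::finite sym \<Rightarrow> 'n opr" where
  "Op h \<sigma> f k =
     integral (cbox 0 1)
       (\<lambda>\<theta>. exp (2 * of_real pi * (\<i> / of_real h) * of_real (k \<bullet> \<theta>)) * \<sigma> k \<theta> * sfourier h f \<theta>)"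

text \<open>
  The operators act on the rapidly decreasing functions on the lattice. Symbols of order
  \<open>\<mu>\<close> with \<open>\<delta> < 1\<close> map this space to itself, so that compositions make sense.
\<close>

definition schwartz :: "real \<Rightarrow> (real ^ 'n::finite \<Rightarrow> complex) set" where
  "schwartz h = {f. \<forall>m::nat. \<exists>C. \<forall>k\<in>hlattice h. (1 + norm k) ^ m * norm (f k) \<le> C}"

text \<open>
  \<open>A\<close> and \<open>Op h \<sigma>\<close> are the same operator on rapidly decreasing functions. For \<open>\<sigma>\<close> in a symbol
  class this determines \<open>\<sigma>\<close> at all lattice points, so \<open>\<sigma>\<close> is then the symbol of \<open>A\<close>.
\<close>

definition has_symbol :: "real \<Rightarrow> 'n::finite opr \<Rightarrow> 'n sym \<Rightarrow> bool" where
  "has_symbol h A \<sigma> \<longleftrightarrow> (\<forall>f\<in>schwartz h. \<forall>k\<in>hlattice h. A f k = Op h \<sigma> f k)"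

definition OpS :: "real \<Rightarrow> 'n::finite sym set \<Rightarrow> 'n opr set" where
  "OpS h S = {A. \<exists>\<sigma>\<in>S. has_symbol h A \<sigma>}"

definition elliptic_symbol :: "real \<Rightarrow> real \<Rightarrow> 'n::finite sym \<Rightarrow> bool" where
  "elliptic_symbol h \<mu> \<sigma> \<longleftrightarrow>
     (\<exists>C>0. \<exists>M>0. \<forall>\<theta>. \<forall>k\<in>hlattice h. norm k \<ge> M \<longrightarrow>
        norm (\<sigma> k \<theta>) \<ge> C * (1 + norm k) powr \<mu>)"

definition elliptic :: "real \<Rightarrow> real \<Rightarrow> real \<Rightarrow> real \<Rightarrow> 'n::finite opr \<Rightarrow> bool" where
  "elliptic h \<rho> \<delta> \<mu> A \<longleftrightarrow>
     (\<exists>\<sigma>\<in>symbols h \<rho> \<delta> \<mu>. has_symbol h A \<sigma> \<and> elliptic_symbol h \<mu> \<sigma>)"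

definition op_sim :: "real \<Rightarrow> 'n::finite opr \<Rightarrow> 'n opr \<Rightarrow> bool" where
  "op_sim h A B \<longleftrightarrow> (\<lambda>f k. A f k - B f k) \<in> OpS h (smoothing_symbols h)"

definition parametrix :: "real \<Rightarrow> 'n::finite opr \<Rightarrow> 'n opr \<Rightarrow> bool" where
  "parametrix h V U \<longleftrightarrow> op_sim h (V \<circ> U) id \<and> op_sim h (U \<circ> V) id"

definition op_expansion ::
    "real \<Rightarrow> real \<Rightarrow> real \<Rightarrow> real \<Rightarrow> 'n::finite opr \<Rightarrow> (nat \<Rightarrow> 'n opr) \<Rightarrow> bool" where
  "op_expansion h \<rho> \<delta> m A As \<longleftrightarrow>
     (\<forall>l. As l \<in> OpS h (symbols h \<rho> \<delta> (m - (\<rho> - \<delta>) * real l))) \<and>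
     (\<forall>N. (\<lambda>f k. A f k - (\<Sum>l<N. As l f k)) \<in> OpS h (symbols h \<rho> \<delta> (m - (\<rho> - \<delta>) * real N)))"

definition nonvanishing_from :: "real \<Rightarrow> real \<Rightarrow> 'n::finite sym \<Rightarrow> bool" where
  "nonvanishing_from h M \<sigma> \<longleftrightarrow> (\<forall>k\<in>hlattice h. norm k \<ge> M \<longrightarrow> (\<forall>\<theta>. \<sigma> k \<theta> \<noteq> 0))"

text \<open>
  The recursion is imposed only where the leading symbol \<open>u 0\<close> can be inverted, that is for
  \<open>|k| \<ge> M\<close>; at the finitely many other lattice points the \<open>v N\<close> are arbitrary smooth functions
  of \<open>\<theta>\<close>. If \<open>u 0\<close> vanishes nowhere, \<open>M = 0\<close> gives the recursion everywhere.

  The condition \<open>|\<gamma>| = N - j - l\<close> is written additively, so that the sum over \<open>\<gamma>\<close> is empty when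
  \<open>j + l > N\<close>. The index \<open>l\<close> runs up to \<open>N\<close>: the term \<open>v 0 * u N\<close> (\<open>j = 0\<close>, \<open>l = N\<close>,
  \<open>\<gamma> = 0\<close>) belongs to the homogeneous part of order \<open>- (\<rho> - \<delta>) N\<close> of the composition, and the
  expansion fails without it, e.g. for \<open>u 0 = 1\<close>, \<open>u 1 k \<theta> = 1 / (1 + |k|)\<close>, \<open>u l = 0\<close> for
  \<open>l \<ge> 2\<close> with \<open>\<rho> = 1\<close> and \<open>\<delta> = 0\<close>.
\<close>

definition parametrix_recursion ::
    "real \<Rightarrow> real \<Rightarrow> (nat \<Rightarrow> 'n::finite sym) \<Rightarrow> (nat \<Rightarrow> 'n sym) \<Rightarrow> bool" where
  "parametrix_recursion h M u v \<longleftrightarrow>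
     (\<forall>N. \<forall>k\<in>hlattice h. torus_smooth (v N k)) \<and>
     (\<forall>k\<in>hlattice h. norm k \<ge> M \<longrightarrow> (\<forall>\<theta>.
        v 0 k \<theta> = 1 / u 0 k \<theta> \<and>
        (\<forall>N\<ge>1. v N k \<theta> =
           - 1 / u 0 k \<theta> *
             (\<Sum>j<N. \<Sum>l\<le>N. \<Sum>\<gamma> | mlen \<gamma> + j + l = N.
                1 / of_nat (mfact \<gamma>) * tor_op h \<gamma> (v j k) \<theta> * diff_op h \<gamma> (\<lambda>\<kappa>. u l \<kappa> \<theta>) k))))"

end

theory Submission
  imports Defs
begin

text \<open>
  An operator is the matrix whose entry at \<open>(h r, h q)\<close> is the Fourier coefficient of index
  \<open>q - r\<close> of its symbol at \<open>h r\<close>; hence operators determine their symbols on the lattice, and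
  compositions are operators again, with symbol
  \<open>\<Sum>p. fourier_coef (a k) p * e^(2 \<pi> i p \<theta>) * b (k + h p) \<theta>\<close>. Newton's interpolation
  formula for \<open>b (k + h p)\<close> in \<open>p\<close> turns this into the asymptotic expansion of the composition.
  The remainder is only estimated crudely, with a loss that does not depend on the number \<open>N\<close>
  of terms; comparing with a much longer expansion removes the loss.

  If \<open>U\<close> is elliptic, the operators with symbol \<open>1 / \<sigma>\<close> invert it on both sides modulo order
  \<open>- (\<rho> - \<delta>)\<close>, and an asymptotic Neumann series improves this to a parametrix. Conversely, the
  leading term of the composition shows that the symbols of \<open>V\<close> and \<open>U\<close> are inverse to each other
  modulo order \<open>- (\<rho> - \<delta>)\<close>, which forces ellipticity of \<open>U\<close> and of the leading term \<open>U 0\<close>.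
  By the recursion, \<open>V N = \<Sum>j<N. Op (v j)\<close> satisfies \<open>V N \<circ> U = I + E\<close> with \<open>E\<close> of order
  \<open>- (\<rho> - \<delta>) N\<close>; composing with the parametrix \<open>V\<close> on the right gives the expansion of \<open>V\<close>.
\<close>


section \<open>Smooth functions on the torus\<close>

text \<open>Since \<open>h\<close> is fixed, constants may depend on it: below any radius there are
  only finitely many lattice points, differences are bounded on every weighted space, and a symbol
  supported at finitely many points lies in every class. Cutoffs and choices near the origin are
  therefore free. The obstacle is the composition remainder. The differences of \<open>b\<close> at
  \<open>k + h p\<close> are small only while \<open>p\<close> is small compared with
  \<open>k\<close>; for larger \<open>p\<close> the smallness must come from the Fourier
  coefficients of \<open>a k\<close>, where each power of \<open>p\<close> costs a factor
  \<open>(1 + |k|)\<close> to the \<open>\<delta>\<close>. Because \<open>\<delta> < 1\<close>,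
  enough powers win. Summing over \<open>p\<close> takes \<open>2 n\<close> further powers, and
  these make up the loss. Derivatives of a remainder are not estimated separately: composition and
  expansion obey the same product rule, so a torus derivative of a remainder is a sum of two
  remainders, and differences are traded for a lower order. Newton's formula rather than Taylor's is
  dictated by the operators: the Fourier multiplier of the toroidal operator of index
  \<open>\<gamma>\<close> is a falling factorial, the numerator of a binomial coefficient.\<close>

lemma partial_eqI:
  assumes "(f has_derivative D) (at \<theta>)"
  shows "partial j f \<theta> = D (axis j 1)"
proof -
  have "((\<lambda>t. f (\<theta> + t *\<^sub>R axis j 1)) has_derivative (\<lambda>t. D (t *\<^sub>R axis j 1))) (at 0)"
    by (rule has_derivative_compose[of "\<lambda>t. \<theta> + t *\<^sub>R axis j 1" "\<lambda>t. t *\<^sub>R axis j 1" 0 UNIV f])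
      (auto intro!: derivative_eq_intros assms)
  moreover have "D (t *\<^sub>R axis j 1) = t *\<^sub>R D (axis j 1)" for t
    using has_derivative_linear[OF assms] by (simp add: linear_cmul)
  ultimately show ?thesis
    unfolding partial_def
    by (intro vector_derivative_at) (simp add: has_vector_derivative_def)
qed

lemma has_vector_derivative_partial:
  assumes "f differentiable (at (\<theta> + t *\<^sub>R axis j 1))"
  shows "((\<lambda>t. f (\<theta> + t *\<^sub>R axis j 1)) has_vector_derivative partial j f (\<theta> + t *\<^sub>R axis j 1)) (at t within S)"
proof -
  obtain D where D: "(f has_derivative D) (at (\<theta> + t *\<^sub>R axis j 1))"
    using assms by (auto simp: differentiable_def)
  have "((\<lambda>t. f (\<theta> + t *\<^sub>R axis j 1)) has_derivative (\<lambda>u. D (u *\<^sub>R axis j 1))) (at t within S)"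
    by (rule has_derivative_compose[of "\<lambda>t. \<theta> + t *\<^sub>R axis j 1" "\<lambda>t. t *\<^sub>R axis j 1" t S f])
      (auto intro!: derivative_eq_intros D)
  moreover have "D (t *\<^sub>R axis j 1) = t *\<^sub>R D (axis j 1)" for t
    using has_derivative_linear[OF D] by (simp add: linear_cmul)
  ultimately show ?thesis
    by (simp add: has_vector_derivative_def partial_eqI[OF D])
qed

lemma has_derivative_partial:
  fixes f :: "real ^ 'n::finite \<Rightarrow> complex"
  assumes "f differentiable (at \<theta>)"
  shows "(f has_derivative (\<lambda>v. \<Sum>j\<in>UNIV. v $ j *\<^sub>R partial j f \<theta>)) (at \<theta>)"
proof -
  obtain D where D: "(f has_derivative D) (at \<theta>)"
    using assms by (auto simp: differentiable_def)
  have "D v = (\<Sum>j\<in>UNIV. v $ j *\<^sub>R partial j f \<theta>)" for v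
  proof -
    have "D v = D (\<Sum>j\<in>UNIV. v $ j *\<^sub>R axis j 1)"
      by (simp add: basis_expansion flip: scalar_mult_eq_scaleR)
    also have "\<dots> = (\<Sum>j\<in>UNIV. D (v $ j *\<^sub>R axis j 1))"
      by (intro linear_sum has_derivative_linear[OF D])
    finally show ?thesis
      using has_derivative_linear[OF D] by (simp add: linear_cmul partial_eqI[OF D])
  qed
  then have "D = (\<lambda>v. \<Sum>j\<in>UNIV. v $ j *\<^sub>R partial j f \<theta>)" by (rule ext)
  with D show ?thesis by simp
qed

lemma partial_add:
  assumes "f differentiable (at \<theta>)" "g differentiable (at \<theta>)"
  shows "partial j (\<lambda>\<theta>. f \<theta> + g \<theta>) \<theta> = partial j f \<theta> + partial j g \<theta>"
  using assms unfolding differentiable_def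
  by (auto simp: partial_eqI partial_eqI[OF has_derivative_add])

lemma partial_mult:
  assumes "f differentiable (at \<theta>)" "g differentiable (at \<theta>)"
  shows "partial j (\<lambda>\<theta>. f \<theta> * g \<theta>) \<theta> = partial j f \<theta> * g \<theta> + f \<theta> * partial j g \<theta>"
  using assms unfolding differentiable_def
  by (auto simp: partial_eqI partial_eqI[OF has_derivative_mult])

lemma partial_const [simp]: "partial j (\<lambda>\<theta>. c) \<theta> = 0"
  by (simp add: partial_eqI[OF has_derivative_const])

lemma partial_cmult:
  assumes "f differentiable (at \<theta>)"
  shows "partial j (\<lambda>\<theta>. c * f \<theta>) \<theta> = c * partial j f \<theta>"
  using partial_mult[of "\<lambda>_. c" \<theta> f j] assms by simp

lemma partial_inverse:
  assumes "f differentiable (at \<theta>)" "f \<theta> \<noteq> 0"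
  shows "partial j (\<lambda>\<theta>. inverse (f \<theta>)) \<theta> = - (partial j f \<theta> * (inverse (f \<theta>) * inverse (f \<theta>)))"
proof -
  obtain D where D: "(f has_derivative D) (at \<theta>)"
    using assms by (auto simp: differentiable_def)
  show ?thesis
    using partial_eqI[OF Deriv.has_derivative_inverse[OF assms(2) D]] 
    by (simp add: partial_eqI[OF D] algebra_simps)
qed

lemma Ck_add: "Ck m f \<Longrightarrow> Ck m g \<Longrightarrow> Ck m (\<lambda>\<theta>. f \<theta> + g \<theta>)"
proof (induction m arbitrary: f g)
  case 0
  then show ?case by (auto intro: continuous_intros)
next
  case (Suc m)
  then have "partial j (\<lambda>\<theta>. f \<theta> + g \<theta>) = (\<lambda>\<theta>. partial j f \<theta> + partial j g \<theta>)" for j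
    by (auto simp: partial_add)
  with Suc show ?case by (auto intro: differentiable_add)
qed

text \<open>The recursion records continuity only at order 0, so the base case is that
  differentiability implies continuity.\<close>

lemma Ck_Suc_imp_Ck: "Ck (Suc m) f \<Longrightarrow> Ck m f"
proof (induction m arbitrary: f)
  case 0
  then show ?case
    by (auto simp: continuous_on_eq_continuous_at intro: differentiable_imp_continuous_within)
next
  case (Suc m)
  from Suc.prems have "f differentiable (at \<theta>)" "Ck (Suc m) (partial j f)" for \<theta> j
    by (auto simp only: Ck.simps(2)[of "Suc m"])
  with Suc.IH show ?case by simp
qed

lemma Ck_mult: "Ck m f \<Longrightarrow> Ck m g \<Longrightarrow> Ck m (\<lambda>\<theta>. f \<theta> * g \<theta>)"
proof (induction m arbitrary: f g)
  case 0
  then show ?case by (auto intro: continuous_intros)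
next
  case (Suc m)
  then have "partial j (\<lambda>\<theta>. f \<theta> * g \<theta>) = (\<lambda>\<theta>. partial j f \<theta> * g \<theta> + f \<theta> * partial j g \<theta>)" for j
    by (auto simp: partial_mult)
  moreover have "Ck m f" "Ck m g"
    using Suc.prems by (auto intro: Ck_Suc_imp_Ck simp del: Ck.simps)
  ultimately show ?case
    using Suc by (auto intro!: Ck_add differentiable_mult)
qed

lemma Ck_const: "Ck m (\<lambda>\<theta>::real ^ 'n::finite. c)"
proof (induction m arbitrary: c)
  case (Suc m)
  have "partial j (\<lambda>\<theta>::real ^ 'n. c) = (\<lambda>\<theta>. 0)" for j by auto
  with Suc show ?case by simp
qed auto

lemma Ck_inverse:
  assumes "\<And>\<theta>. f \<theta> \<noteq> 0"
  shows "Ck m f \<Longrightarrow> Ck m (\<lambda>\<theta>. inverse (f \<theta>))"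
proof (induction m)
  case 0
  then show ?case using assms by (auto intro: continuous_intros)
next
  case (Suc m)
  \<comment> \<open>The sign is a product with the constant -1, so that \<open>Ck_mult\<close> and
    \<open>Ck_const\<close> cover the whole expression.\<close>
  have "partial j (\<lambda>\<theta>. inverse (f \<theta>)) = (\<lambda>\<theta>. -1 * (partial j f \<theta> * (inverse (f \<theta>) * inverse (f \<theta>))))" for j
    using assms Suc.prems by (auto simp: partial_inverse)
  moreover have "Ck m f"
    using Suc.prems by (auto intro: Ck_Suc_imp_Ck simp del: Ck.simps)
  with Suc have "Ck m (\<lambda>\<theta>. -1 * (partial j f \<theta> * (inverse (f \<theta>) * inverse (f \<theta>))))" for j
    by (intro Ck_mult Ck_const) auto
  ultimately show ?case
    using Suc.prems assms by (auto intro!: differentiable_inverse)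
qed

lemma torus_smooth_differentiable: "torus_smooth f \<Longrightarrow> f differentiable (at \<theta>)"
  unfolding torus_smooth_def by (meson Ck.simps(2))

lemma torus_smooth_continuous: "torus_smooth f \<Longrightarrow> continuous_on S f"
  unfolding torus_smooth_def by (metis Ck.simps(1) continuous_on_subset subset_UNIV)

lemma periodicD: "periodic f \<Longrightarrow> (\<And>j. m $ j \<in> \<int>) \<Longrightarrow> f (\<theta> + m) = f \<theta>"
  by (auto simp: periodic_def)

lemma periodic_partial:
  fixes f :: "real ^ 'n::finite \<Rightarrow> complex"
  assumes "periodic f"
  shows "periodic (partial j f)"
  unfolding periodic_def
proof (intro allI impI)
  fix \<theta> m :: "real ^ 'n" assume m: "\<forall>j. m $ j \<in> \<int>"
  have "f (\<theta> + m + t *\<^sub>R axis j 1) = f (\<theta> + t *\<^sub>R axis j 1)" for t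
    using periodicD[OF assms, of m "\<theta> + t *\<^sub>R axis j 1"] m by (simp add: ac_simps)
  then show "partial j f (\<theta> + m) = partial j f \<theta>"
    by (simp add: partial_def)
qed

lemma torus_smooth_partial: "torus_smooth f \<Longrightarrow> torus_smooth (partial j f)"
  unfolding torus_smooth_def by (meson Ck.simps(2) periodic_partial)

text \<open>A class of periodic differentiable functions that is closed under partial derivatives
  consists of smooth functions; this avoids computing iterated derivatives.\<close>

lemma torus_smooth_coinduct:
  assumes "X f"
    and X: "\<And>g. X g \<Longrightarrow> periodic g \<and> (\<forall>\<theta>. g differentiable (at \<theta>)) \<and> (\<forall>j. X (partial j g))"
  shows "torus_smooth f"
proof -
  have "X g \<Longrightarrow> Ck m g" for m g
  proof (induction m arbitrary: g)
    case 0
    then show ?case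
      using X by (auto simp: continuous_on_eq_continuous_at intro: differentiable_imp_continuous_within)
  next
    case (Suc m)
    then show ?case using X by auto
  qed
  with assms show ?thesis by (auto simp: torus_smooth_def)
qed

lemma torus_smooth_const: "torus_smooth (\<lambda>\<theta>. c)"
  by (simp add: torus_smooth_def Ck_const periodic_def)

lemma torus_smooth_add:
  "torus_smooth f \<Longrightarrow> torus_smooth g \<Longrightarrow> torus_smooth (\<lambda>\<theta>. f \<theta> + g \<theta>)"
  by (auto simp: torus_smooth_def Ck_add periodic_def)

lemma torus_smooth_mult:
  "torus_smooth f \<Longrightarrow> torus_smooth g \<Longrightarrow> torus_smooth (\<lambda>\<theta>. f \<theta> * g \<theta>)"
  by (auto simp: torus_smooth_def Ck_mult periodic_def)

lemma torus_smooth_cmult: "torus_smooth f \<Longrightarrow> torus_smooth (\<lambda>\<theta>. c * f \<theta>)"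
  by (intro torus_smooth_mult torus_smooth_const)

lemma torus_smooth_diff:
  "torus_smooth f \<Longrightarrow> torus_smooth g \<Longrightarrow> torus_smooth (\<lambda>\<theta>. f \<theta> - g \<theta>)"
  using torus_smooth_add[OF _ torus_smooth_cmult, of f g "-1"] by simp

lemma torus_smooth_sum:
  "(\<And>i. i \<in> I \<Longrightarrow> torus_smooth (f i)) \<Longrightarrow> torus_smooth (\<lambda>\<theta>. \<Sum>i\<in>I. f i \<theta>)"
  by (induction I rule: infinite_finite_induct) (auto intro: torus_smooth_add torus_smooth_const)

lemma torus_smooth_inverse:
  "torus_smooth f \<Longrightarrow> (\<And>\<theta>. f \<theta> \<noteq> 0) \<Longrightarrow> torus_smooth (\<lambda>\<theta>. inverse (f \<theta>))"
  by (auto simp: torus_smooth_def Ck_inverse periodic_def)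

lemma partial_diff:
  assumes "torus_smooth f" "torus_smooth g"
  shows "partial j (\<lambda>\<theta>. f \<theta> - g \<theta>) \<theta> = partial j f \<theta> - partial j g \<theta>"
  using partial_add[of f \<theta> "\<lambda>\<theta>. -1 * g \<theta>" j] partial_cmult[of g \<theta> j "-1"] assms
    torus_smooth_differentiable[OF torus_smooth_cmult[of g "-1"]]
  by (simp add: torus_smooth_differentiable)

lemma partial_sum:
  assumes "\<And>i. i \<in> I \<Longrightarrow> torus_smooth (f i)"
  shows "partial j (\<lambda>\<theta>. \<Sum>i\<in>I. f i \<theta>) \<theta> = (\<Sum>i\<in>I. partial j (f i) \<theta>)"
  using assms
proof (induction I rule: infinite_finite_induct)
  case (insert x F)
  then have "torus_smooth (f x)" "torus_smooth (\<lambda>\<theta>. \<Sum>i\<in>F. f i \<theta>)"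
    by (auto intro: torus_smooth_sum)
  with insert show ?case
    by (simp add: partial_add torus_smooth_differentiable)
qed auto

text \<open>Periodicity moves every point into the compact unit cube, by subtracting the integer
  parts of its coordinates.\<close>

lemma torus_bounded:
  fixes f :: "real ^ 'n::finite \<Rightarrow> complex"
  assumes "continuous_on UNIV f" "periodic f"
  obtains B where "B \<ge> 0" "\<And>\<theta>. norm (f \<theta>) \<le> B"
proof -
  have "compact (f ` cbox 0 1)"
    by (intro compact_continuous_image continuous_on_subset[OF assms(1)]) auto
  then obtain B where B: "\<And>x. x \<in> cbox 0 1 \<Longrightarrow> norm (f x) \<le> B"
    using compact_imp_bounded bounded_iff by (metis imageI)
  have "norm (f \<theta>) \<le> max B 0" for \<theta>
  proof -
    define m where "m = (\<chi> j. - of_int \<lfloor>\<theta> $ j\<rfloor> :: real ^ 'n)"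
    have "\<theta> + m \<in> cbox 0 1"
      by (auto simp: m_def mem_box_cart algebra_simps) linarith+
    moreover have "f (\<theta> + m) = f \<theta>"
      by (rule periodicD[OF assms(2)]) (simp add: m_def)
    ultimately show ?thesis using B[of "\<theta> + m"] by simp
  qed
  then show ?thesis using that[of "max B 0"] by auto
qed

section \<open>The integer lattice of Fourier indices and its characters\<close>

definition zlat :: "(real ^ 'n) set" where
  "zlat = {p. \<forall>j. p $ j \<in> \<int>}"

definition echar :: "real ^ 'n::finite \<Rightarrow> real ^ 'n \<Rightarrow> complex" where
  "echar p \<theta> = cis (2 * pi * (p \<bullet> \<theta>))"

lemma zlat_add: "p \<in> zlat \<Longrightarrow> q \<in> zlat \<Longrightarrow> p + q \<in> zlat"
  and zlat_diff: "p \<in> zlat \<Longrightarrow> q \<in> zlat \<Longrightarrow> p - q \<in> zlat"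
  and zlat_minus: "p \<in> zlat \<Longrightarrow> - p \<in> zlat"
  and zlat_0: "0 \<in> zlat"
  by (auto simp: zlat_def)

lemma zlat_axis: "axis j 1 \<in> zlat"
  by (auto simp: zlat_def axis_def)

lemma norm_echar [simp]: "norm (echar p \<theta>) = 1"
  by (simp add: echar_def)

lemma echar_0 [simp]: "echar 0 \<theta> = 1"
  by (simp add: echar_def)

lemma echar_add: "echar (p + q) \<theta> = echar p \<theta> * echar q \<theta>"
  by (simp add: echar_def cis_mult ring_distribs inner_add_left)

lemma echar_has_derivative:
  "(echar p has_derivative (\<lambda>v. of_real (2 * pi * (p \<bullet> v)) * \<i> * echar p \<theta>)) (at \<theta>)"
proof -
  have "((\<lambda>\<theta>. exp (\<i> * of_real (2 * pi * (p \<bullet> \<theta>)))) has_derivative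
     (\<lambda>v. of_real (2 * pi * (p \<bullet> v)) * \<i> * exp (\<i> * of_real (2 * pi * (p \<bullet> \<theta>))))) (at \<theta>)"
    by (rule has_derivative_eq_rhs, rule has_derivative_compose[OF _ has_field_derivative_imp_has_derivative[OF DERIV_exp]])
      (auto intro!: derivative_eq_intros simp: algebra_simps)
  then show ?thesis by (simp add: echar_def[abs_def] cis_conv_exp)
qed

lemma echar_differentiable: "echar p differentiable (at \<theta>)"
  using echar_has_derivative differentiable_def by blast

lemma partial_echar: "partial j (echar p) \<theta> = 2 * of_real pi * \<i> * of_real (p $ j) * echar p \<theta>"
  by (simp add: partial_eqI[OF echar_has_derivative] inner_axis algebra_simps)

lemma periodic_echar:
  assumes "p \<in> zlat"
  shows "periodic (echar p)"
  unfolding periodic_def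
proof (intro allI impI)
  fix \<theta> m :: "real ^ 'a" assume m: "\<forall>j. m $ j \<in> \<int>"
  have "p \<bullet> m \<in> \<int>"
    using assms m by (auto simp: inner_vec_def zlat_def)
  then obtain z where "p \<bullet> m = of_int z" by (auto elim: Ints_cases)
  then have "cis (2 * pi * (p \<bullet> m)) = 1"
    using cis_multiple_2pi[of "p \<bullet> m"] \<open>p \<bullet> m \<in> \<int>\<close> by simp
  then show "echar p (\<theta> + m) = echar p \<theta>"
    by (simp add: echar_def inner_add_right ring_distribs flip: cis_mult)
qed

text \<open>The multiples of one character form a class closed under partial derivatives, so
  coinduction applies.\<close>

lemma torus_smooth_echar:
  assumes "p \<in> zlat"
  shows "torus_smooth (echar p)"
proof -
  have *: "torus_smooth (\<lambda>\<theta>. c * echar p \<theta>)" for c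
  proof (rule torus_smooth_coinduct[of "\<lambda>g. \<exists>c. g = (\<lambda>\<theta>. c * echar p \<theta>)"])
    fix g assume "\<exists>c. g = (\<lambda>\<theta>. c * echar p \<theta>)"
    then obtain c where g: "g = (\<lambda>\<theta>. c * echar p \<theta>)" by auto
    have "partial j g = (\<lambda>\<theta>. (c * (2 * of_real pi * \<i> * of_real (p $ j))) * echar p \<theta>)" for j
      by (auto simp: g partial_cmult[OF echar_differentiable] partial_echar)
    moreover have "periodic g"
      using periodic_echar[OF assms] by (auto simp: g periodic_def)
    ultimately show "periodic g \<and> (\<forall>\<theta>. g differentiable (at \<theta>)) \<and> (\<forall>j. \<exists>c. partial j g = (\<lambda>\<theta>. c * echar p \<theta>))"
      by (auto simp: g intro!: differentiable_mult echar_differentiable)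
  qed auto
  from *[of 1] show ?thesis by simp
qed

section \<open>Fourier series\<close>

text \<open>Cut the shifted cube along the hyperplane where coordinate \<open>j\<close> equals 1.
  The slab beyond it, translated back by one period, fills exactly the gap left in the unit
  cube.\<close>

lemma integral_torus_shift:
  fixes f :: "real ^ 'n::finite \<Rightarrow> complex"
  assumes f: "continuous_on UNIV f" "periodic f" and t: "0 \<le> t" "t \<le> 1"
  shows "integral (cbox 0 1) (\<lambda>\<theta>. f (\<theta> + t *\<^sub>R axis j 1)) = integral (cbox 0 1) f"
proof -
  define e :: "real ^ 'n" where "e = axis j 1"
  have e: "e \<in> Basis" by (auto simp: e_def axis_in_Basis_iff)
  have xe: "x \<bullet> e = x $ j" for x by (simp add: e_def inner_axis)
  have ei: "e $ i = (if i = j then 1 else 0)" for i by (auto simp: e_def axis_def)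
  have int: "f integrable_on cbox a b" for a b
    by (intro integrable_continuous continuous_on_subset[OF f(1)]) auto
  have "integral (cbox 0 1) (\<lambda>\<theta>. f (\<theta> + t *\<^sub>R e)) = integral (cbox (t *\<^sub>R e) (1 + t *\<^sub>R e)) f"
    using integral_shift_cbox[of "t *\<^sub>R e" "t *\<^sub>R e" "1 + t *\<^sub>R e" f] by simp
  also have "\<dots> = integral (cbox (t *\<^sub>R e) (1 + t *\<^sub>R e) \<inter> {x. x \<bullet> e \<le> 1}) f
                + integral (cbox (t *\<^sub>R e) (1 + t *\<^sub>R e) \<inter> {x. x \<bullet> e \<ge> 1}) f"
    by (rule integral_split[OF int e])
  also have "cbox (t *\<^sub>R e) (1 + t *\<^sub>R e) \<inter> {x. x \<bullet> e \<le> 1} = cbox 0 1 \<inter> {x. x \<bullet> e \<ge> t}"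
    using t by (auto simp: mem_box_cart xe ei split: if_splits) (smt (verit))+
  also have "cbox (t *\<^sub>R e) (1 + t *\<^sub>R e) \<inter> {x. x \<bullet> e \<ge> 1} = cbox e (1 + t *\<^sub>R e)"
    using t by (auto simp: mem_box_cart xe ei split: if_splits) (smt (verit))+
  also have "integral (cbox e (1 + t *\<^sub>R e)) f = integral (cbox 0 (1 + t *\<^sub>R e - e)) (\<lambda>x. f (x + e))"
    using integral_shift_cbox[of e e "1 + t *\<^sub>R e" f] by simp
  also have "(\<lambda>x. f (x + e)) = f"
    by (intro ext periodicD[OF f(2)]) (simp add: ei)
  also have "cbox 0 (1 + t *\<^sub>R e - e) = cbox 0 1 \<inter> {x. x \<bullet> e \<le> t}"
    using t by (auto simp: mem_box_cart xe ei split: if_splits) (smt (verit))+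
  also have "integral (cbox 0 1 \<inter> {x. t \<le> x \<bullet> e}) f + integral (cbox 0 1 \<inter> {x. x \<bullet> e \<le> t}) f = integral (cbox 0 1) f"
    using integral_split[OF int e, of 0 1 t] by simp
  finally show ?thesis by (simp add: e_def)
qed

text \<open>By \<open>integral_torus_shift\<close> the integral of the shifted function is constant
  in \<open>t\<close>, while differentiating under the integral sign at 0 produces the integral of
  the partial derivative. Shifts are available for \<open>t\<close> in [0,1] only, hence the
  one-sided derivative at an endpoint.\<close>

lemma integral_partial:
  fixes f :: "real ^ 'n::finite \<Rightarrow> complex"
  assumes f: "torus_smooth f"
  shows "integral (cbox 0 1) (partial j f) = 0"
proof -
  have "((\<lambda>t. integral (cbox 0 1) (\<lambda>\<theta>. f (\<theta> + t *\<^sub>R axis j 1))) has_vector_derivative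
      integral (cbox 0 1) (\<lambda>\<theta>. partial j f (\<theta> + 0 *\<^sub>R axis j 1))) (at 0 within {0..1::real})"
  proof (rule leibniz_rule_vector_derivative)
    show "((\<lambda>t. f (\<theta> + t *\<^sub>R axis j 1)) has_vector_derivative partial j f (\<theta> + t *\<^sub>R axis j 1)) (at t within {0..1})" for t \<theta>
      by (intro has_vector_derivative_partial torus_smooth_differentiable f)
    show "(\<lambda>\<theta>. f (\<theta> + t *\<^sub>R axis j 1)) integrable_on cbox 0 1" for t
      by (intro integrable_continuous continuous_on_compose2[OF torus_smooth_continuous[OF f, of UNIV]] continuous_intros) auto
    show "continuous_on ({0..1} \<times> cbox 0 1) (\<lambda>(t, \<theta>). partial j f (\<theta> + t *\<^sub>R axis j 1))"
      unfolding split_beta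
      by (intro continuous_on_compose2[OF torus_smooth_continuous[OF torus_smooth_partial[OF f], of UNIV]] continuous_intros) auto
  qed auto
  moreover have "((\<lambda>t. integral (cbox 0 1) (\<lambda>\<theta>. f (\<theta> + t *\<^sub>R axis j 1))) has_vector_derivative 0) (at 0 within {0..1::real})"
  proof (rule has_vector_derivative_transform[where f = "\<lambda>t. integral (cbox 0 1) f"])
    show "integral (cbox 0 1) (\<lambda>\<theta>. f (\<theta> + t *\<^sub>R axis j 1)) = integral (cbox 0 1) f" if "t \<in> {0..1}" for t
      using integral_torus_shift[of f t j] f that torus_smooth_continuous[OF f, of UNIV] by (auto simp: torus_smooth_def)
  qed auto
  ultimately show ?thesis
    using vector_derivative_unique_within_closed_interval[of 0 1 0 "\<lambda>t. integral (cbox 0 1) (\<lambda>\<theta>. f (\<theta> + t *\<^sub>R axis j 1))"]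
    by (simp add: cbox_interval)
qed

definition fourier_coef :: "(real ^ 'n::finite \<Rightarrow> complex) \<Rightarrow> real ^ 'n \<Rightarrow> complex" where
  "fourier_coef f p = integral (cbox 0 1) (\<lambda>\<theta>. echar (- p) \<theta> * f \<theta>)"

lemma echar_continuous: "continuous_on S (echar p)"
  by (auto simp: continuous_on_eq_continuous_within intro!: differentiable_imp_continuous_within
      differentiable_at_withinI echar_differentiable)

lemma fourier_coef_integrable: "continuous_on UNIV f \<Longrightarrow> (\<lambda>\<theta>. echar p \<theta> * f \<theta>) integrable_on cbox a b"
  by (intro integrable_continuous continuous_intros echar_continuous) (auto intro: continuous_on_subset)

lemma fourier_coef_add:
  "continuous_on UNIV f \<Longrightarrow> continuous_on UNIV g \<Longrightarrow> fourier_coef (\<lambda>\<theta>. f \<theta> + g \<theta>) p = fourier_coef f p + fourier_coef g p"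
  unfolding fourier_coef_def by (simp add: ring_distribs integral_add fourier_coef_integrable)

lemma fourier_coef_cmult: "fourier_coef (\<lambda>\<theta>. c * f \<theta>) p = c * fourier_coef f p"
proof -
  have "(\<lambda>\<theta>. echar (- p) \<theta> * (c * f \<theta>)) = (\<lambda>\<theta>. c * (echar (- p) \<theta> * f \<theta>))" by (simp add: ac_simps)
  then show ?thesis unfolding fourier_coef_def by (simp only: integral_mult_right)
qed

lemma fourier_coef_sum:
  assumes "\<And>i. i \<in> I \<Longrightarrow> continuous_on UNIV (f i)"
  shows "fourier_coef (\<lambda>\<theta>. \<Sum>i\<in>I. f i \<theta>) p = (\<Sum>i\<in>I. fourier_coef (f i) p)"
  using assms
proof (induction I rule: infinite_finite_induct)
  case (insert x F)
  then show ?case by (simp add: fourier_coef_add continuous_on_sum)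
qed (auto simp: fourier_coef_def)

lemma fourier_coef_echar_mult: "fourier_coef (\<lambda>\<theta>. echar q \<theta> * f \<theta>) p = fourier_coef f (p - q)"
proof -
  have "echar (- p) \<theta> * (echar q \<theta> * f \<theta>) = echar (- (p - q)) \<theta> * f \<theta>" for \<theta>
    using echar_add[of "- p" q \<theta>] by simp
  then show ?thesis by (simp only: fourier_coef_def)
qed

lemma measure_unit_cbox: "measure lborel (cbox 0 (1 :: real ^ 'n::finite)) = 1"
  by (subst content_cbox_cart) (auto simp: interval_ne_empty_cart)

lemma norm_fourier_coef_le:
  fixes f :: "real ^ 'n::finite \<Rightarrow> complex"
  assumes "continuous_on UNIV f" "\<And>\<theta>. norm (f \<theta>) \<le> B"
  shows "norm (fourier_coef f p) \<le> B"
proof -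
  have "norm (fourier_coef f p) \<le> B * measure lborel (cbox 0 (1::real ^ 'n))"
    unfolding fourier_coef_def
    by (rule integrable_bound) 
      (use assms norm_ge_zero[of "f 0"] order_trans[OF norm_ge_zero assms(2)[of 0]] in \<open>auto simp: norm_mult fourier_coef_integrable intro: order_trans\<close>)
  then show ?thesis by (simp add: measure_unit_cbox)
qed

text \<open>Integration by parts: the derivative of the product with \<open>echar (- p)\<close> has
  integral 0.\<close>

lemma fourier_coef_partial:
  assumes f: "torus_smooth f" and p: "p \<in> zlat"
  shows "fourier_coef (partial j f) p = 2 * of_real pi * \<i> * of_real (p $ j) * fourier_coef f p"
proof -
  have sm: "torus_smooth (echar (- p))"
    using p by (intro torus_smooth_echar zlat_minus)
  have "partial j (\<lambda>\<theta>. echar (- p) \<theta> * f \<theta>) =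
      (\<lambda>\<theta>. echar (- p) \<theta> * partial j f \<theta> + (- (2 * of_real pi * \<i> * of_real (p $ j))) * (echar (- p) \<theta> * f \<theta>))"
    by (rule ext, subst partial_mult)
      (auto simp: partial_echar torus_smooth_differentiable f sm algebra_simps)
  then have "0 = integral (cbox 0 1) (\<lambda>\<theta>. echar (- p) \<theta> * partial j f \<theta> + (- (2 * of_real pi * \<i> * of_real (p $ j))) * (echar (- p) \<theta> * f \<theta>))"
    using integral_partial[OF torus_smooth_mult[OF sm f], of j] by simp
  also have "\<dots> = fourier_coef (partial j f) p + (- (2 * of_real pi * \<i> * of_real (p $ j))) * fourier_coef f p"
    unfolding fourier_coef_def
    by (subst integral_add, intro fourier_coef_integrable torus_smooth_continuous torus_smooth_partial f,
        intro integrable_on_mult_right fourier_coef_integrable torus_smooth_continuous torus_smooth_partial f)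
      simp
  finally show ?thesis by (simp add: eq_neg_iff_add_eq_0)
qed

text \<open>For nonzero \<open>p\<close> no integral is evaluated:
  \<open>fourier_coef_partial\<close> for a constant function says that a nonzero multiple of the
  coefficient vanishes.\<close>

lemma fourier_coef_const_0: "p \<in> zlat \<Longrightarrow> fourier_coef (\<lambda>_. 1) p = (if p = 0 then 1 else 0)"
proof (cases "p = 0")
  case True
  with measure_unit_cbox[where 'n='a] show ?thesis by (simp add: fourier_coef_def)
next
  case False
  assume p: "p \<in> zlat"
  from False obtain j where "p $ j \<noteq> 0" by (auto simp: vec_eq_iff)
  moreover have "partial j (\<lambda>_::real^'a. 1) = (\<lambda>_. 0)" by auto
  ultimately have "fourier_coef (\<lambda>_::real^'a. 1) p = 0"
    using fourier_coef_partial[OF torus_smooth_const p, of j 1] by (simp add: fourier_coef_def)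
  with False show ?thesis by simp
qed

lemma fourier_coef_echar:
  assumes "p \<in> zlat" "q \<in> zlat"
  shows "fourier_coef (echar q) p = (if p = q then 1 else 0)"
  using fourier_coef_echar_mult[of q "\<lambda>_. 1" p] fourier_coef_const_0[of "p - q"] assms by (simp add: zlat_diff)

text \<open>The powers of the trigonometric polynomial \<open>T\<close> concentrate at \<open>x\<close>.\<close>

lemma fourier_coef_eq_0_imp_eq_0_interior:
  fixes f :: "real ^ 'n::finite \<Rightarrow> complex"
  assumes f: "continuous_on UNIV f" "periodic f" and zero: "\<And>p. p \<in> zlat \<Longrightarrow> fourier_coef f p = 0"
    and x: "x \<in> box 0 1"
  shows "f x = 0"
proof (rule ccontr)
  assume nz: "f x \<noteq> 0"
  define n where "n = real CARD('n)"
  have n: "n > 0" by (simp add: n_def)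
  \<comment> \<open>Normalised to take values in [0,1], with value 1 at \<open>x\<close> and
    otherwise only at the translates of \<open>x\<close> by integer vectors.\<close>
  define T where "T = (\<lambda>\<theta>::real^'n. (\<Sum>j\<in>UNIV. 1 + cos (2 * pi * (\<theta> $ j - x $ j))) / (2 * n))"
  have T_cont: "continuous_on S T" for S
    unfolding T_def by (intro continuous_intros) (use n in auto)
  have T0: "0 \<le> T \<theta>" for \<theta>
    using n by (auto simp: T_def intro!: divide_nonneg_nonneg sum_nonneg) (smt (verit) cos_ge_minus_one)
  have T1: "T \<theta> \<le> 1" for \<theta>
  proof -
    have "(\<Sum>j\<in>UNIV. 1 + cos (2 * pi * (\<theta> $ j - x $ j))) \<le> (\<Sum>j\<in>(UNIV::'n set). 2)"
      by (intro sum_mono) (smt (verit) cos_le_one)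
    then show ?thesis using n by (simp add: T_def n_def divide_simps)
  qed
  have T_eq_1: "\<theta> - x \<in> zlat" if "T \<theta> = 1" for \<theta>
  proof -
    have "(\<Sum>j\<in>UNIV. 1 - cos (2 * pi * (\<theta> $ j - x $ j))) = 0"
      using that n by (simp add: T_def n_def divide_simps sum.distrib sum_subtractf)
    then have "cos (2 * pi * (\<theta> $ j - x $ j)) = 1" for j
      by (subst (asm) sum_nonneg_eq_0_iff) (auto)
    then have "\<exists>m. \<theta> $ j - x $ j = of_int m" for j
      by (simp add: cos_one_2pi_int)
    then show ?thesis unfolding zlat_def by (auto simp: Ints_def)
  qed
  \<comment> \<open>Vanishing of all Fourier coefficients survives multiplication by
    \<open>T\<close>, because \<open>T\<close> is a combination of the characters at 0 and at plus
    or minus the unit vectors.\<close>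
  define Z where "Z = (\<lambda>g::real^'n \<Rightarrow> complex. continuous_on UNIV g \<and> (\<forall>p\<in>zlat. fourier_coef g p = 0))"
  have Z_mult: "Z (\<lambda>\<theta>. of_real (T \<theta>) * g \<theta>)" if g: "Z g" for g
  proof -
    define c where "c = (\<lambda>j. cis (- 2 * pi * x $ j))"
    have cos: "complex_of_real (cos (2 * pi * (\<theta> $ j - x $ j))) =
        (c j * echar (axis j 1) \<theta> + cnj (c j) * echar (- axis j 1) \<theta>) / 2" for j \<theta>
      by (auto simp: complex_eq_iff c_def echar_def inner_axis inner_commute[of "axis j 1"] cis.ctr
          cos_add sin_add ring_distribs cos_diff algebra_simps)
    have eq: "(\<lambda>\<theta>. of_real (T \<theta>) * g \<theta>) = (\<lambda>\<theta>. \<Sum>j\<in>UNIV. 1 / (2 * of_real n) * (g \<theta> +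
       (c j / 2) * (echar (axis j 1) \<theta> * g \<theta>) + (cnj (c j) / 2) * (echar (- axis j 1) \<theta> * g \<theta>)))"
      by (rule ext, unfold T_def, simp add: cos sum_distrib_right sum_divide_distrib, rule sum.cong[OF refl])
        (use n in \<open>simp add: field_simps\<close>)
    have c0: "fourier_coef (\<lambda>\<theta>. \<Sum>j\<in>UNIV. 1 / (2 * of_real n) * (g \<theta> +
       (c j / 2) * (echar (axis j 1) \<theta> * g \<theta>) + (cnj (c j) / 2) * (echar (- axis j 1) \<theta> * g \<theta>))) p = 0"
      if "p \<in> zlat" for p
    proof -
      have gc: "continuous_on UNIV g" and g0: "\<And>q. q \<in> zlat \<Longrightarrow> fourier_coef g q = 0"
        using g by (auto simp: Z_def)
      have c1: "continuous_on UNIV (\<lambda>\<theta>. a * (echar q \<theta> * g \<theta>))" for a q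
        by (intro continuous_intros echar_continuous gc)
      have "fourier_coef (\<lambda>\<theta>. g \<theta> + (c j / 2) * (echar (axis j 1) \<theta> * g \<theta>)
          + (cnj (c j) / 2) * (echar (- axis j 1) \<theta> * g \<theta>)) p = 0" for j
        using that by (simp only: fourier_coef_add continuous_on_add gc c1 fourier_coef_cmult fourier_coef_echar_mult
          g0 zlat_diff zlat_minus zlat_axis) simp
      then show ?thesis
        by (subst fourier_coef_sum) (auto simp only: fourier_coef_cmult intro!: continuous_intros echar_continuous gc, simp)
    qed
    have "continuous_on UNIV (\<lambda>\<theta>. of_real (T \<theta>) * g \<theta>)"
      using g by (auto simp: Z_def intro!: continuous_intros T_cont)
    moreover have "\<forall>p\<in>zlat. fourier_coef (\<lambda>\<theta>. of_real (T \<theta>) * g \<theta>) p = 0"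
      unfolding eq using c0 by blast
    ultimately show ?thesis unfolding Z_def by blast
  qed
  have Z: "Z (\<lambda>\<theta>. of_real (T \<theta> ^ N) * f \<theta>)" for N
  proof (induction N)
    case 0
    then show ?case using f zero by (simp add: Z_def)
  next
    case (Suc N)
    from Z_mult[OF Suc] show ?case by (simp add: mult.assoc)
  qed
  \<comment> \<open>Multiplication by the conjugate of \<open>f x\<close> reduces the contradiction
    to a real function that is positive at \<open>x\<close>, with
    \<open>F x = 2 * a\<close>.\<close>
  define F where "F = (\<lambda>\<theta>. Re (cnj (f x) * f \<theta>))"
  define a where "a = (norm (f x))\<^sup>2 / 2"
  have a: "a > 0" using nz by (simp add: a_def)
  have Fx: "F x = 2 * a" using cmod_power2[of "f x"] by (simp add: F_def a_def power2_eq_square)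
  have F_cont: "continuous_on S F" for S
    unfolding F_def by (intro continuous_intros continuous_on_subset[OF f(1)]) auto
  obtain b0 where b0: "b0 \<ge> 0" "\<And>\<theta>. norm (f \<theta>) \<le> b0" using torus_bounded[OF f] by blast
  define b where "b = norm (f x) * b0"
  have b: "- b \<le> F \<theta>" "b \<ge> 0" for \<theta>
  proof -
    have "\<bar>F \<theta>\<bar> \<le> norm (cnj (f x) * f \<theta>)" unfolding F_def by (rule abs_Re_le_cmod)
    also have "\<dots> \<le> b" using b0 by (auto simp: b_def norm_mult intro: mult_left_mono)
    finally show "- b \<le> F \<theta>" by simp
  qed (use b0 in \<open>simp add: b_def\<close>)
  have int0: "integral (cbox 0 1) (\<lambda>\<theta>. F \<theta> * T \<theta> ^ N) = 0" for N
  proof -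
    have "integral (cbox 0 1) (\<lambda>\<theta>. of_real (T \<theta> ^ N) * f \<theta>) = 0"
      using Z[of N] zlat_0 by (auto simp: Z_def fourier_coef_def)
    moreover have int: "(\<lambda>\<theta>. of_real (T \<theta> ^ N) * f \<theta>) integrable_on cbox 0 1"
      by (intro integrable_continuous continuous_intros T_cont continuous_on_subset[OF f(1)]) auto
    ultimately have "((\<lambda>\<theta>. of_real (T \<theta> ^ N) * f \<theta>) has_integral 0) (cbox 0 1)"
      by (metis integrable_integral)
    from has_integral_linear[OF has_integral_mult_right[OF this, of "cnj (f x)"] bounded_linear_Re]
    have "((\<lambda>\<theta>. Re (cnj (f x) * (of_real (T \<theta> ^ N) * f \<theta>))) has_integral Re (cnj (f x) * 0)) (cbox 0 1)"
      by (simp only: o_def)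
    moreover have "Re (cnj (f x) * (of_real (T \<theta> ^ N) * f \<theta>)) = F \<theta> * T \<theta> ^ N" for \<theta>
      by (simp add: F_def algebra_simps)
    ultimately show ?thesis by (simp add: integral_unique)
  qed
  \<comment> \<open>Here \<open>F\<close> is at most half its value at \<open>x\<close>. By
    periodicity of \<open>f\<close> no point of \<open>W\<close> is an integer translate of
    \<open>x\<close>, so compactness keeps \<open>T\<close> below some \<open>s < 1\<close> on
    \<open>W\<close>.\<close>
  define W where "W = {\<theta> \<in> cbox 0 1. F \<theta> \<le> a}"
  have "closed {\<theta>. F \<theta> \<le> a}"
    by (intro closed_Collect_le F_cont continuous_on_const)
  then have "compact (cbox 0 1 \<inter> {\<theta>. F \<theta> \<le> a})"
    by (intro compact_Int_closed) auto
  then have "compact W"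
    by (simp add: W_def Int_def)
  have W1: "T \<theta> < 1" if "\<theta> \<in> W" for \<theta>
  proof -
    have "T \<theta> \<noteq> 1"
    proof
      assume "T \<theta> = 1"
      from T_eq_1[OF this] have "f (x + (\<theta> - x)) = f x"
        by (intro periodicD[OF f(2)]) (auto simp: zlat_def)
      then have "F \<theta> = F x" by (simp add: F_def)
      then show False using that a Fx by (simp add: W_def)
    qed
    with T1[of \<theta>] show ?thesis by simp
  qed
  obtain s where s: "0 \<le> s" "s < 1" "\<And>\<theta>. \<theta> \<in> W \<Longrightarrow> T \<theta> \<le> s"
  proof (cases "W = {}")
    case False
    obtain y where "y \<in> W" "\<forall>\<theta>\<in>W. T \<theta> \<le> T y"
      using continuous_attains_sup[OF \<open>compact W\<close> False T_cont] by auto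
    then show ?thesis using that[of "T y"] W1 T0 by auto
  qed (use that[of 0] in auto)
  \<comment> \<open>Close to \<open>x\<close> the values of \<open>T\<close> exceed this midpoint,
    so the contribution from there decays no faster than \<open>s' ^ N\<close>, whereas on
    \<open>W\<close> it decays like \<open>s ^ N\<close>.\<close>
  define s' where "s' = (s + 1) / 2"
  have s': "s < s'" "s' < 1" "0 < s'" using s by (auto simp: s'_def)
  have Tx: "T x = 1" using n by (simp add: T_def n_def)
  have "open ({\<theta>. s' < T \<theta>} \<inter> {\<theta>. a < F \<theta>} \<inter> box 0 1)"
    by (intro open_Int open_Collect_less F_cont T_cont continuous_on_const open_box)
  moreover have "x \<in> {\<theta>. s' < T \<theta>} \<inter> {\<theta>. a < F \<theta>} \<inter> box 0 1"
    using x Tx Fx a s' by auto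
  ultimately obtain c d where cd: "cbox c d \<subseteq> {\<theta>. s' < T \<theta>} \<inter> {\<theta>. a < F \<theta>} \<inter> box 0 1" "x \<in> box c d"
    using open_contains_cbox by metis
  define V where "V = measure lborel (cbox c d)"
  have "V > 0" using cd(2) unfolding V_def
    by (subst content_pos_lt_eq) (auto simp: mem_box intro: less_trans)
  \<comment> \<open>The integral of \<open>F\<close> against \<open>T ^ N\<close> is 0, so the
    positive contribution of the small box around \<open>x\<close> must be outweighed by
    \<open>W\<close>, which offers at most \<open>b * s ^ N\<close>; elsewhere the integrand is
    nonnegative. That \<open>x\<close> is interior lets the small box lie inside the unit
    cube.\<close>
  have key: "a * s' ^ N * V \<le> b * s ^ N" for N
  proof -
    have "((\<lambda>\<theta>. if \<theta> \<in> cbox c d then a * s' ^ N else 0) has_integral (measure lborel (cbox c d) *\<^sub>R (a * s' ^ N))) (cbox 0 1)"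
      using cd box_subset_cbox[of 0 1] by (intro has_integral_restrict_closed_subinterval has_integral_const) blast
    moreover have "((\<lambda>\<theta>::real^'n. b * s ^ N) has_integral (measure lborel (cbox 0 (1::real^'n)) *\<^sub>R (b * s ^ N))) (cbox 0 1)"
      by (rule has_integral_const)
    ultimately have L: "((\<lambda>\<theta>. (if \<theta> \<in> cbox c d then a * s' ^ N else 0) - b * s ^ N) has_integral (V * (a * s' ^ N) - b * s ^ N)) (cbox 0 1)"
      unfolding measure_unit_cbox V_def by (auto dest: has_integral_diff)
    have "((\<lambda>\<theta>. F \<theta> * T \<theta> ^ N) has_integral 0) (cbox 0 1)"
      unfolding int0[of N, symmetric]
      by (intro integrable_integral integrable_continuous continuous_intros F_cont T_cont)
    then have "V * (a * s' ^ N) - b * s ^ N \<le> 0"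
    proof (rule has_integral_le[OF L])
      fix \<theta> :: "real^'n" assume \<theta>: "\<theta> \<in> cbox 0 1"
      show "(if \<theta> \<in> cbox c d then a * s' ^ N else 0) - b * s ^ N \<le> F \<theta> * T \<theta> ^ N"
      proof (cases "\<theta> \<in> W")
        case True
        then have "\<theta> \<notin> cbox c d" using cd by (auto simp: W_def)
        moreover have "- b * s ^ N \<le> - b * T \<theta> ^ N"
          using b(2) s(3)[OF True] T0[of \<theta>] by (simp add: mult_left_mono power_mono)
        moreover have "- b * T \<theta> ^ N \<le> F \<theta> * T \<theta> ^ N"
          using b(1) T0[of \<theta>] by (intro mult_right_mono) auto
        ultimately show ?thesis by simp
      next
        case False
        then have F: "F \<theta> > a" using \<theta> by (auto simp: W_def)
        have "(if \<theta> \<in> cbox c d then a * s' ^ N else 0) \<le> F \<theta> * T \<theta> ^ N"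
        proof (cases "\<theta> \<in> cbox c d")
          case True
          then have "s' < T \<theta>" using cd by auto
          then show ?thesis using True F a s' by (auto intro!: mult_mono power_mono)
        qed (use F a T0[of \<theta>] in auto)
        moreover have "0 \<le> b * s ^ N" using b s by simp
        ultimately show ?thesis by linarith
      qed
    qed
    then show ?thesis by (simp add: algebra_simps)
  qed
  have "(\<lambda>N. b * (s / s') ^ N) \<longlonglongrightarrow> b * 0"
    using s s' by (intro tendsto_intros LIMSEQ_power_zero) auto
  moreover have "a * V \<le> b * (s / s') ^ N" for N
    using key[of N] s' by (simp add: power_divide divide_simps algebra_simps)
  ultimately have "a * V \<le> b * 0"
    by (intro LIMSEQ_le_const) auto
  with a \<open>V > 0\<close> show False by (simp add: mult_le_0_iff)
qed

text \<open>The interior case extends to the closed cube because the zero set is closed, and to all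
  points by periodicity.\<close>

lemma fourier_coef_eq_0_imp_eq_0:
  fixes f :: "real ^ 'n::finite \<Rightarrow> complex"
  assumes f: "continuous_on UNIV f" "periodic f" and zero: "\<And>p. p \<in> zlat \<Longrightarrow> fourier_coef f p = 0"
  shows "f \<theta> = 0"
proof -
  have *: "f y = 0" if "y \<in> cbox 0 1" for y
  proof -
    have "box 0 (1::real^'n) \<noteq> {}" by (auto simp: interval_ne_empty_cart)
    then have "y \<in> closure (box 0 1)" using that by (simp add: closure_box)
    moreover have "closure (box 0 1) \<subseteq> {y. f y = 0}"
      by (intro closure_minimal closed_Collect_eq f continuous_on_const)
        (use fourier_coef_eq_0_imp_eq_0_interior[OF f zero] in auto)
    ultimately show ?thesis by auto
  qed
  define m where "m = (\<chi> j. - of_int \<lfloor>\<theta> $ j\<rfloor> :: real ^ 'n)"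
  have "\<theta> + m \<in> cbox 0 1"
    by (auto simp: m_def mem_box_cart algebra_simps) linarith+
  moreover have "f (\<theta> + m) = f \<theta>"
    by (rule periodicD[OF f(2)]) (simp add: m_def)
  ultimately show ?thesis using *[of "\<theta> + m"] by simp
qed

lemma fourier_coef_diff:
  "continuous_on UNIV f \<Longrightarrow> continuous_on UNIV g \<Longrightarrow> fourier_coef (\<lambda>\<theta>. f \<theta> - g \<theta>) p = fourier_coef f p - fourier_coef g p"
  using fourier_coef_add[of f "\<lambda>\<theta>. -1 * g \<theta>" p] fourier_coef_cmult[of "-1" g p] continuous_on_minus[of UNIV g] by simp

lemma fourier_coef_eqI:
  assumes "continuous_on UNIV f" "periodic f" "continuous_on UNIV g" "periodic g"
    and "\<And>p. p \<in> zlat \<Longrightarrow> fourier_coef f p = fourier_coef g p"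
  shows "f = g"
proof
  fix \<theta>
  have "f \<theta> - g \<theta> = 0"
    by (rule fourier_coef_eq_0_imp_eq_0[of "\<lambda>\<theta>. f \<theta> - g \<theta>"])
      (use assms in \<open>auto simp: fourier_coef_diff periodic_def intro: continuous_intros\<close>)
  then show "f \<theta> = g \<theta>" by simp
qed

lemma torus_smooth_fourier_coef_eqI:
  "torus_smooth f \<Longrightarrow> torus_smooth g \<Longrightarrow> (\<And>p. p \<in> zlat \<Longrightarrow> fourier_coef f p = fourier_coef g p) \<Longrightarrow> f = g"
  by (rule fourier_coef_eqI) (auto intro: torus_smooth_continuous simp: torus_smooth_def)

text \<open>Only pure derivatives are needed, since the largest coordinate of \<open>p\<close>
  controls \<open>norm p\<close> up to the factor \<open>CARD('n)\<close>. The constant is explicit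
  and linear in \<open>B\<close> because \<open>B\<close> will later depend on the lattice point
  \<open>k\<close>.\<close>

lemma fourier_coef_decay:
  fixes f :: "real ^ 'n::finite \<Rightarrow> complex"
  assumes f: "torus_smooth f" and p: "p \<in> zlat"
    and B0: "\<And>\<theta>. norm (f \<theta>) \<le> B"
    and B: "\<And>j \<theta>. norm ((partial j ^^ P) f \<theta>) \<le> B"
  shows "norm (fourier_coef f p) * (1 + norm p) ^ P \<le> (2 * real CARD('n)) ^ P * (2 * B)"
proof -
  have sm: "torus_smooth ((partial j ^^ m) f)" for j m
    by (induction m) (auto intro: f torus_smooth_partial)
  have c: "fourier_coef ((partial j ^^ m) f) p = (2 * of_real pi * \<i> * of_real (p $ j)) ^ m * fourier_coef f p" for j m
    by (induction m) (auto simp: fourier_coef_partial[OF sm p])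
  have cB0: "norm (fourier_coef f p) \<le> B"
    by (intro norm_fourier_coef_le torus_smooth_continuous f B0)
  have B_nn: "B \<ge> 0" using norm_ge_zero B0 order_trans by blast
  have cB: "norm (fourier_coef f p) * \<bar>p $ j\<bar> ^ P \<le> B" for j
  proof -
    have "norm (fourier_coef f p) * \<bar>p $ j\<bar> ^ P \<le> norm (fourier_coef f p) * (2 * pi * \<bar>p $ j\<bar>) ^ P"
      using pi_ge_two by (intro mult_left_mono power_mono) (auto intro!: mult_le_cancel_right1[THEN iffD2])
    also have "\<dots> = norm (fourier_coef ((partial j ^^ P) f) p)"
      by (simp add: c norm_mult norm_power)
    also have "\<dots> \<le> B"
      by (intro norm_fourier_coef_le torus_smooth_continuous sm B)
    finally show ?thesis .
  qed
  obtain i where i: "\<And>j. \<bar>p $ j\<bar> \<le> \<bar>p $ i\<bar>"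
  proof -
    have "Max (range (\<lambda>j. \<bar>p $ j\<bar>)) \<in> range (\<lambda>j. \<bar>p $ j\<bar>)" by (intro Max_in) auto
    then obtain i where "Max (range (\<lambda>j. \<bar>p $ j\<bar>)) = \<bar>p $ i\<bar>" by blast
    moreover have "\<bar>p $ j\<bar> \<le> Max (range (\<lambda>j. \<bar>p $ j\<bar>))" for j by (intro Max_ge) auto
    ultimately show ?thesis using that by metis
  qed
  have "norm p \<le> (\<Sum>j\<in>UNIV. \<bar>p $ j\<bar>)" by (rule norm_le_l1_cart)
  also have "\<dots> \<le> real CARD('n) * \<bar>p $ i\<bar>" using sum_bounded_above[of UNIV "\<lambda>j. \<bar>p $ j\<bar>", OF i] by simp
  finally have np: "norm p \<le> real CARD('n) * \<bar>p $ i\<bar>" .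
  have n1: "real CARD('n) \<ge> 1" using zero_less_card_finite[where 'a='n] by linarith
  \<comment> \<open>The maximum with 1 covers \<open>p = 0\<close>, where derivatives yield nothing
    and the bound on \<open>f\<close> itself is used.\<close>
  have "1 + norm p \<le> (2 * real CARD('n)) * max 1 \<bar>p $ i\<bar>"
  proof -
    have "1 \<le> real CARD('n) * max 1 \<bar>p $ i\<bar>" using n1 mult_mono[of 1 "real CARD('n)" 1 "max 1 \<bar>p $ i\<bar>"] by simp
    moreover have "real CARD('n) * \<bar>p $ i\<bar> \<le> real CARD('n) * max 1 \<bar>p $ i\<bar>" by (intro mult_left_mono) auto
    ultimately show ?thesis using np by linarith
  qed
  then have "(1 + norm p) ^ P \<le> ((2 * real CARD('n)) * max 1 \<bar>p $ i\<bar>) ^ P"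
    by (intro power_mono) (auto intro: add_nonneg_nonneg)
  then have "norm (fourier_coef f p) * (1 + norm p) ^ P \<le> norm (fourier_coef f p) * ((2 * real CARD('n)) * max 1 \<bar>p $ i\<bar>) ^ P"
    by (intro mult_left_mono) auto
  also have "\<dots> = (2 * real CARD('n)) ^ P * (norm (fourier_coef f p) * max 1 \<bar>p $ i\<bar> ^ P)"
    by (simp add: power_mult_distrib)
  also have "\<dots> \<le> (2 * real CARD('n)) ^ P * (2 * B)"
    using cB0 cB[of i] B_nn by (intro mult_left_mono) (auto simp: max_def)
  finally show ?thesis .
qed

section \<open>Absolutely convergent series over the integer lattice, and Fourier inversion\<close>

lemma inverse_square_summable_on_Ints: "(\<lambda>x::real. 1 / (1 + x\<^sup>2)) summable_on \<int>"
proof -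
  have sq: "summable (\<lambda>n::nat. 1 / (1 + (real n)\<^sup>2))"
  proof (rule summable_comparison_test'[where N = 1])
    show "summable (\<lambda>n::nat. inverse (real n ^ 2))" by (rule inverse_power_summable) simp
    show "norm (1 / (1 + (real n)\<^sup>2)) \<le> inverse (real n ^ 2)" if "n \<ge> 1" for n
      using that by (simp add: divide_simps add_pos_nonneg not_less)
  qed
  then have sq': "(\<lambda>n::nat. 1 / (1 + (real n)\<^sup>2)) summable_on UNIV"
    by (subst summable_on_UNIV_nonneg_real_iff) auto
  have "(\<lambda>x::real. 1 / (1 + x\<^sup>2)) summable_on (range real)"
    using sq' by (subst summable_on_reindex) (auto simp: o_def)
  moreover have "(\<lambda>x::real. 1 / (1 + x\<^sup>2)) summable_on (range (\<lambda>n. - real n))"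
    using sq' by (subst summable_on_reindex) (auto simp: o_def inj_def)
  ultimately have "(\<lambda>x::real. 1 / (1 + x\<^sup>2)) summable_on (range real \<union> range (\<lambda>n. - real n))"
    by (rule summable_on_union)
  moreover have "\<int> \<subseteq> range real \<union> range (\<lambda>n. - real n)"
  proof
    fix x :: real assume "x \<in> \<int>"
    then obtain z where "x = of_int z" by (auto elim: Ints_cases)
    then show "x \<in> range real \<union> range (\<lambda>n. - real n)"
      by (cases z) (auto simp: image_iff intro: exI[of _ "Suc _"])
  qed
  ultimately show ?thesis by (rule summable_on_subset)
qed

text \<open>The exponent is 2 for each coordinate, so that the weight is dominated by the product of
  the one-dimensional functions \<open>1 / (1 + x^2)\<close>. It serves as the common summable
  majorant.\<close>

definition zlat_weight :: "real ^ 'n::finite \<Rightarrow> real" where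
  "zlat_weight p = 1 / (1 + norm p) ^ (2 * CARD('n))"

lemma zlat_weight_pos: "zlat_weight p > 0"
  unfolding zlat_weight_def by (intro divide_pos_pos zero_less_power) (auto intro: add_pos_nonneg)

text \<open>A finite set of lattice points lies in the product of its coordinate projections, over
  which the sum of products factors into one-dimensional sums.\<close>

lemma zlat_weight_summable: "(zlat_weight :: real ^ 'n::finite \<Rightarrow> real) summable_on zlat"
proof (rule nonneg_bdd_above_summable_on)
  show "0 \<le> zlat_weight p" for p :: "real ^ 'n" using zlat_weight_pos[of p] by simp
  define S where "S = (\<Sum>\<^sub>\<infinity>x\<in>\<int>. 1 / (1 + (x::real)\<^sup>2))"
  show "bdd_above (sum zlat_weight ` {F. F \<subseteq> (zlat :: (real ^ 'n) set) \<and> finite F})"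
  proof (rule bdd_aboveI2)
    fix F :: "(real ^ 'n) set" assume "F \<in> {F. F \<subseteq> zlat \<and> finite F}"
    then have F: "F \<subseteq> zlat" "finite F" by auto
    define B where "B = (\<lambda>j. (\<lambda>p. p $ j) ` F)"
    have B: "finite (B j)" "B j \<subseteq> \<int>" for j
      using F by (auto simp: B_def zlat_def)
    have le: "zlat_weight p \<le> (\<Prod>j\<in>UNIV. 1 / (1 + (p $ j)\<^sup>2))" for p :: "real ^ 'n"
    proof -
      have "1 + (p $ j)\<^sup>2 \<le> (1 + norm p)\<^sup>2" for j
      proof -
        have "\<bar>p $ j\<bar>\<^sup>2 \<le> (norm p)\<^sup>2" by (intro power_mono component_le_norm_cart) auto
        then show ?thesis using norm_ge_zero[of p] by (simp add: power2_sum del: norm_ge_zero)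
      qed
      then have "(\<Prod>j\<in>(UNIV::'n set). 1 / (1 + norm p)\<^sup>2) \<le> (\<Prod>j\<in>UNIV. 1 / (1 + (p $ j)\<^sup>2))"
        by (intro prod_mono) (auto intro!: divide_left_mono mult_pos_pos add_pos_nonneg simp: zero_less_power2 add_nonneg_eq_0_iff)
      then show ?thesis by (simp add: zlat_weight_def power_mult power_one_over flip: power_mult)
    qed
    have "sum zlat_weight F \<le> (\<Sum>p\<in>F. \<Prod>j\<in>UNIV. 1 / (1 + (p $ j)\<^sup>2))"
      by (intro sum_mono le)
    also have "\<dots> = (\<Sum>g\<in>(\<lambda>p j. p $ j) ` F. \<Prod>j\<in>UNIV. 1 / (1 + (g j)\<^sup>2))"
      by (subst sum.reindex) (auto simp: inj_on_def vec_eq_iff fun_eq_iff)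
    also have "\<dots> \<le> (\<Sum>g\<in>PiE UNIV B. \<Prod>j\<in>UNIV. 1 / (1 + (g j)\<^sup>2))"
      using B by (intro sum_mono2 finite_PiE) (auto simp: B_def intro!: prod_nonneg)
    also have "\<dots> = (\<Prod>j\<in>UNIV. \<Sum>x\<in>B j. 1 / (1 + x\<^sup>2))"
      by (intro prod_sum_PiE[symmetric] B) auto
    also have "\<dots> \<le> (\<Prod>j\<in>(UNIV::'n set). S)"
      unfolding S_def
      by (intro prod_mono conjI sum_nonneg finite_sum_le_infsum inverse_square_summable_on_Ints B) auto
    finally show "sum zlat_weight F \<le> (\<Prod>j\<in>(UNIV::'n set). S)" .
  qed
qed

text \<open>A summable real family has countable support, and the weight vanishes nowhere.\<close>

lemma countable_zlat: "countable (zlat :: (real ^ 'n::finite) set)"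
proof -
  have "countable {p \<in> (zlat :: (real ^ 'n) set). zlat_weight p \<noteq> 0}"
    by (rule summable_countable_real[OF zlat_weight_summable])
  moreover have "{p \<in> (zlat :: (real ^ 'n) set). zlat_weight p \<noteq> 0} = zlat"
    using zlat_weight_pos by (force simp: less_le)
  ultimately show ?thesis by simp
qed

lemma infinite_zlat: "infinite (zlat :: (real ^ 'n::finite) set)"
proof -
  have "inj (\<lambda>m::nat. (vec (real m)) :: real ^ 'n)" by (auto simp: inj_def vec_eq_iff)
  then have "infinite (range (\<lambda>m::nat. (vec (real m)) :: real ^ 'n))" by (rule range_inj_infinite)
  moreover have "range (\<lambda>m::nat. (vec (real m)) :: real ^ 'n) \<subseteq> zlat" by (auto simp: zlat_def)
  ultimately show ?thesis using finite_subset by blast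
qed

lemma zlat_weight_comparison:
  fixes g :: "real ^ 'n::finite \<Rightarrow> 'b::banach"
  assumes "\<And>p. p \<in> zlat \<Longrightarrow> norm (g p) * (1 + norm p) ^ (2 * CARD('n)) \<le> C"
  shows "(\<lambda>p. norm (g p)) summable_on zlat"
    and "g summable_on zlat"
    and "norm (infsum g zlat) \<le> C * infsum zlat_weight (zlat :: (real ^ 'n) set)"
proof -
  have le: "norm (g p) \<le> C * zlat_weight p" if "p \<in> zlat" for p
  proof -
    have "(1 + norm p) ^ (2 * CARD('n)) > 0" by (intro zero_less_power) (auto intro: add_pos_nonneg)
    with assms[OF that] show ?thesis by (simp add: zlat_weight_def divide_simps)
  qed
  have sC: "((\<lambda>p::real ^ 'n. C * zlat_weight p) has_sum (C * infsum zlat_weight (zlat :: (real ^ 'n) set))) zlat"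
    by (rule has_sum_cmult_right[OF has_sum_infsum[OF zlat_weight_summable]])
  then show s: "(\<lambda>p. norm (g p)) summable_on zlat"
    using le by (intro summable_on_comparison_test[OF has_sum_imp_summable]) auto
  then show s': "g summable_on zlat" by (rule abs_summable_summable)
  show "norm (infsum g zlat) \<le> C * infsum zlat_weight (zlat :: (real ^ 'n) set)"
    by (rule norm_infsum_le[OF has_sum_infsum[OF s'] sC le])
qed

lemma infsum_continuous_integral:
  fixes w :: "'i \<Rightarrow> real ^ 'n::finite \<Rightarrow> complex" and a b :: "real ^ 'n"
  assumes cont: "\<And>p. p \<in> A \<Longrightarrow> continuous_on UNIV (w p)"
    and M: "\<And>p \<theta>. p \<in> A \<Longrightarrow> norm (w p \<theta>) \<le> M p" "M summable_on A"
  shows "continuous_on UNIV (\<lambda>\<theta>. \<Sum>\<^sub>\<infinity>p\<in>A. w p \<theta>)"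
    and "((\<lambda>p. integral (cbox a b) (w p)) has_sum integral (cbox a b) (\<lambda>\<theta>. \<Sum>\<^sub>\<infinity>p\<in>A. w p \<theta>)) A"
proof -
  have ul: "uniform_limit U (\<lambda>X \<theta>. \<Sum>p\<in>X. w p \<theta>) (\<lambda>\<theta>. \<Sum>\<^sub>\<infinity>p\<in>A. w p \<theta>) (finite_subsets_at_top A)" for U
    by (rule Weierstrass_m_test_general[OF M])
  show "continuous_on UNIV (\<lambda>\<theta>. \<Sum>\<^sub>\<infinity>p\<in>A. w p \<theta>)"
    by (rule uniform_limit_theorem[OF _ ul])
      (auto intro!: eventually_finite_subsets_at_top_weakI continuous_on_sum cont)
  \<comment> \<open>Extension by 0 makes the partial sums continuous over every index set, also
    those not contained in \<open>A\<close>; the rule for interchanging limit and integral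
    quantifies over all of them.\<close>
  define w' where "w' = (\<lambda>p. if p \<in> A then w p else (\<lambda>_. 0))"
  have w'_cont: "continuous_on U (w' p)" for p U
    using cont by (auto simp: w'_def intro: continuous_on_subset)
  have "uniform_limit (cbox a b) (\<lambda>X \<theta>. \<Sum>p\<in>X. w' p \<theta>) (\<lambda>\<theta>. \<Sum>\<^sub>\<infinity>p\<in>A. w' p \<theta>) (finite_subsets_at_top A)"
    by (rule Weierstrass_m_test_general[OF _ M(2)]) (auto simp: w'_def M)
  moreover have "(\<lambda>\<theta>. \<Sum>\<^sub>\<infinity>p\<in>A. w' p \<theta>) = (\<lambda>\<theta>. \<Sum>\<^sub>\<infinity>p\<in>A. w p \<theta>)"
    by (auto simp: w'_def intro!: infsum_cong)
  ultimately obtain I J where I: "\<And>X. ((\<lambda>\<theta>. \<Sum>p\<in>X. w' p \<theta>) has_integral I X) (cbox a b)"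
      "((\<lambda>\<theta>. \<Sum>\<^sub>\<infinity>p\<in>A. w p \<theta>) has_integral J) (cbox a b)" "(I \<longlongrightarrow> J) (finite_subsets_at_top A)"
    by (elim uniform_limit_integral_cbox) (auto intro: continuous_on_sum w'_cont)
  have "I X = (\<Sum>p\<in>X. integral (cbox a b) (w p))" if "finite X" "X \<subseteq> A" for X
  proof -
    have "I X = integral (cbox a b) (\<lambda>\<theta>. \<Sum>p\<in>X. w' p \<theta>)" using integral_unique[OF I(1)] by simp
    also have "\<dots> = (\<Sum>p\<in>X. integral (cbox a b) (w' p))"
      using that by (intro integral_sum integrable_continuous w'_cont)
    also have "\<dots> = (\<Sum>p\<in>X. integral (cbox a b) (w p))"
      using that by (intro sum.cong) (auto simp: w'_def)
    finally show ?thesis .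
  qed
  then have "(sum (\<lambda>p. integral (cbox a b) (w p)) \<longlongrightarrow> J) (finite_subsets_at_top A)"
    using I(3) by (rule_tac Lim_transform_eventually[rotated]) (auto intro: eventually_finite_subsets_at_top_weakI)
  then show "((\<lambda>p. integral (cbox a b) (w p)) has_sum integral (cbox a b) (\<lambda>\<theta>. \<Sum>\<^sub>\<infinity>p\<in>A. w p \<theta>)) A"
    using I(2) by (simp add: has_sum_def integral_unique)
qed

lemma fourier_coef_infsum:
  fixes w :: "'i \<Rightarrow> real ^ 'n::finite \<Rightarrow> complex"
  assumes cont: "\<And>p. p \<in> A \<Longrightarrow> continuous_on UNIV (w p)"
    and M: "\<And>p \<theta>. p \<in> A \<Longrightarrow> norm (w p \<theta>) \<le> M p" "M summable_on A"
  shows "((\<lambda>p. fourier_coef (w p) q) has_sum fourier_coef (\<lambda>\<theta>. \<Sum>\<^sub>\<infinity>p\<in>A. w p \<theta>) q) A"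
proof -
  have "((\<lambda>p. integral (cbox 0 1) (\<lambda>\<theta>. echar (- q) \<theta> * w p \<theta>)) has_sum
     integral (cbox 0 1) (\<lambda>\<theta>. \<Sum>\<^sub>\<infinity>p\<in>A. echar (- q) \<theta> * w p \<theta>)) A"
    by (rule infsum_continuous_integral(2)[where M = M])
      (auto intro!: continuous_intros echar_continuous cont simp: norm_mult M)
  then show ?thesis by (simp add: fourier_coef_def infsum_cmult_right')
qed

lemma fourier_coef_decay_ex:
  fixes f :: "real ^ 'n::finite \<Rightarrow> complex"
  assumes f: "torus_smooth f"
  shows "\<exists>C. \<forall>p\<in>zlat. norm (fourier_coef f p) * (1 + norm p) ^ P \<le> C"
proof -
  have sm: "torus_smooth ((partial j ^^ m) f)" for j m
    by (induction m) (auto intro: f torus_smooth_partial)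
  have "\<exists>B. \<forall>\<theta>. norm ((partial j ^^ P) f \<theta>) \<le> B" for j
    by (meson torus_bounded torus_smooth_continuous[OF sm] sm torus_smooth_def)
  then obtain B where B: "\<And>j \<theta>. norm ((partial j ^^ P) f \<theta>) \<le> B j" by metis
  obtain B0 where B0: "B0 \<ge> 0" "\<And>\<theta>. norm (f \<theta>) \<le> B0"
    by (meson torus_bounded torus_smooth_continuous[OF f] f torus_smooth_def)
  have Bn: "B j \<ge> 0" for j using B[of j 0] norm_ge_zero order_trans by blast
  have "norm (fourier_coef f p) * (1 + norm p) ^ P \<le> (2 * real CARD('n)) ^ P * (2 * (B0 + sum B UNIV))" if "p \<in> zlat" for p
  proof (rule fourier_coef_decay[OF f that])
    show "norm (f \<theta>) \<le> B0 + sum B UNIV" for \<theta>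
      using B0(2)[of \<theta>] sum_nonneg[of UNIV B] Bn by (smt (verit))
    show "norm ((partial j ^^ P) f \<theta>) \<le> B0 + sum B UNIV" for j \<theta>
      using B[of j \<theta>] B0(1) member_le_sum[of j UNIV B] Bn by (smt (verit) UNIV_I finite)
  qed
  then show ?thesis by blast
qed

text \<open>The series converges uniformly to a continuous periodic function with the same
  coefficients as \<open>f\<close>, and such functions are determined by their coefficients.\<close>

lemma fourier_inversion:
  fixes f :: "real ^ 'n::finite \<Rightarrow> complex"
  assumes f: "torus_smooth f"
  shows "(\<Sum>\<^sub>\<infinity>p\<in>zlat. fourier_coef f p * echar p \<theta>) = f \<theta>"
proof -
  obtain C where C: "\<And>p. p \<in> zlat \<Longrightarrow> norm (fourier_coef f p) * (1 + norm p) ^ (2 * CARD('n)) \<le> C"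
    using fourier_coef_decay_ex[OF f] by metis
  have s: "(\<lambda>p. norm (fourier_coef f p)) summable_on zlat"
    by (rule zlat_weight_comparison(1)[OF C])
  define g where "g = (\<lambda>\<theta>. \<Sum>\<^sub>\<infinity>p\<in>zlat. fourier_coef f p * echar p \<theta>)"
  have cont: "continuous_on UNIV (\<lambda>\<theta>. fourier_coef f p * echar p \<theta>)" for p
    by (intro continuous_intros echar_continuous)
  have "continuous_on UNIV g"
    unfolding g_def by (rule infsum_continuous_integral(1)[OF cont _ s]) (simp add: norm_mult)
  moreover have "periodic g"
    unfolding periodic_def
  proof (intro allI impI)
    fix \<theta> m :: "real ^ 'n" assume "\<forall>j. m $ j \<in> \<int>"
    then show "g (\<theta> + m) = g \<theta>"
      unfolding g_def by (intro infsum_cong) (auto simp: periodicD[OF periodic_echar])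
  qed
  moreover have "fourier_coef g q = fourier_coef f q" if q: "q \<in> zlat" for q
  proof -
    have "((\<lambda>p. fourier_coef (\<lambda>\<theta>. fourier_coef f p * echar p \<theta>) q) has_sum fourier_coef g q) zlat"
      unfolding g_def by (rule fourier_coef_infsum[OF cont _ s]) (simp add: norm_mult)
    moreover have "((\<lambda>p. fourier_coef (\<lambda>\<theta>. fourier_coef f p * echar p \<theta>) q) has_sum fourier_coef f q) zlat"
      by (rule has_sum_finite_neutralI[where B = "{q}"]) (use q in \<open>auto simp: fourier_coef_cmult fourier_coef_echar\<close>)
    ultimately show ?thesis by (rule has_sum_unique)
  qed
  ultimately have "g = f"
    using f by (intro fourier_coef_eqI) (auto simp: torus_smooth_def intro: torus_smooth_continuous)
  then show ?thesis by (simp add: g_def fun_eq_iff)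
qed

text \<open>Termwise differentiation in several variables. The theorem on derivatives of series
  concerns sequences, so the lattice is enumerated first.\<close>

lemma infsum_partial:
  fixes w :: "real ^ 'n::finite \<Rightarrow> real ^ 'n \<Rightarrow> complex"
  assumes diff: "\<And>p \<theta>. p \<in> zlat \<Longrightarrow> w p differentiable (at \<theta>)"
    and M0: "\<And>p \<theta>. p \<in> zlat \<Longrightarrow> norm (w p \<theta>) \<le> M p"
    and M1: "\<And>p j \<theta>. p \<in> zlat \<Longrightarrow> norm (partial j (w p) \<theta>) \<le> M p"
    and M: "M summable_on zlat"
  shows "((\<lambda>\<theta>. \<Sum>\<^sub>\<infinity>p\<in>zlat. w p \<theta>) has_derivative
      (\<lambda>v. \<Sum>j\<in>UNIV. v $ j *\<^sub>R (\<Sum>\<^sub>\<infinity>p\<in>zlat. partial j (w p) \<theta>))) (at \<theta>)"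
proof -
  obtain e' :: "real ^ 'n \<Rightarrow> nat" where "bij_betw e' zlat UNIV"
    using countableE_infinite[OF countable_zlat infinite_zlat] by metis
  then obtain e :: "nat \<Rightarrow> real ^ 'n" where e: "bij_betw e UNIV zlat"
    using bij_betw_inv by blast
  have ez: "e n \<in> zlat" for n using e by (auto simp: bij_betw_def)
  have Me: "summable (\<lambda>n. M (e n))"
    using M summable_on_reindex_bij_betw[OF e, of M] summable_on_imp_summable by blast
  have sums: "(\<lambda>n. f (e n)) sums infsum f zlat" if "\<And>p. p \<in> zlat \<Longrightarrow> norm (f p) \<le> M p" for f :: "real ^ 'n \<Rightarrow> complex"
  proof -
    have "f summable_on zlat"
      using that by (intro abs_summable_summable[OF summable_on_comparison_test[OF M]]) auto
    then have "(f has_sum infsum f zlat) zlat" by simp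
    then have "((\<lambda>n. f (e n)) has_sum infsum f zlat) UNIV"
      by (subst has_sum_reindex_bij_betw[OF e])
    then show ?thesis by (rule has_sum_imp_sums)
  qed
  define S where "S = (\<lambda>j \<theta>. \<Sum>\<^sub>\<infinity>p\<in>zlat. partial j (w p) \<theta>)"
  have S: "(\<lambda>n. partial j (w (e n)) \<theta>) sums S j \<theta>" for j \<theta>
    unfolding S_def using sums[of "\<lambda>p. partial j (w p) \<theta>"] M1 by simp
  have ul: "uniform_limit UNIV (\<lambda>n \<theta>. \<Sum>i<n. partial j (w (e i)) \<theta>) (S j) sequentially" for j
  proof -
    have "uniform_limit UNIV (\<lambda>n \<theta>. \<Sum>i<n. partial j (w (e i)) \<theta>) (\<lambda>\<theta>. suminf (\<lambda>i. partial j (w (e i)) \<theta>)) sequentially"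
      by (rule Weierstrass_m_test[OF _ Me]) (auto intro: M1 ez)
    moreover have "(\<lambda>\<theta>. suminf (\<lambda>i. partial j (w (e i)) \<theta>)) = S j"
      using sums_unique[OF S] by (simp add: fun_eq_iff)
    ultimately show ?thesis by simp
  qed
  have "\<exists>g. \<forall>\<theta>\<in>UNIV. (\<lambda>n. w (e n) \<theta>) sums g \<theta> \<and> (g has_derivative (\<lambda>v. \<Sum>j\<in>UNIV. v $ j *\<^sub>R S j \<theta>)) (at \<theta> within UNIV)"
  proof (rule has_derivative_series)
    show "(w (e n) has_derivative (\<lambda>v. \<Sum>j\<in>UNIV. v $ j *\<^sub>R partial j (w (e n)) \<theta>)) (at \<theta> within UNIV)" for n \<theta>
      by (rule has_derivative_partial[OF diff[OF ez]])
    show "(\<lambda>n. w (e n) 0) sums infsum (\<lambda>p. w p 0) zlat"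
      by (rule sums) (rule M0)
    fix \<epsilon> :: real assume "\<epsilon> > 0"
    \<comment> \<open>The differential is a sum of \<open>CARD('n)\<close> partial terms, and each
      gets an equal share of the error.\<close>
    define \<epsilon>' where "\<epsilon>' = \<epsilon> / real CARD('n)"
    have "\<epsilon>' > 0" using \<open>\<epsilon> > 0\<close> by (simp add: \<epsilon>'_def)
    then have "\<forall>\<^sub>F n in sequentially. \<forall>j. \<forall>\<theta>\<in>UNIV. dist (\<Sum>i<n. partial j (w (e i)) \<theta>) (S j \<theta>) < \<epsilon>'"
      using ul by (intro eventually_all_finite) (auto simp: uniform_limit_iff)
    then show "\<forall>\<^sub>F n in sequentially. \<forall>\<theta>\<in>UNIV. \<forall>v. norm ((\<Sum>i<n. \<Sum>j\<in>UNIV. v $ j *\<^sub>R partial j (w (e i)) \<theta>) - (\<Sum>j\<in>UNIV. v $ j *\<^sub>R S j \<theta>)) \<le> \<epsilon> * norm v"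
    proof (rule eventually_mono, intro ballI allI)
      fix n \<theta> v assume *: "\<forall>j. \<forall>\<theta>\<in>UNIV. dist (\<Sum>i<n. partial j (w (e i)) \<theta>) (S j \<theta>) < \<epsilon>'"
      have "(\<Sum>i<n. \<Sum>j\<in>UNIV. v $ j *\<^sub>R partial j (w (e i)) \<theta>) = (\<Sum>j\<in>UNIV. v $ j *\<^sub>R (\<Sum>i<n. partial j (w (e i)) \<theta>))"
        by (subst sum.swap) (simp add: scaleR_sum_right)
      then have "norm ((\<Sum>i<n. \<Sum>j\<in>UNIV. v $ j *\<^sub>R partial j (w (e i)) \<theta>) - (\<Sum>j\<in>UNIV. v $ j *\<^sub>R S j \<theta>))
         = norm (\<Sum>j\<in>UNIV. v $ j *\<^sub>R ((\<Sum>i<n. partial j (w (e i)) \<theta>) - S j \<theta>))"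
        by (simp add: sum_subtractf scaleR_diff_right)
      also have "\<dots> \<le> (\<Sum>j\<in>(UNIV::'n set). norm v * \<epsilon>')"
      proof (rule sum_norm_le)
        fix j
        have "norm ((\<Sum>i<n. partial j (w (e i)) \<theta>) - S j \<theta>) \<le> \<epsilon>'"
          using * by (auto simp: dist_norm intro: less_imp_le)
        then show "norm (v $ j *\<^sub>R ((\<Sum>i<n. partial j (w (e i)) \<theta>) - S j \<theta>)) \<le> norm v * \<epsilon>'"
          unfolding norm_scaleR by (intro mult_mono component_le_norm_cart) (auto simp: real_norm_def component_le_norm_cart)
      qed
      also have "\<dots> = \<epsilon> * norm v" by (simp add: \<epsilon>'_def)
      finally show "norm ((\<Sum>i<n. \<Sum>j\<in>UNIV. v $ j *\<^sub>R partial j (w (e i)) \<theta>) - (\<Sum>j\<in>UNIV. v $ j *\<^sub>R S j \<theta>)) \<le> \<epsilon> * norm v" .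
    qed
  qed auto
  then obtain g where g: "\<And>\<theta>. (\<lambda>n. w (e n) \<theta>) sums g \<theta>"
      "\<And>\<theta>. (g has_derivative (\<lambda>v. \<Sum>j\<in>UNIV. v $ j *\<^sub>R S j \<theta>)) (at \<theta>)" by auto
  have "g = (\<lambda>\<theta>. \<Sum>\<^sub>\<infinity>p\<in>zlat. w p \<theta>)"
  proof
    fix \<theta>
    have "(\<lambda>n. w (e n) \<theta>) sums (\<Sum>\<^sub>\<infinity>p\<in>zlat. w p \<theta>)" by (rule sums) (rule M0)
    with g(1) show "g \<theta> = (\<Sum>\<^sub>\<infinity>p\<in>zlat. w p \<theta>)" by (rule sums_unique2)
  qed
  with g(2)[of \<theta>] show ?thesis by (simp add: S_def)
qed

lemma partial_infsum:
  fixes w :: "real ^ 'n::finite \<Rightarrow> real ^ 'n \<Rightarrow> complex"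
  assumes "\<And>p \<theta>. p \<in> zlat \<Longrightarrow> w p differentiable (at \<theta>)"
    and "\<And>p \<theta>. p \<in> zlat \<Longrightarrow> norm (w p \<theta>) \<le> M p"
    and "\<And>p j \<theta>. p \<in> zlat \<Longrightarrow> norm (partial j (w p) \<theta>) \<le> M p"
    and "M summable_on zlat"
  shows "(\<lambda>\<theta>. \<Sum>\<^sub>\<infinity>p\<in>zlat. w p \<theta>) differentiable (at \<theta>)"
    and "partial j (\<lambda>\<theta>. \<Sum>\<^sub>\<infinity>p\<in>zlat. w p \<theta>) \<theta> = (\<Sum>\<^sub>\<infinity>p\<in>zlat. partial j (w p) \<theta>)"
proof -
  note D = infsum_partial[where M = M, OF assms, of \<theta>]
  show "(\<lambda>\<theta>. \<Sum>\<^sub>\<infinity>p\<in>zlat. w p \<theta>) differentiable (at \<theta>)"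
    using D by (auto simp: differentiable_def)
  show "partial j (\<lambda>\<theta>. \<Sum>\<^sub>\<infinity>p\<in>zlat. w p \<theta>) \<theta> = (\<Sum>\<^sub>\<infinity>p\<in>zlat. partial j (w p) \<theta>)"
    by (simp add: partial_eqI[OF D] axis_def if_distrib[of "\<lambda>x. x *\<^sub>R _"] cong: if_cong)
qed

section \<open>Symbol classes\<close>

lemma distinct_coords: "distinct (coords :: 'n::finite list)"
  and set_coords: "set (coords :: 'n::finite list) = UNIV"
proof -
  have "\<exists>js :: 'n list. distinct js \<and> set js = UNIV"
    using finite_distinct_list[of "UNIV :: 'n set"] by auto
  from someI_ex[OF this] show "distinct (coords :: 'n list)" "set (coords :: 'n list) = UNIV"
    by (auto simp: coords_def)
qed

lemma sum_list_coords: "(\<Sum>j\<leftarrow>coords. f j) = (\<Sum>j\<in>UNIV. f j)"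
  by (simp add: sum_list_distinct_conv_sum_set distinct_coords set_coords)

lemma mlen_upd: "mlen (\<alpha>(j := Suc (\<alpha> j))) = Suc (mlen \<alpha>)"
proof -
  have "mlen (\<alpha>(j := Suc (\<alpha> j))) = Suc (\<alpha> j) + (\<Sum>i\<in>UNIV - {j}. \<alpha> i)"
    unfolding mlen_def by (subst sum.remove[of _ j]) auto
  also have "\<dots> = Suc (mlen \<alpha>)"
    unfolding mlen_def by (subst (2) sum.remove[of _ j]) auto
  finally show ?thesis .
qed

definition lat_diff :: "real \<Rightarrow> 'n::finite \<Rightarrow> 'n sym \<Rightarrow> 'n sym" where
  "lat_diff h j \<sigma> = (\<lambda>k \<theta>. diff1 h j (\<lambda>\<kappa>. \<sigma> \<kappa> \<theta>) k)"

definition tor_diff :: "'n::finite \<Rightarrow> 'n sym \<Rightarrow> 'n sym" where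
  "tor_diff j \<sigma> = (\<lambda>k. partial j (\<sigma> k))"

text \<open>Translation by one lattice step enters through the discrete Leibniz rule, where one
  factor is evaluated at the neighbouring point.\<close>

definition shift :: "real \<Rightarrow> 'n::finite \<Rightarrow> 'n sym \<Rightarrow> 'n sym" where
  "shift h j \<sigma> = (\<lambda>k. \<sigma> (k + h *\<^sub>R axis j 1))"

lemma lat_diff_eq: "lat_diff h j \<sigma> = (\<lambda>k \<theta>. (shift h j \<sigma> k \<theta> - \<sigma> k \<theta>) / of_real h)"
  by (simp add: lat_diff_def diff1_def shift_def)

lemma hlattice_eq: "hlattice h = (*\<^sub>R) h ` zlat"
  by (auto simp: hlattice_def zlat_def)

lemma hlattice_add: "k \<in> hlattice h \<Longrightarrow> p \<in> zlat \<Longrightarrow> k + h *\<^sub>R p \<in> hlattice h"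
  by (force simp: hlattice_eq zlat_add simp flip: scaleR_add_right)

lemma hlattice_axis: "k \<in> hlattice h \<Longrightarrow> k + h *\<^sub>R axis j 1 \<in> hlattice h"
  by (rule hlattice_add[OF _ zlat_axis])

definition smooth_sym :: "real \<Rightarrow> 'n::finite sym \<Rightarrow> bool" where
  "smooth_sym h \<sigma> \<longleftrightarrow> (\<forall>k\<in>hlattice h. torus_smooth (\<sigma> k))"

definition order_bound :: "real \<Rightarrow> real \<Rightarrow> 'n::finite sym \<Rightarrow> bool" where
  "order_bound h m \<sigma> \<longleftrightarrow> (\<exists>C. \<forall>k\<in>hlattice h. \<forall>\<theta>. norm (\<sigma> k \<theta>) \<le> C * (1 + norm k) powr m)"

text \<open>Words in the first-order operators replace pairs of multi-indices: products and inverses are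
  then handled by induction on the length \<open>r\<close> of the words.\<close>

primrec word_bounds :: "real \<Rightarrow> real \<Rightarrow> real \<Rightarrow> nat \<Rightarrow> real \<Rightarrow> 'n::finite sym \<Rightarrow> bool" where
  "word_bounds h \<rho> \<delta> 0 m \<sigma> \<longleftrightarrow> order_bound h m \<sigma>"
| "word_bounds h \<rho> \<delta> (Suc r) m \<sigma> \<longleftrightarrow> order_bound h m \<sigma> \<and>
     (\<forall>j. word_bounds h \<rho> \<delta> r (m - \<rho>) (lat_diff h j \<sigma>)) \<and> (\<forall>j. word_bounds h \<rho> \<delta> r (m + \<delta>) (tor_diff j \<sigma>))"

lemma order_bound_pos:
  assumes "order_bound h m \<sigma>"
  shows "\<exists>C>0. \<forall>k\<in>hlattice h. \<forall>\<theta>. norm (\<sigma> k \<theta>) \<le> C * (1 + norm k) powr m"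
proof -
  obtain C where C: "\<And>k \<theta>. k \<in> hlattice h \<Longrightarrow> norm (\<sigma> k \<theta>) \<le> C * (1 + norm k) powr m"
    using assms by (auto simp: order_bound_def)
  have "norm (\<sigma> k \<theta>) \<le> max C 1 * (1 + norm k) powr m" if "k \<in> hlattice h" for k \<theta>
    using C[OF that, of \<theta>] by (rule order_trans) (auto intro: mult_right_mono)
  then show ?thesis by (intro exI[of _ "max C 1"]) auto
qed

lemma bndI:
  assumes "\<And>k \<theta>. k \<in> hlattice h \<Longrightarrow> norm (\<sigma> k \<theta>) \<le> C * (1 + norm k) powr m"
  shows "order_bound h m \<sigma>"
  using assms by (auto simp: order_bound_def)

lemma powr_mono_weight: "a \<le> b \<Longrightarrow> (1 + norm k) powr a \<le> (1 + norm k) powr b"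
  by (rule powr_mono) auto

lemma order_bound_mono:
  assumes "m \<le> m'" "order_bound h m \<sigma>"
  shows "order_bound h m' \<sigma>"
proof -
  obtain C where C: "C > 0" "\<And>k \<theta>. k \<in> hlattice h \<Longrightarrow> norm (\<sigma> k \<theta>) \<le> C * (1 + norm k) powr m"
    using order_bound_pos[OF assms(2)] by auto
  show ?thesis
    by (rule bndI[of _ _ C], rule order_trans[OF C(2)])
      (use C(1) powr_mono_weight[OF assms(1)] in auto)
qed

lemma order_bound_cong: "(\<And>k. k \<in> hlattice h \<Longrightarrow> \<sigma> k = \<tau> k) \<Longrightarrow> order_bound h m \<sigma> \<longleftrightarrow> order_bound h m \<tau>"
  by (simp add: order_bound_def)

lemma order_bound_add:
  assumes "order_bound h m \<sigma>" "order_bound h m \<tau>"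
  shows "order_bound h m (\<lambda>k \<theta>. \<sigma> k \<theta> + \<tau> k \<theta>)"
proof -
  obtain C where C: "\<And>k \<theta>. k \<in> hlattice h \<Longrightarrow> norm (\<sigma> k \<theta>) \<le> C * (1 + norm k) powr m"
    using assms(1) by (auto simp: order_bound_def)
  obtain D where D: "\<And>k \<theta>. k \<in> hlattice h \<Longrightarrow> norm (\<tau> k \<theta>) \<le> D * (1 + norm k) powr m"
    using assms(2) by (auto simp: order_bound_def)
  show ?thesis
    by (rule bndI[of _ _ "C + D"], rule order_trans[OF norm_triangle_ineq])
      (use add_mono[OF C D] in \<open>auto simp: ring_distribs\<close>)
qed

lemma order_bound_mult:
  assumes "order_bound h m \<sigma>" "order_bound h m' \<tau>"
  shows "order_bound h (m + m') (\<lambda>k \<theta>. \<sigma> k \<theta> * \<tau> k \<theta>)"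
proof -
  obtain C where C: "C > 0" "\<And>k \<theta>. k \<in> hlattice h \<Longrightarrow> norm (\<sigma> k \<theta>) \<le> C * (1 + norm k) powr m"
    using order_bound_pos[OF assms(1)] by auto
  obtain D where D: "D > 0" "\<And>k \<theta>. k \<in> hlattice h \<Longrightarrow> norm (\<tau> k \<theta>) \<le> D * (1 + norm k) powr m'"
    using order_bound_pos[OF assms(2)] by auto
  have "norm (\<sigma> k \<theta> * \<tau> k \<theta>) \<le> C * D * (1 + norm k) powr (m + m')" if "k \<in> hlattice h" for k \<theta>
    using mult_mono[OF C(2)[OF that] D(2)[OF that]] C(1) by (simp add: norm_mult powr_add mult_ac)
  then show ?thesis by (rule bndI)
qed

lemma order_bound_const: "order_bound h 0 (\<lambda>k \<theta>. c)"
  by (rule bndI[of _ _ "norm c"]) (auto simp: add_nonneg_eq_0_iff)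

lemma order_bound_cmult: "order_bound h m \<sigma> \<Longrightarrow> order_bound h m (\<lambda>k \<theta>. c * \<sigma> k \<theta>)"
  using order_bound_mult[OF order_bound_const, of h m \<sigma> c] by simp

text \<open>Peetre's inequality. For negative \<open>s\<close> the triangle inequality is applied to
  \<open>x\<close> written as \<open>x + y\<close> minus \<open>y\<close>.\<close>

lemma powr_weight_add:
  fixes x y :: "'a::real_normed_vector"
  shows "(1 + norm (x + y)) powr s \<le> (1 + norm y) powr \<bar>s\<bar> * (1 + norm x) powr s"
proof (cases "s \<ge> 0")
  case True
  have "1 + norm (x + y) \<le> (1 + norm y) * (1 + norm x)"
    using norm_triangle_ineq[of x y] mult_nonneg_nonneg[OF norm_ge_zero norm_ge_zero, of y x]
    unfolding ring_distribs by linarith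
  then have "(1 + norm (x + y)) powr s \<le> ((1 + norm y) * (1 + norm x)) powr s"
    using True by (intro powr_mono2) (auto intro: add_nonneg_nonneg)
  also have "\<dots> = (1 + norm y) powr \<bar>s\<bar> * (1 + norm x) powr s"
    using True by (simp add: powr_mult)
  finally show ?thesis .
next
  case False
  have "1 + norm x \<le> (1 + norm y) * (1 + norm (x + y))"
    using norm_triangle_ineq4[of "x + y" y] mult_nonneg_nonneg[OF norm_ge_zero norm_ge_zero, of y "x + y"]
    unfolding ring_distribs add_diff_cancel_right' by linarith
  then have "(1 + norm x) powr (- s) \<le> ((1 + norm y) * (1 + norm (x + y))) powr (- s)"
    using False by (intro powr_mono2) (auto intro: add_nonneg_nonneg)
  also have "\<dots> = (1 + norm y) powr (- s) * (1 + norm (x + y)) powr (- s)"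
    by (simp add: powr_mult)
  finally have "(1 + norm x) powr (- s) * (1 + norm (x + y)) powr s \<le> (1 + norm y) powr (- s)"
    by (simp add: powr_minus divide_simps add_nonneg_eq_0_iff mult_ac split: if_splits)
  then show ?thesis using False
    by (simp add: powr_minus divide_simps add_nonneg_eq_0_iff mult_ac split: if_splits)
qed

lemma order_bound_shift:
  assumes "order_bound h m \<sigma>"
  shows "order_bound h m (shift h j \<sigma>)"
proof -
  obtain C where C: "C > 0" "\<And>k \<theta>. k \<in> hlattice h \<Longrightarrow> norm (\<sigma> k \<theta>) \<le> C * (1 + norm k) powr m"
    using order_bound_pos[OF assms] by auto
  have "norm (shift h j \<sigma> k \<theta>) \<le> C * (1 + norm (h *\<^sub>R axis j 1 :: real ^ 'a)) powr \<bar>m\<bar> * (1 + norm k) powr m"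
    if "k \<in> hlattice h" for k \<theta>
  proof -
    have "norm (shift h j \<sigma> k \<theta>) \<le> C * (1 + norm (k + h *\<^sub>R axis j 1)) powr m"
      unfolding shift_def by (rule C(2)[OF hlattice_axis[OF that]])
    also have "\<dots> \<le> C * ((1 + norm (h *\<^sub>R axis j 1 :: real ^ 'a)) powr \<bar>m\<bar> * (1 + norm k) powr m)"
      using C(1) by (intro mult_left_mono powr_weight_add) auto
    finally show ?thesis by simp
  qed
  then show ?thesis by (rule bndI)
qed

lemma word_bounds_imp_order_bound: "word_bounds h \<rho> \<delta> r m \<sigma> \<Longrightarrow> order_bound h m \<sigma>"
  by (cases r) auto

lemma word_bounds_Suc_imp_word_bounds: "word_bounds h \<rho> \<delta> (Suc r) m \<sigma> \<Longrightarrow> word_bounds h \<rho> \<delta> r m \<sigma>"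
proof (induction r arbitrary: m \<sigma>)
  case (Suc r)
  from Suc.prems have "order_bound h m \<sigma>" "word_bounds h \<rho> \<delta> (Suc r) (m - \<rho>) (lat_diff h j \<sigma>)"
    "word_bounds h \<rho> \<delta> (Suc r) (m + \<delta>) (tor_diff j \<sigma>)" for j
    by (auto simp only: word_bounds.simps(2)[of _ _ _ "Suc r"])
  then show ?case by (subst word_bounds.simps(2)) (blast intro: Suc.IH)
qed auto

lemma word_bounds_mono: "m \<le> m' \<Longrightarrow> word_bounds h \<rho> \<delta> r m \<sigma> \<Longrightarrow> word_bounds h \<rho> \<delta> r m' \<sigma>"
proof (induction r arbitrary: m m' \<sigma>)
  case (Suc r)
  have *: "order_bound h m \<sigma>" "word_bounds h \<rho> \<delta> r (m - \<rho>) (lat_diff h j \<sigma>)" "word_bounds h \<rho> \<delta> r (m + \<delta>) (tor_diff j \<sigma>)" for j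
    using Suc.prems(2) by auto
  have "m - \<rho> \<le> m' - \<rho>" "m + \<delta> \<le> m' + \<delta>" using Suc.prems(1) by auto
  from Suc.IH[OF this(1) *(2)] Suc.IH[OF this(2) *(3)]
  have "word_bounds h \<rho> \<delta> r (m' - \<rho>) (lat_diff h j \<sigma>)" "word_bounds h \<rho> \<delta> r (m' + \<delta>) (tor_diff j \<sigma>)" for j
    by blast+
  with order_bound_mono[OF Suc.prems(1) *(1)] show ?case by simp
qed (auto intro: order_bound_mono)

lemma lat_diff_cong:
  assumes "\<And>k. k \<in> hlattice h \<Longrightarrow> \<sigma> k = \<tau> k" "k \<in> hlattice h"
  shows "lat_diff h j \<sigma> k = lat_diff h j \<tau> k"
  using assms(1)[OF assms(2)] assms(1)[OF hlattice_axis[OF assms(2)]] by (simp add: lat_diff_def diff1_def)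

lemma word_bounds_cong: "(\<And>k. k \<in> hlattice h \<Longrightarrow> \<sigma> k = \<tau> k) \<Longrightarrow> word_bounds h \<rho> \<delta> r m \<sigma> \<longleftrightarrow> word_bounds h \<rho> \<delta> r m \<tau>"
proof (induction r arbitrary: m \<sigma> \<tau>)
  case 0
  then show ?case using order_bound_cong[OF 0] by simp
next
  case (Suc r)
  have "word_bounds h \<rho> \<delta> r (m - \<rho>) (lat_diff h j \<sigma>) = word_bounds h \<rho> \<delta> r (m - \<rho>) (lat_diff h j \<tau>)" for j
    by (rule Suc.IH) (auto intro: lat_diff_cong Suc.prems)
  moreover have "word_bounds h \<rho> \<delta> r (m + \<delta>) (tor_diff j \<sigma>) = word_bounds h \<rho> \<delta> r (m + \<delta>) (tor_diff j \<tau>)" for j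
    by (rule Suc.IH) (simp add: tor_diff_def Suc.prems)
  moreover have "order_bound h m \<sigma> = order_bound h m \<tau>"
    by (rule order_bound_cong[OF Suc.prems])
  ultimately show ?case by simp
qed

lemma ssmD: "smooth_sym h \<sigma> \<Longrightarrow> k \<in> hlattice h \<Longrightarrow> torus_smooth (\<sigma> k)"
  by (auto simp: smooth_sym_def)

lemma smooth_sym_cong: "(\<And>k. k \<in> hlattice h \<Longrightarrow> \<sigma> k = \<tau> k) \<Longrightarrow> smooth_sym h \<sigma> \<longleftrightarrow> smooth_sym h \<tau>"
  by (simp add: smooth_sym_def)

lemma smooth_sym_add: "smooth_sym h \<sigma> \<Longrightarrow> smooth_sym h \<tau> \<Longrightarrow> smooth_sym h (\<lambda>k \<theta>. \<sigma> k \<theta> + \<tau> k \<theta>)"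
  by (auto simp: smooth_sym_def intro: torus_smooth_add)

lemma smooth_sym_diff: "smooth_sym h \<sigma> \<Longrightarrow> smooth_sym h \<tau> \<Longrightarrow> smooth_sym h (\<lambda>k \<theta>. \<sigma> k \<theta> - \<tau> k \<theta>)"
  by (auto simp: smooth_sym_def intro: torus_smooth_diff)

lemma smooth_sym_mult: "smooth_sym h \<sigma> \<Longrightarrow> smooth_sym h \<tau> \<Longrightarrow> smooth_sym h (\<lambda>k \<theta>. \<sigma> k \<theta> * \<tau> k \<theta>)"
  by (auto simp: smooth_sym_def intro: torus_smooth_mult)

lemma smooth_sym_cmult: "smooth_sym h \<sigma> \<Longrightarrow> smooth_sym h (\<lambda>k \<theta>. c * \<sigma> k \<theta>)"
  by (auto simp: smooth_sym_def intro: torus_smooth_cmult)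

lemma smooth_sym_const: "smooth_sym h (\<lambda>k \<theta>. c)"
  by (auto simp: smooth_sym_def intro: torus_smooth_const)

lemma smooth_sym_shift: "smooth_sym h \<sigma> \<Longrightarrow> smooth_sym h (shift h j \<sigma>)"
  by (auto simp: smooth_sym_def shift_def hlattice_axis)

lemma smooth_sym_tor_diff: "smooth_sym h \<sigma> \<Longrightarrow> smooth_sym h (tor_diff j \<sigma>)"
  by (auto simp: smooth_sym_def tor_diff_def intro: torus_smooth_partial)

lemma smooth_sym_lat_diff: "smooth_sym h \<sigma> \<Longrightarrow> smooth_sym h (lat_diff h j \<sigma>)"
  using smooth_sym_cmult[OF smooth_sym_diff[OF smooth_sym_shift], of h \<sigma> \<sigma> "1 / of_real h" j] by (simp add: lat_diff_eq)

lemma smooth_sym_inverse: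
  "smooth_sym h \<sigma> \<Longrightarrow> (\<And>k \<theta>. k \<in> hlattice h \<Longrightarrow> \<sigma> k \<theta> \<noteq> 0) \<Longrightarrow> smooth_sym h (\<lambda>k \<theta>. inverse (\<sigma> k \<theta>))"
  by (auto simp: smooth_sym_def intro: torus_smooth_inverse)

lemma tor_diff_add:
  "smooth_sym h \<sigma> \<Longrightarrow> smooth_sym h \<tau> \<Longrightarrow> k \<in> hlattice h \<Longrightarrow>
    tor_diff j (\<lambda>k \<theta>. \<sigma> k \<theta> + \<tau> k \<theta>) k = (\<lambda>\<theta>. tor_diff j \<sigma> k \<theta> + tor_diff j \<tau> k \<theta>)"
  by (auto simp: tor_diff_def smooth_sym_def partial_add torus_smooth_differentiable)

lemma tor_diff_mult:
  "smooth_sym h \<sigma> \<Longrightarrow> smooth_sym h \<tau> \<Longrightarrow> k \<in> hlattice h \<Longrightarrow>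
    tor_diff j (\<lambda>k \<theta>. \<sigma> k \<theta> * \<tau> k \<theta>) k = (\<lambda>\<theta>. tor_diff j \<sigma> k \<theta> * \<tau> k \<theta> + \<sigma> k \<theta> * tor_diff j \<tau> k \<theta>)"
  by (auto simp: tor_diff_def smooth_sym_def partial_mult torus_smooth_differentiable)

lemma tor_diff_shift: "tor_diff i (shift h j \<sigma>) = shift h j (tor_diff i \<sigma>)"
  by (simp add: tor_diff_def shift_def)

lemma lat_diff_shift: "lat_diff h i (shift h j \<sigma>) = shift h j (lat_diff h i \<sigma>)"
  by (simp add: lat_diff_def diff1_def shift_def ac_simps)

lemma tor_diff_lat_diff:
  assumes "smooth_sym h \<sigma>" "k \<in> hlattice h"
  shows "tor_diff i (lat_diff h j \<sigma>) k = lat_diff h j (tor_diff i \<sigma>) k"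
proof
  fix \<theta>
  have "torus_smooth (\<sigma> k)" "torus_smooth (shift h j \<sigma> k)"
    using ssmD[OF assms] ssmD[OF smooth_sym_shift[OF assms(1)] assms(2)] by auto
  then have "partial i (\<lambda>\<theta>. (1 / of_real h) * (shift h j \<sigma> k \<theta> - \<sigma> k \<theta>)) \<theta> =
     (1 / of_real h) * (partial i (shift h j \<sigma> k) \<theta> - partial i (\<sigma> k) \<theta>)"
    by (subst partial_cmult) (auto simp: partial_diff intro: torus_smooth_differentiable torus_smooth_diff)
  then show "tor_diff i (lat_diff h j \<sigma>) k \<theta> = lat_diff h j (tor_diff i \<sigma>) k \<theta>"
    by (simp add: tor_diff_def lat_diff_eq shift_def)
qed

lemma word_bounds_shift: "word_bounds h \<rho> \<delta> r m \<sigma> \<Longrightarrow> word_bounds h \<rho> \<delta> r m (shift h j \<sigma>)"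
  by (induction r arbitrary: m \<sigma>) (auto simp: order_bound_shift lat_diff_shift tor_diff_shift)

lemma word_bounds_add:
  "smooth_sym h \<sigma> \<Longrightarrow> smooth_sym h \<tau> \<Longrightarrow> word_bounds h \<rho> \<delta> r m \<sigma> \<Longrightarrow> word_bounds h \<rho> \<delta> r m \<tau> \<Longrightarrow>
    word_bounds h \<rho> \<delta> r m (\<lambda>k \<theta>. \<sigma> k \<theta> + \<tau> k \<theta>)"
proof (induction r arbitrary: m \<sigma> \<tau>)
  case (Suc r)
  have "word_bounds h \<rho> \<delta> r (m - \<rho>) (lat_diff h j (\<lambda>k \<theta>. \<sigma> k \<theta> + \<tau> k \<theta>))" for j
  proof -
    have "lat_diff h j (\<lambda>k \<theta>. \<sigma> k \<theta> + \<tau> k \<theta>) = (\<lambda>k \<theta>. lat_diff h j \<sigma> k \<theta> + lat_diff h j \<tau> k \<theta>)"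
      by (intro ext) (simp add: lat_diff_def diff1_def diff_divide_distrib add_divide_distrib)
    moreover have "word_bounds h \<rho> \<delta> r (m - \<rho>) (\<lambda>k \<theta>. lat_diff h j \<sigma> k \<theta> + lat_diff h j \<tau> k \<theta>)"
      using Suc.prems by (intro Suc.IH smooth_sym_lat_diff) auto
    ultimately show ?thesis by simp
  qed
  moreover have "word_bounds h \<rho> \<delta> r (m + \<delta>) (tor_diff j (\<lambda>k \<theta>. \<sigma> k \<theta> + \<tau> k \<theta>))" for j
    using Suc.prems by (intro word_bounds_cong[OF tor_diff_add, THEN iffD2] Suc.IH smooth_sym_tor_diff) auto
  ultimately show ?case using Suc.prems by (auto intro: order_bound_add)
qed (auto intro: order_bound_add)

text \<open>Both first-order operators satisfy a Leibniz rule. The discrete one reads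
  \<open>lat_diff\<close> of the first factor times the second, plus the shifted first factor times
  \<open>lat_diff\<close> of the second, and shifts preserve the bounds. The induction hypothesis
  then applies to each product.\<close>

lemma word_bounds_mult:
  fixes m m' :: real
  shows "smooth_sym h \<sigma> \<Longrightarrow> smooth_sym h \<tau> \<Longrightarrow> word_bounds h \<rho> \<delta> r m \<sigma> \<Longrightarrow> word_bounds h \<rho> \<delta> r m' \<tau> \<Longrightarrow>
    word_bounds h \<rho> \<delta> r (m + m') (\<lambda>k \<theta>. \<sigma> k \<theta> * \<tau> k \<theta>)"
proof (induction r arbitrary: m m' \<sigma> \<tau>)
  case (Suc r)
  have e: "word_bounds h \<rho> \<delta> r m \<sigma>" "word_bounds h \<rho> \<delta> r m' \<tau>"
    using Suc.prems by (auto intro: word_bounds_Suc_imp_word_bounds simp del: word_bounds.simps)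
  have "word_bounds h \<rho> \<delta> r (m + m' - \<rho>) (lat_diff h j (\<lambda>k \<theta>. \<sigma> k \<theta> * \<tau> k \<theta>))" for j
  proof -
    have "lat_diff h j (\<lambda>k \<theta>. \<sigma> k \<theta> * \<tau> k \<theta>) =
        (\<lambda>k \<theta>. lat_diff h j \<sigma> k \<theta> * \<tau> k \<theta> + shift h j \<sigma> k \<theta> * lat_diff h j \<tau> k \<theta>)"
      by (intro ext) (simp add: lat_diff_eq shift_def diff_divide_distrib algebra_simps)
    moreover have "word_bounds h \<rho> \<delta> r ((m - \<rho>) + m') (\<lambda>k \<theta>. lat_diff h j \<sigma> k \<theta> * \<tau> k \<theta>)"
      using Suc.prems e by (intro Suc.IH smooth_sym_lat_diff) auto
    moreover have "word_bounds h \<rho> \<delta> r (m + (m' - \<rho>)) (\<lambda>k \<theta>. shift h j \<sigma> k \<theta> * lat_diff h j \<tau> k \<theta>)"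
      using Suc.prems e by (intro Suc.IH smooth_sym_lat_diff smooth_sym_shift word_bounds_shift) auto
    moreover have "(m - \<rho>) + m' = m + m' - \<rho>" "m + (m' - \<rho>) = m + m' - \<rho>" by simp_all
    ultimately show ?thesis
      using Suc.prems(1,2) by (simp only: word_bounds_add smooth_sym_mult smooth_sym_lat_diff smooth_sym_shift)
  qed
  moreover have "word_bounds h \<rho> \<delta> r (m + m' + \<delta>) (tor_diff j (\<lambda>k \<theta>. \<sigma> k \<theta> * \<tau> k \<theta>))" for j
  proof -
    have "word_bounds h \<rho> \<delta> r ((m + \<delta>) + m') (\<lambda>k \<theta>. tor_diff j \<sigma> k \<theta> * \<tau> k \<theta>)"
      using Suc.prems e by (intro Suc.IH smooth_sym_tor_diff) auto
    moreover have "word_bounds h \<rho> \<delta> r (m + (m' + \<delta>)) (\<lambda>k \<theta>. \<sigma> k \<theta> * tor_diff j \<tau> k \<theta>)"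
      using Suc.prems e by (intro Suc.IH smooth_sym_tor_diff) auto
    moreover have "(m + \<delta>) + m' = m + m' + \<delta>" "m + (m' + \<delta>) = m + m' + \<delta>" by simp_all
    ultimately show ?thesis using Suc.prems(1,2)
      by (intro word_bounds_cong[OF tor_diff_mult, THEN iffD2] word_bounds_add smooth_sym_mult smooth_sym_tor_diff) simp_all
  qed
  ultimately show ?case using Suc.prems by (auto intro: order_bound_mult)
qed (auto intro: order_bound_mult)

lemma word_bounds_zero: "word_bounds h \<rho> \<delta> r m (\<lambda>k \<theta>. 0)"
proof (induction r arbitrary: m)
  case (Suc r)
  have "lat_diff h j (\<lambda>k \<theta>. 0) = (\<lambda>k \<theta>. 0)" "tor_diff j (\<lambda>k \<theta>. 0) = (\<lambda>k \<theta>. 0)" for j :: 'a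
    by (auto simp: lat_diff_def diff1_def tor_diff_def fun_eq_iff)
  with Suc show ?case by (auto simp: order_bound_def intro: exI[of _ 0])
qed (auto simp: order_bound_def intro: exI[of _ 0])

lemma word_bounds_const: "word_bounds h \<rho> \<delta> r 0 (\<lambda>k \<theta>. c)"
proof (cases r)
  case (Suc r')
  have "lat_diff h j (\<lambda>k \<theta>. c) = (\<lambda>k \<theta>. 0)" "tor_diff j (\<lambda>k \<theta>. c) = (\<lambda>k \<theta>. 0)" for j :: 'a
    by (auto simp: lat_diff_def diff1_def tor_diff_def fun_eq_iff)
  with Suc show ?thesis by (auto simp: order_bound_const word_bounds_zero)
qed (auto simp: order_bound_const)

lemma order_bound_inverse:
  fixes \<sigma> :: "'n::finite sym"
  assumes c: "c > 0" "\<And>k \<theta>. k \<in> hlattice h \<Longrightarrow> norm (\<sigma> k \<theta>) \<ge> c * (1 + norm k) powr m"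
  shows "order_bound h (- m) (\<lambda>k \<theta>. inverse (\<sigma> k \<theta>))"
proof (rule bndI)
  fix k \<theta> :: "real ^ 'n" assume k: "k \<in> hlattice h"
  have pos: "c * (1 + norm k) powr m > 0"
    using c(1) by (intro mult_pos_pos) (auto simp: add_nonneg_eq_0_iff)
  have "norm (inverse (\<sigma> k \<theta>)) \<le> inverse (c * (1 + norm k) powr m)"
    unfolding norm_inverse by (rule le_imp_inverse_le[OF c(2)[OF k] pos])
  also have "\<dots> = inverse c * (1 + norm k) powr - m" by (simp add: powr_minus)
  finally show "norm (inverse (\<sigma> k \<theta>)) \<le> inverse c * (1 + norm k) powr - m" .
qed

text \<open>A first-order operator applied to \<open>1 / \<sigma>\<close> gives minus its value on
  \<open>\<sigma>\<close> times two inverses, one of them shifted in the case of a difference. The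
  inverses satisfy the bounds for shorter words by induction, and products are already
  understood.\<close>

lemma word_bounds_inverse:
  assumes s: "smooth_sym h \<sigma>" and c: "c > 0" "\<And>k \<theta>. k \<in> hlattice h \<Longrightarrow> norm (\<sigma> k \<theta>) \<ge> c * (1 + norm k) powr m"
    and e: "word_bounds h \<rho> \<delta> r m \<sigma>"
  shows "word_bounds h \<rho> \<delta> r (- m) (\<lambda>k \<theta>. inverse (\<sigma> k \<theta>))"
  using e
proof (induction r)
  case 0
  then show ?case using order_bound_inverse[OF c] by simp
next
  case (Suc r)
  have nz: "\<sigma> k \<theta> \<noteq> 0" if "k \<in> hlattice h" for k \<theta>
  proof -
    have "c * (1 + norm k) powr m > 0"
      using c(1) by (intro mult_pos_pos) (auto simp: add_nonneg_eq_0_iff)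
    with c(2)[OF that, of \<theta>] show ?thesis by auto
  qed
  let ?\<tau> = "\<lambda>k \<theta>. inverse (\<sigma> k \<theta>)"
  have ss: "smooth_sym h ?\<tau>" by (rule smooth_sym_inverse[OF s nz])
  have e: "word_bounds h \<rho> \<delta> r (- m) ?\<tau>"
    using Suc by (auto intro: word_bounds_Suc_imp_word_bounds simp del: word_bounds.simps)
  have cm: "word_bounds h \<rho> \<delta> r a (\<lambda>k \<theta>. -1 * \<upsilon> k \<theta>)" if "smooth_sym h \<upsilon>" "word_bounds h \<rho> \<delta> r a \<upsilon>" for \<upsilon> a
    using word_bounds_mult[OF smooth_sym_const that(1) word_bounds_const[of h \<rho> \<delta> r "-1"] that(2)] by simp
  have "word_bounds h \<rho> \<delta> r (- m - \<rho>) (lat_diff h j ?\<tau>)" for j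
  proof -
    \<comment> \<open>For \<open>h = 0\<close> both sides vanish, as division by 0 gives 0.\<close>
    have *: "lat_diff h j ?\<tau> k = (\<lambda>\<theta>. -1 * (lat_diff h j \<sigma> k \<theta> * (?\<tau> k \<theta> * shift h j ?\<tau> k \<theta>)))" if "k \<in> hlattice h" for k
      using nz[OF that] nz[OF hlattice_axis[OF that]]
      by (intro ext) (cases "h = 0", auto simp: lat_diff_eq shift_def field_simps)
    have "word_bounds h \<rho> \<delta> r ((m - \<rho>) + (- m + - m)) (\<lambda>k \<theta>. lat_diff h j \<sigma> k \<theta> * (?\<tau> k \<theta> * shift h j ?\<tau> k \<theta>))"
      using Suc.prems by (intro word_bounds_mult smooth_sym_lat_diff smooth_sym_mult smooth_sym_shift word_bounds_shift e ss s) auto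
    then show ?thesis
      by (intro word_bounds_cong[OF *, THEN iffD2] cm smooth_sym_mult smooth_sym_lat_diff smooth_sym_shift ss s) simp_all
  qed
  moreover have "word_bounds h \<rho> \<delta> r (- m + \<delta>) (tor_diff j ?\<tau>)" for j
  proof -
    have *: "tor_diff j ?\<tau> k = (\<lambda>\<theta>. -1 * (tor_diff j \<sigma> k \<theta> * (?\<tau> k \<theta> * ?\<tau> k \<theta>)))" if "k \<in> hlattice h" for k
      using nz[OF that] ssmD[OF s that]
      by (intro ext) (auto simp: tor_diff_def partial_inverse torus_smooth_differentiable)
    have "word_bounds h \<rho> \<delta> r ((m + \<delta>) + (- m + - m)) (\<lambda>k \<theta>. tor_diff j \<sigma> k \<theta> * (?\<tau> k \<theta> * ?\<tau> k \<theta>))"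
      using Suc.prems by (intro word_bounds_mult smooth_sym_tor_diff smooth_sym_mult e ss s) auto
    then show ?thesis
      by (intro word_bounds_cong[OF *, THEN iffD2] cm smooth_sym_mult smooth_sym_tor_diff ss s) simp_all
  qed
  ultimately show ?case using order_bound_inverse[OF c] by simp
qed

section \<open>Crude estimates by torus derivatives with a single exponent, and symbols supported at
  finitely many points\<close>

primrec tor_bounds :: "real \<Rightarrow> nat \<Rightarrow> real \<Rightarrow> 'n::finite sym \<Rightarrow> bool" where
  "tor_bounds h 0 s \<sigma> \<longleftrightarrow> order_bound h s \<sigma>"
| "tor_bounds h (Suc r) s \<sigma> \<longleftrightarrow> order_bound h s \<sigma> \<and> (\<forall>j. tor_bounds h r s (tor_diff j \<sigma>))"

lemma tor_bounds_cong: "(\<And>k. k \<in> hlattice h \<Longrightarrow> \<sigma> k = \<tau> k) \<Longrightarrow> tor_bounds h r m \<sigma> \<longleftrightarrow> tor_bounds h r m \<tau>"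
proof (induction r arbitrary: \<sigma> \<tau>)
  case 0
  then show ?case using order_bound_cong[OF 0] by simp
next
  case (Suc r)
  have "tor_bounds h r m (tor_diff j \<sigma>) = tor_bounds h r m (tor_diff j \<tau>)" for j
    by (rule Suc.IH) (simp add: tor_diff_def Suc.prems)
  with order_bound_cong[OF Suc.prems] show ?case by simp
qed

lemma order_bound_lat_diff: "order_bound h m \<sigma> \<Longrightarrow> order_bound h m (lat_diff h j \<sigma>)"
  using order_bound_cmult[OF order_bound_add[OF order_bound_shift order_bound_cmult], of h m \<sigma> \<sigma> "1 / of_real h" j "-1"] by (simp add: lat_diff_eq)

lemma tor_bounds_lat_diff: "smooth_sym h \<sigma> \<Longrightarrow> tor_bounds h r m \<sigma> \<Longrightarrow> tor_bounds h r m (lat_diff h j \<sigma>)"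
proof (induction r arbitrary: \<sigma>)
  case (Suc r)
  have "tor_bounds h r m (tor_diff i (lat_diff h j \<sigma>))" for i
    using Suc.prems by (intro tor_bounds_cong[OF tor_diff_lat_diff, THEN iffD2] Suc.IH smooth_sym_tor_diff) auto
  with Suc.prems show ?case by (auto intro: order_bound_lat_diff)
qed (auto intro: order_bound_lat_diff)

text \<open>The step of the lattice is fixed, so differences are bounded operators: estimates on the
  torus derivatives alone suffice as soon as enough powers of \<open>k\<close> are available.\<close>

lemma tor_bounds_imp_word_bounds:
  assumes "\<rho> \<ge> 0" "\<delta> \<ge> 0"
  shows "smooth_sym h \<sigma> \<Longrightarrow> tor_bounds h r s \<sigma> \<Longrightarrow> s \<le> m - \<rho> * real r \<Longrightarrow> word_bounds h \<rho> \<delta> r m \<sigma>"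
proof (induction r arbitrary: m \<sigma>)
  case 0
  then show ?case by (auto intro: order_bound_mono)
next
  case (Suc r)
  have r: "\<rho> * real r \<ge> 0" "s \<le> m - \<rho> - \<rho> * real r"
    using assms Suc.prems(3) by (auto simp: algebra_simps)
  have tor_bounds: "order_bound h s \<sigma>" "tor_bounds h r s (tor_diff j \<sigma>)" for j using Suc.prems by auto
  have "tor_bounds h r s \<sigma>" using Suc.prems(2)
    by (induction r arbitrary: \<sigma>) auto
  then have "word_bounds h \<rho> \<delta> r (m - \<rho>) (lat_diff h j \<sigma>)" for j
    using Suc.prems(1) r by (intro Suc.IH smooth_sym_lat_diff tor_bounds_lat_diff)
  moreover have "word_bounds h \<rho> \<delta> r (m + \<delta>) (tor_diff j \<sigma>)" for j
    using Suc.prems(1) r tor_bounds assms by (intro Suc.IH smooth_sym_tor_diff) auto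
  moreover have "s \<le> m"
    using mult_nonneg_nonneg[OF assms(1), of "real (Suc r)"] Suc.prems(3) by linarith
  then have "order_bound h m \<sigma>" by (rule order_bound_mono[OF _ tor_bounds(1)])
  ultimately show ?case by simp
qed

lemma finite_hlattice_ball:
  assumes "h > 0"
  shows "finite {k \<in> hlattice h. norm (k :: real ^ 'n::finite) < R}"
proof -
  define I where "I = {x \<in> \<int>. \<bar>x :: real\<bar> \<le> R / h}"
  have "finite (PiE (UNIV :: 'n set) (\<lambda>_. I))"
    unfolding I_def by (intro finite_PiE finite_abs_int_segment) auto
  then have "finite ((\<lambda>g. h *\<^sub>R (\<chi> j. g j) :: real ^ 'n) ` PiE UNIV (\<lambda>_. I))" by (rule finite_imageI)
  moreover have "{k \<in> hlattice h. norm (k :: real ^ 'n) < R} \<subseteq> (\<lambda>g. h *\<^sub>R (\<chi> j. g j) :: real ^ 'n) ` PiE UNIV (\<lambda>_. I)"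
  proof safe
    fix k :: "real ^ 'n" assume k: "k \<in> hlattice h" "norm k < R"
    then obtain p where p: "k = h *\<^sub>R p" "p \<in> zlat" by (auto simp: hlattice_eq)
    have "\<bar>p $ j\<bar> \<le> R / h" for j
    proof -
      have "h * \<bar>p $ j\<bar> \<le> norm k" using component_le_norm_cart[of k j] assms by (simp add: p abs_mult)
      with k(2) assms show ?thesis by (simp add: divide_simps mult_ac)
    qed
    then have "($) p \<in> PiE UNIV (\<lambda>_. I)" using p(2) by (auto simp: I_def zlat_def)
    then show "k \<in> (\<lambda>g. h *\<^sub>R (\<chi> j. g j) :: real ^ 'n) ` PiE UNIV (\<lambda>_. I)"
      by (rule rev_image_eqI) (simp add: p)
  qed
  ultimately show ?thesis by (rule finite_subset[rotated])
qed

lemma order_bound_finite_support: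
  assumes "h > 0" "smooth_sym h \<sigma>" and van: "\<And>k \<theta>. k \<in> hlattice h \<Longrightarrow> R \<le> norm k \<Longrightarrow> \<sigma> k \<theta> = 0"
  shows "order_bound h s \<sigma>"
proof -
  have "\<exists>B. B \<ge> 0 \<and> (\<forall>\<theta>. norm (\<sigma> k \<theta>) \<le> B)" if "k \<in> hlattice h" for k
    by (meson torus_bounded torus_smooth_continuous ssmD[OF assms(2) that] torus_smooth_def)
  then obtain B where B: "\<And>k. k \<in> hlattice h \<Longrightarrow> B k \<ge> 0" "\<And>k \<theta>. k \<in> hlattice h \<Longrightarrow> norm (\<sigma> k \<theta>) \<le> B k"
    by metis
  \<comment> \<open>Only finitely many lattice points contribute, so the constant can add up their
    individual bounds.\<close>
  define C where "C = (\<Sum>k\<in>{k \<in> hlattice h. norm k < R}. B k * (1 + norm k) powr (- s))"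
  have "norm (\<sigma> k \<theta>) \<le> C * (1 + norm k) powr s" if k: "k \<in> hlattice h" for k \<theta>
  proof (cases "norm k < R")
    case True
    have "B k * (1 + norm k) powr (- s) \<le> C"
      unfolding C_def using B(1) k True
      by (intro member_le_sum[of k _ "\<lambda>k. B k * (1 + norm k) powr (- s)"] finite_hlattice_ball assms) auto
    then have "B k * (1 + norm k) powr (- s) * (1 + norm k) powr s \<le> C * (1 + norm k) powr s"
      by (intro mult_right_mono) auto
    moreover have "B k * (1 + norm k) powr (- s) * (1 + norm k) powr s = B k"
      by (simp add: add_nonneg_eq_0_iff mult.assoc flip: powr_add)
    ultimately show ?thesis using B(2)[OF k, of \<theta>] by linarith
  next
    case False
    have "C \<ge> 0" unfolding C_def using B(1) by (intro sum_nonneg) auto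
    then show ?thesis using van[OF k] False by simp
  qed
  then show ?thesis by (rule bndI)
qed

lemma tor_diff_vanish: "\<sigma> k = (\<lambda>\<theta>. 0) \<Longrightarrow> tor_diff j \<sigma> k = (\<lambda>\<theta>. 0)"
  by (auto simp: tor_diff_def)

lemma tor_bounds_finite_support:
  assumes "h > 0"
  shows "smooth_sym h \<sigma> \<Longrightarrow> (\<And>k \<theta>. k \<in> hlattice h \<Longrightarrow> R \<le> norm k \<Longrightarrow> \<sigma> k \<theta> = 0) \<Longrightarrow> tor_bounds h r s \<sigma>"
proof (induction r arbitrary: \<sigma>)
  case 0
  then show ?case using order_bound_finite_support[OF assms 0] by simp
next
  case (Suc r)
  have "tor_diff j \<sigma> k \<theta> = 0" if "k \<in> hlattice h" "R \<le> norm k" for j k \<theta>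
    using Suc.prems(2)[OF that] tor_diff_vanish[of \<sigma> k j] by (auto simp: fun_eq_iff)
  then have "tor_bounds h r s (tor_diff j \<sigma>)" for j
    by (intro Suc.IH smooth_sym_tor_diff Suc.prems) auto
  moreover have "order_bound h s \<sigma>"
    using order_bound_finite_support[OF assms Suc.prems] .
  ultimately show ?case by simp
qed

section \<open>From multi-indices to words of first-order operators\<close>

lemma diff1_commute: "diff1 h i (diff1 h j g) = diff1 h j (diff1 h i g)"
  by (rule ext) (simp add: diff1_def ac_simps diff_divide_distrib)

lemma foldr_funpow_comm:
  assumes "\<And>i g. F i (F j g) = F j (F i g)"
  shows "foldr (\<lambda>i. F i ^^ \<alpha> i) js (F j g) = F j (foldr (\<lambda>i. F i ^^ \<alpha> i) js g)"
proof -
  have "(F i ^^ n) (F j g) = F j ((F i ^^ n) g)" for i n g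
    by (induction n) (auto simp: assms)
  then show ?thesis by (induction js) auto
qed

text \<open>Commutation brings the additional factor \<open>F j\<close> to the outside, wherever
  \<open>j\<close> stands in the enumeration; distinctness ensures that \<open>j\<close> is met only
  once.\<close>

lemma foldr_funpow_upd:
  assumes comm: "\<And>i g. F i (F j g) = F j (F i g)"
  shows "distinct js \<Longrightarrow> j \<in> set js \<Longrightarrow>
    foldr (\<lambda>i. F i ^^ (\<alpha>(j := Suc (\<alpha> j))) i) js g = F j (foldr (\<lambda>i. F i ^^ \<alpha> i) js g)"
proof (induction js)
  case (Cons i js)
  have pow: "(F i ^^ n) (F j g) = F j ((F i ^^ n) g)" for i n g
    by (induction n) (auto simp: comm)
  show ?case
  proof (cases "i = j")
    case True
    then have "foldr (\<lambda>i. F i ^^ (\<alpha>(j := Suc (\<alpha> j))) i) js g = foldr (\<lambda>i. F i ^^ \<alpha> i) js g"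
      using Cons.prems by (intro foldr_cong) auto
    with True show ?thesis by simp
  next
    case False
    then show ?thesis using Cons by (simp add: pow)
  qed
qed auto

lemma diff_op_upd: "diff_op h (\<alpha>(j := Suc (\<alpha> j))) g = diff_op h \<alpha> (diff1 h j g)"
  unfolding diff_op_def
  by (subst foldr_funpow_upd) (auto simp: foldr_funpow_comm diff1_commute distinct_coords set_coords)

definition lat_diffs :: "real \<Rightarrow> ('n::finite \<Rightarrow> nat) \<Rightarrow> 'n sym \<Rightarrow> 'n sym" where
  "lat_diffs h \<alpha> \<sigma> = foldr (\<lambda>j. lat_diff h j ^^ \<alpha> j) coords \<sigma>"

definition tor_ops :: "real \<Rightarrow> ('n::finite \<Rightarrow> nat) \<Rightarrow> 'n sym \<Rightarrow> 'n sym" where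
  "tor_ops h \<beta> \<sigma> = (\<lambda>k. tor_op h \<beta> (\<sigma> k))"

lemma lat_diffs_eq: "lat_diffs h \<alpha> \<sigma> k \<theta> = diff_op h \<alpha> (\<lambda>\<kappa>. \<sigma> \<kappa> \<theta>) k"
proof -
  have 1: "(\<lambda>\<kappa>. (lat_diff h j ^^ n) \<sigma> \<kappa> \<theta>) = (diff1 h j ^^ n) (\<lambda>\<kappa>. \<sigma> \<kappa> \<theta>)" for j n \<sigma>
    by (induction n) (auto simp: lat_diff_def)
  have "(\<lambda>\<kappa>. foldr (\<lambda>j. lat_diff h j ^^ \<alpha> j) js \<sigma> \<kappa> \<theta>) = foldr (\<lambda>j. diff1 h j ^^ \<alpha> j) js (\<lambda>\<kappa>. \<sigma> \<kappa> \<theta>)" for js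
    by (induction js) (auto simp: 1)
  then show ?thesis by (simp add: lat_diffs_def diff_op_def fun_eq_iff)
qed

lemma torus_smooth_tor1: "torus_smooth f \<Longrightarrow> torus_smooth (tor1 j l f)"
  unfolding tor1_def[abs_def]
  by (intro torus_smooth_diff torus_smooth_cmult torus_smooth_partial)

lemma fourier_coef_tor1:
  assumes "torus_smooth f" "p \<in> zlat"
  shows "fourier_coef (tor1 j l f) p = (of_real (p $ j) - of_nat l) * fourier_coef f p"
  unfolding tor1_def[abs_def]
  using assms by (subst fourier_coef_diff)
    (auto intro!: continuous_intros torus_smooth_continuous torus_smooth_partial torus_smooth_cmult
      simp only: fourier_coef_cmult fourier_coef_partial, simp add: ring_distribs)

lemma torus_smooth_foldr_tor1: "torus_smooth f \<Longrightarrow> torus_smooth (foldr (tor1 j) ls f)"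
  by (induction ls) (auto intro: torus_smooth_tor1)

lemma fourier_coef_foldr_tor1:
  assumes "torus_smooth f" "p \<in> zlat"
  shows "fourier_coef (foldr (tor1 j) ls f) p = (\<Prod>l\<leftarrow>ls. of_real (p $ j) - of_nat l) * fourier_coef f p"
  by (induction ls) (auto simp: fourier_coef_tor1 torus_smooth_foldr_tor1 assms)

text \<open>The falling factorial power of \<open>p\<close>. Up to the factor
  \<open>h ^ mlen \<beta>\<close> it is the Fourier multiplier of
  \<open>tor_op h \<beta>\<close>.\<close>

definition falling :: "('n::finite \<Rightarrow> nat) \<Rightarrow> real ^ 'n \<Rightarrow> complex" where
  "falling \<beta> p = (\<Prod>j\<in>UNIV. \<Prod>l<\<beta> j. of_real (p $ j) - of_nat l)"

lemma falling_upd: "falling (\<beta>(j := Suc (\<beta> j))) p = (of_real (p $ j) - of_nat (\<beta> j)) * falling \<beta> p"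
proof -
  have "falling (\<beta>(j := Suc (\<beta> j))) p = (\<Prod>l<Suc (\<beta> j). of_real (p $ j) - of_nat l) *
     (\<Prod>i\<in>UNIV - {j}. \<Prod>l<\<beta> i. of_real (p $ i) - of_nat l)"
    unfolding falling_def by (subst prod.remove[of _ j]) auto
  also have "\<dots> = (of_real (p $ j) - of_nat (\<beta> j)) * falling \<beta> p"
    unfolding falling_def by (subst (2) prod.remove[of _ j]) auto
  finally show ?thesis .
qed

lemma torus_smooth_foldr_foldr_tor1:
  "torus_smooth f \<Longrightarrow> torus_smooth (foldr (\<lambda>j. foldr (tor1 j) [0..<\<beta> j]) js f)"
  by (induction js) (auto intro: torus_smooth_foldr_tor1)

lemma torus_smooth_tor_op: "torus_smooth f \<Longrightarrow> torus_smooth (tor_op h \<beta> f)"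
  unfolding tor_op_def[abs_def]
  by (intro torus_smooth_cmult torus_smooth_foldr_foldr_tor1)

lemma fourier_coef_tor_op:
  fixes f :: "real ^ 'n::finite \<Rightarrow> complex"
  assumes "torus_smooth f" "p \<in> zlat"
  shows "fourier_coef (tor_op h \<beta> f) p = of_real (h ^ mlen \<beta>) * falling \<beta> p * fourier_coef f p"
proof -
  have "fourier_coef (foldr (\<lambda>j. foldr (tor1 j) [0..<\<beta> j]) js f) p =
     (\<Prod>j\<leftarrow>js. \<Prod>l<\<beta> j. of_real (p $ j) - of_nat l) * fourier_coef f p" for js
    by (induction js) (auto simp: fourier_coef_foldr_tor1 torus_smooth_foldr_foldr_tor1 assms prod.distinct_set_conv_list[symmetric]
      lessThan_atLeast0)
  moreover have "(\<Prod>j\<leftarrow>coords. \<Prod>l<\<beta> j. of_real (p $ j) - of_nat l) = falling \<beta> p"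
    unfolding falling_def by (simp add: prod.distinct_set_conv_list[symmetric] distinct_coords set_coords)
  ultimately show ?thesis unfolding tor_op_def[abs_def] by (simp add: fourier_coef_cmult)
qed

text \<open>Torus operators commute because their Fourier multipliers do.\<close>

lemma tor_op_partial:
  assumes f: "torus_smooth f" and h: "h \<noteq> 0"
  shows "tor_op h \<beta> (partial j f) \<theta> =
    2 * of_real pi * \<i> * (1 / of_real h * tor_op h (\<beta>(j := Suc (\<beta> j))) f \<theta> + of_nat (\<beta> j) * tor_op h \<beta> f \<theta>)"
proof -
  have "tor_op h \<beta> (partial j f) = (\<lambda>\<theta>. 2 * of_real pi * \<i> *
    (1 / of_real h * tor_op h (\<beta>(j := Suc (\<beta> j))) f \<theta> + of_nat (\<beta> j) * tor_op h \<beta> f \<theta>))"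
  proof (rule torus_smooth_fourier_coef_eqI)
    fix p :: "real ^ 'a" assume p: "p \<in> zlat"
    have "fourier_coef (\<lambda>\<theta>. 1 / of_real h * tor_op h (\<beta>(j := Suc (\<beta> j))) f \<theta> + of_nat (\<beta> j) * tor_op h \<beta> f \<theta>) p
      = 1 / of_real h * fourier_coef (tor_op h (\<beta>(j := Suc (\<beta> j))) f) p + of_nat (\<beta> j) * fourier_coef (tor_op h \<beta> f) p"
      by (subst fourier_coef_add) (auto intro!: torus_smooth_continuous torus_smooth_cmult torus_smooth_tor_op f simp only: fourier_coef_cmult)
    \<comment> \<open>The multipliers satisfy \<open>p_j * falling \<beta> p = falling (\<beta> +
      e_j) p + \<beta>_j * falling \<beta> p\<close>.\<close>
    also have "\<dots> = of_real (h ^ mlen \<beta>) * falling \<beta> p * (of_real (p $ j) * fourier_coef f p)"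
      using h by (simp add: fourier_coef_tor_op f p falling_upd mlen_upd field_simps)
    finally show "fourier_coef (tor_op h \<beta> (partial j f)) p = fourier_coef (\<lambda>\<theta>. 2 * of_real pi * \<i> *
       (1 / of_real h * tor_op h (\<beta>(j := Suc (\<beta> j))) f \<theta> + of_nat (\<beta> j) * tor_op h \<beta> f \<theta>)) p"
      unfolding fourier_coef_cmult[of "2 * of_real pi * \<i>"]
      by (simp add: fourier_coef_tor_op torus_smooth_partial fourier_coef_partial f p)
  qed (intro torus_smooth_tor_op torus_smooth_partial torus_smooth_cmult torus_smooth_add f)+
  then show ?thesis by (simp add: fun_eq_iff)
qed

definition multi_bounds :: "real \<Rightarrow> real \<Rightarrow> real \<Rightarrow> real \<Rightarrow> 'n::finite sym \<Rightarrow> bool" where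
  "multi_bounds h \<rho> \<delta> \<mu> \<sigma> \<longleftrightarrow> (\<forall>\<alpha> \<beta>. order_bound h (\<mu> - \<rho> * real (mlen \<alpha>) + \<delta> * real (mlen \<beta>)) (tor_ops h \<beta> (lat_diffs h \<alpha> \<sigma>)))"

lemma symbols_iff_multi_bounds: "\<sigma> \<in> symbols h \<rho> \<delta> \<mu> \<longleftrightarrow> smooth_sym h \<sigma> \<and> multi_bounds h \<rho> \<delta> \<mu> \<sigma>"
proof -
  have *: "(\<lambda>\<phi>. diff_op h \<alpha> (\<lambda>\<kappa>. \<sigma> \<kappa> \<phi>) k) = lat_diffs h \<alpha> \<sigma> k" for \<alpha> k
    by (simp add: lat_diffs_eq fun_eq_iff)
  show ?thesis
    unfolding symbols_def mem_Collect_eq smooth_sym_def multi_bounds_def * tor_ops_def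
    using order_bound_pos by (fastforce simp: order_bound_def)
qed

lemma multi_bounds_lat_diff:
  assumes "multi_bounds h \<rho> \<delta> \<mu> \<sigma>"
  shows "multi_bounds h \<rho> \<delta> (\<mu> - \<rho>) (lat_diff h j \<sigma>)"
  unfolding multi_bounds_def
proof (intro allI)
  fix \<alpha> \<beta> :: "'a \<Rightarrow> nat"
  have "lat_diffs h \<alpha> (lat_diff h j \<sigma>) = lat_diffs h (\<alpha>(j := Suc (\<alpha> j))) \<sigma>"
    by (intro ext) (simp add: lat_diffs_eq diff_op_upd lat_diff_def)
  moreover have "order_bound h (\<mu> - \<rho> * real (mlen (\<alpha>(j := Suc (\<alpha> j)))) + \<delta> * real (mlen \<beta>)) (tor_ops h \<beta> (lat_diffs h (\<alpha>(j := Suc (\<alpha> j))) \<sigma>))"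
    using assms by (simp only: multi_bounds_def)
  moreover have "\<mu> - \<rho> * real (mlen (\<alpha>(j := Suc (\<alpha> j)))) + \<delta> * real (mlen \<beta>)
     = \<mu> - \<rho> - \<rho> * real (mlen \<alpha>) + \<delta> * real (mlen \<beta>)"
    by (simp add: mlen_upd algebra_simps)
  ultimately show "order_bound h (\<mu> - \<rho> - \<rho> * real (mlen \<alpha>) + \<delta> * real (mlen \<beta>)) (tor_ops h \<beta> (lat_diffs h \<alpha> (lat_diff h j \<sigma>)))"
    by simp
qed

lemma lat_diffs_induct:
  assumes "P 0 \<sigma>" and "\<And>n j \<sigma>. P n \<sigma> \<Longrightarrow> P (Suc n) (lat_diff h j \<sigma>)"
  shows "P (mlen \<alpha>) (lat_diffs h \<alpha> \<sigma>)"
proof -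
  have 1: "P n \<tau> \<Longrightarrow> P (m + n) ((lat_diff h j ^^ m) \<tau>)" for n m \<tau> j
    by (induction m) (auto intro: assms(2))
  have "P (\<Sum>j\<leftarrow>js. \<alpha> j) (foldr (\<lambda>j. lat_diff h j ^^ \<alpha> j) js \<sigma>)" for js
    by (induction js) (auto intro: assms(1) 1)
  from this[of coords] show ?thesis by (simp add: lat_diffs_def sum_list_coords mlen_def)
qed

lemma smooth_sym_lat_diffs: "smooth_sym h \<sigma> \<Longrightarrow> smooth_sym h (lat_diffs h \<alpha> \<sigma>)"
  by (rule lat_diffs_induct[where P = "\<lambda>_. smooth_sym h"]) (auto intro: smooth_sym_lat_diff)

lemma smooth_sym_tor_ops: "smooth_sym h \<sigma> \<Longrightarrow> smooth_sym h (tor_ops h \<beta> \<sigma>)"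
  by (auto simp: smooth_sym_def tor_ops_def intro: torus_smooth_tor_op)

lemma tor_diff_lat_diffs:
  assumes "smooth_sym h \<sigma>" "k \<in> hlattice h"
  shows "tor_diff i (lat_diffs h \<alpha> \<sigma>) k = lat_diffs h \<alpha> (tor_diff i \<sigma>) k"
proof -
  \<comment> \<open>The operators commute only on smooth symbols and only at lattice points, so
    smoothness and agreement on the lattice are carried through the fold together.\<close>
  define eqv where "eqv = (\<lambda>\<sigma> \<tau> :: 'a sym. smooth_sym h \<sigma> \<and> (\<forall>k\<in>hlattice h. tor_diff i \<sigma> k = \<tau> k))"
  have 1: "eqv (lat_diff h j \<sigma>) (lat_diff h j \<tau>)" if "eqv \<sigma> \<tau>" for \<sigma> \<tau> j
    using that lat_diff_cong[of h "tor_diff i \<sigma>" \<tau> _ j] by (auto simp: eqv_def tor_diff_lat_diff smooth_sym_lat_diff)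
  have 2: "eqv \<sigma> \<tau> \<Longrightarrow> eqv ((lat_diff h j ^^ m) \<sigma>) ((lat_diff h j ^^ m) \<tau>)" for \<sigma> \<tau> j m
    by (induction m) (auto intro: 1)
  have "eqv (foldr (\<lambda>j. lat_diff h j ^^ \<alpha> j) js \<sigma>) (foldr (\<lambda>j. lat_diff h j ^^ \<alpha> j) js (tor_diff i \<sigma>))" for js
  proof (induction js)
    case Nil
    then show ?case using assms(1) by (simp add: eqv_def)
  next
    case (Cons j js)
    from 2[OF this] show ?case by simp
  qed
  with assms(2) show ?thesis by (auto simp: eqv_def lat_diffs_def)
qed

text \<open>A plain derivative is a combination of the toroidal operators of index
  \<open>\<beta> + e_j\<close> and \<open>\<beta>\<close>. The second has the smaller exponent,
  which is harmless because \<open>\<delta>\<close> is nonnegative.\<close>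

lemma multi_bounds_tor_diff:
  assumes "smooth_sym h \<sigma>" "multi_bounds h \<rho> \<delta> \<mu> \<sigma>" and h: "h > 0" and "\<delta> \<ge> 0"
  shows "multi_bounds h \<rho> \<delta> (\<mu> + \<delta>) (tor_diff j \<sigma>)"
  unfolding multi_bounds_def
proof (intro allI)
  fix \<alpha> \<beta> :: "'a \<Rightarrow> nat"
  let ?m = "\<mu> + \<delta> - \<rho> * real (mlen \<alpha>) + \<delta> * real (mlen \<beta>)"
  let ?G = "lat_diffs h \<alpha> \<sigma>"
  have eq: "tor_ops h \<beta> (lat_diffs h \<alpha> (tor_diff j \<sigma>)) k = (\<lambda>\<theta>. 2 * of_real pi * \<i> * (1 / of_real h * tor_ops h (\<beta>(j := Suc (\<beta> j))) ?G k \<theta>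
      + of_nat (\<beta> j) * tor_ops h \<beta> ?G k \<theta>))" if k: "k \<in> hlattice h" for k
  proof
    fix \<theta>
    have "lat_diffs h \<alpha> (tor_diff j \<sigma>) k = partial j (?G k)"
      using tor_diff_lat_diffs[OF assms(1) k, of j \<alpha>] by (simp add: tor_diff_def)
    then show "tor_ops h \<beta> (lat_diffs h \<alpha> (tor_diff j \<sigma>)) k \<theta> = 2 * of_real pi * \<i> * (1 / of_real h * tor_ops h (\<beta>(j := Suc (\<beta> j))) ?G k \<theta>
      + of_nat (\<beta> j) * tor_ops h \<beta> ?G k \<theta>)"
      using tor_op_partial[OF ssmD[OF smooth_sym_lat_diffs[OF assms(1)] k], where h = h and \<beta> = \<beta> and j = j and \<theta> = \<theta>] h
      by (simp add: tor_ops_def)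
  qed
  have "order_bound h (\<mu> - \<rho> * real (mlen \<alpha>) + \<delta> * real (mlen (\<beta>(j := Suc (\<beta> j))))) (tor_ops h (\<beta>(j := Suc (\<beta> j))) ?G)"
    using assms(2) by (simp only: multi_bounds_def)
  then have 1: "order_bound h ?m (tor_ops h (\<beta>(j := Suc (\<beta> j))) ?G)"
    by (simp add: mlen_upd algebra_simps)
  have "order_bound h (\<mu> - \<rho> * real (mlen \<alpha>) + \<delta> * real (mlen \<beta>)) (tor_ops h \<beta> ?G)"
    using assms(2) by (simp only: multi_bounds_def)
  then have 2: "order_bound h ?m (tor_ops h \<beta> ?G)"
    using assms(4) by (elim order_bound_mono[rotated]) auto
  show "order_bound h ?m (tor_ops h \<beta> (lat_diffs h \<alpha> (tor_diff j \<sigma>)))"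
    by (intro order_bound_cong[OF eq, THEN iffD2] order_bound_cmult order_bound_add 1 2)
qed

lemma foldr_id: "foldr (\<lambda>j. id) js x = x"
  by (induction js) auto

lemma multi_bounds_imp_order_bound: "multi_bounds h \<rho> \<delta> \<mu> \<sigma> \<Longrightarrow> order_bound h \<mu> \<sigma>"
proof -
  assume "multi_bounds h \<rho> \<delta> \<mu> \<sigma>"
  then have "order_bound h (\<mu> - \<rho> * real (mlen (\<lambda>_::'a. 0)) + \<delta> * real (mlen (\<lambda>_::'a. 0))) (tor_ops h (\<lambda>_. 0) (lat_diffs h (\<lambda>_. 0) \<sigma>))"
    by (simp only: multi_bounds_def)
  moreover have "tor_ops h (\<lambda>_. 0) (lat_diffs h (\<lambda>_. 0) \<sigma>) = \<sigma>"
    by (intro ext) (simp add: tor_ops_def tor_op_def mlen_def lat_diffs_def foldr_id)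
  ultimately show ?thesis by (simp add: mlen_def)
qed

lemma multi_bounds_imp_word_bounds:
  assumes "h > 0" "\<delta> \<ge> 0"
  shows "smooth_sym h \<sigma> \<Longrightarrow> multi_bounds h \<rho> \<delta> \<mu> \<sigma> \<Longrightarrow> word_bounds h \<rho> \<delta> r \<mu> \<sigma>"
proof (induction r arbitrary: \<mu> \<sigma>)
  case 0
  then show ?case by (auto dest: multi_bounds_imp_order_bound)
next
  case (Suc r)
  have "word_bounds h \<rho> \<delta> r (\<mu> - \<rho>) (lat_diff h j \<sigma>)" "word_bounds h \<rho> \<delta> r (\<mu> + \<delta>) (tor_diff j \<sigma>)" for j
    using Suc.prems assms by (intro Suc.IH smooth_sym_lat_diff smooth_sym_tor_diff multi_bounds_lat_diff multi_bounds_tor_diff; simp)+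
  with multi_bounds_imp_order_bound[OF Suc.prems(2)] show ?case by simp
qed

text \<open>Working form of \<open>symbols\<close>, with which it is identified in
  \<open>symbols_iff\<close> for positive \<open>h\<close> and nonnegative \<open>\<delta>\<close>.
  Closure under products and inverses comes from the words, and closure under multi-index operators
  is then derived.\<close>

definition symclass :: "real \<Rightarrow> real \<Rightarrow> real \<Rightarrow> real \<Rightarrow> 'n::finite sym \<Rightarrow> bool" where
  "symclass h \<rho> \<delta> m \<sigma> \<longleftrightarrow> smooth_sym h \<sigma> \<and> (\<forall>r. word_bounds h \<rho> \<delta> r m \<sigma>)"

lemma sym_smooth_sym: "symclass h \<rho> \<delta> m \<sigma> \<Longrightarrow> smooth_sym h \<sigma>"
  and sym_word_bounds: "symclass h \<rho> \<delta> m \<sigma> \<Longrightarrow> word_bounds h \<rho> \<delta> r m \<sigma>"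
  by (auto simp: symclass_def)

lemma sym_order_bound: "symclass h \<rho> \<delta> m \<sigma> \<Longrightarrow> order_bound h m \<sigma>"
  using sym_word_bounds[of h \<rho> \<delta> m \<sigma> 0] by simp

lemma sym_cong: "(\<And>k. k \<in> hlattice h \<Longrightarrow> \<sigma> k = \<tau> k) \<Longrightarrow> symclass h \<rho> \<delta> m \<sigma> \<longleftrightarrow> symclass h \<rho> \<delta> m \<tau>"
  using word_bounds_cong[of h \<sigma> \<tau>] smooth_sym_cong[of h \<sigma> \<tau>] by (simp add: symclass_def)

lemma sym_mono: "symclass h \<rho> \<delta> m \<sigma> \<Longrightarrow> m \<le> m' \<Longrightarrow> symclass h \<rho> \<delta> m' \<sigma>"
  by (auto simp: symclass_def intro: word_bounds_mono)

lemma sym_add: "symclass h \<rho> \<delta> m \<sigma> \<Longrightarrow> symclass h \<rho> \<delta> m \<tau> \<Longrightarrow> symclass h \<rho> \<delta> m (\<lambda>k \<theta>. \<sigma> k \<theta> + \<tau> k \<theta>)"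
  by (auto simp: symclass_def intro: word_bounds_add smooth_sym_add)

lemma sym_mult: "symclass h \<rho> \<delta> m \<sigma> \<Longrightarrow> symclass h \<rho> \<delta> m' \<tau> \<Longrightarrow> symclass h \<rho> \<delta> (m + m') (\<lambda>k \<theta>. \<sigma> k \<theta> * \<tau> k \<theta>)"
  by (auto simp: symclass_def intro: word_bounds_mult smooth_sym_mult)

lemma sym_const: "symclass h \<rho> \<delta> 0 (\<lambda>k \<theta>. c)"
  by (auto simp: symclass_def intro: word_bounds_const smooth_sym_const)

lemma sym_zero: "symclass h \<rho> \<delta> m (\<lambda>k \<theta>. 0)"
  by (auto simp: symclass_def intro: word_bounds_zero smooth_sym_const)

lemma sym_cmult: "symclass h \<rho> \<delta> m \<sigma> \<Longrightarrow> symclass h \<rho> \<delta> m (\<lambda>k \<theta>. c * \<sigma> k \<theta>)"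
  using sym_mult[OF sym_const, of h \<rho> \<delta> m \<sigma> c] by simp

lemma sym_diff: "symclass h \<rho> \<delta> m \<sigma> \<Longrightarrow> symclass h \<rho> \<delta> m \<tau> \<Longrightarrow> symclass h \<rho> \<delta> m (\<lambda>k \<theta>. \<sigma> k \<theta> - \<tau> k \<theta>)"
  using sym_add[OF _ sym_cmult, of h \<rho> \<delta> m \<sigma> \<tau> "-1"] by simp

lemma sym_sum: "(\<And>i. i \<in> I \<Longrightarrow> symclass h \<rho> \<delta> m (\<sigma> i)) \<Longrightarrow> symclass h \<rho> \<delta> m (\<lambda>k \<theta>. \<Sum>i\<in>I. \<sigma> i k \<theta>)"
  by (induction I rule: infinite_finite_induct) (auto intro: sym_add sym_zero)

lemma sym_lat_diff: "symclass h \<rho> \<delta> m \<sigma> \<Longrightarrow> symclass h \<rho> \<delta> (m - \<rho>) (lat_diff h j \<sigma>)"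
  unfolding symclass_def by (metis word_bounds.simps(2) smooth_sym_lat_diff)

lemma sym_tor_diff: "symclass h \<rho> \<delta> m \<sigma> \<Longrightarrow> symclass h \<rho> \<delta> (m + \<delta>) (tor_diff j \<sigma>)"
  unfolding symclass_def by (metis word_bounds.simps(2) smooth_sym_tor_diff)

lemma sym_inverse:
  assumes "symclass h \<rho> \<delta> m \<sigma>" "c > 0" "\<And>k \<theta>. k \<in> hlattice h \<Longrightarrow> norm (\<sigma> k \<theta>) \<ge> c * (1 + norm k) powr m"
  shows "symclass h \<rho> \<delta> (- m) (\<lambda>k \<theta>. inverse (\<sigma> k \<theta>))"
proof -
  have "\<sigma> k \<theta> \<noteq> 0" if "k \<in> hlattice h" for k \<theta>
  proof -
    have "c * (1 + norm k) powr m > 0"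
      using assms(2) by (intro mult_pos_pos) (auto simp: add_nonneg_eq_0_iff)
    with assms(3)[OF that, of \<theta>] show ?thesis by auto
  qed
  with assms show ?thesis
    unfolding symclass_def using word_bounds_inverse[OF _ assms(2,3)] by (auto intro: smooth_sym_inverse)
qed

lemma sym_lat_diffs: "symclass h \<rho> \<delta> m \<sigma> \<Longrightarrow> symclass h \<rho> \<delta> (m - \<rho> * real (mlen \<alpha>)) (lat_diffs h \<alpha> \<sigma>)"
proof (rule lat_diffs_induct[where P = "\<lambda>n. symclass h \<rho> \<delta> (m - \<rho> * real n)"])
  fix n j \<sigma> assume "symclass h \<rho> \<delta> (m - \<rho> * real n) \<sigma>"
  from sym_lat_diff[OF this, of j] show "symclass h \<rho> \<delta> (m - \<rho> * real (Suc n)) (lat_diff h j \<sigma>)"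
    by (simp add: algebra_simps)
qed auto

lemma sym_tor_ops:
  assumes "symclass h \<rho> \<delta> m \<sigma>" "\<delta> \<ge> 0"
  shows "symclass h \<rho> \<delta> (m + \<delta> * real (mlen \<beta>)) (tor_ops h \<beta> \<sigma>)"
proof -
  have 1: "symclass h \<rho> \<delta> (m + \<delta>) (\<lambda>k. tor1 j l (\<sigma> k))" if "symclass h \<rho> \<delta> m \<sigma>" for m \<sigma> j l
  proof -
    have "symclass h \<rho> \<delta> (m + \<delta>) (\<lambda>k \<theta>. 1 / (2 * of_real pi * \<i>) * tor_diff j \<sigma> k \<theta> - of_nat l * \<sigma> k \<theta>)"
      using that assms(2) by (intro sym_diff sym_cmult sym_tor_diff sym_mono[OF that]) auto
    then show ?thesis by (simp add: tor1_def[abs_def] tor_diff_def)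
  qed
  have 2: "symclass h \<rho> \<delta> (m + \<delta> * real (length ls)) (\<lambda>k. foldr (tor1 j) ls (\<sigma> k))" if "symclass h \<rho> \<delta> m \<sigma>" for m \<sigma> j ls
  proof (induction ls)
    case (Cons l ls)
    have "symclass h \<rho> \<delta> ((m + \<delta> * real (length ls)) + \<delta>) (\<lambda>k. tor1 j l (foldr (tor1 j) ls (\<sigma> k)))"
      by (rule 1[OF Cons])
    then show ?case by (simp add: algebra_simps)
  qed (use that in auto)
  have "symclass h \<rho> \<delta> (m + \<delta> * real (\<Sum>j\<leftarrow>js. \<beta> j)) (\<lambda>k. foldr (\<lambda>j. foldr (tor1 j) [0..<\<beta> j]) js (\<sigma> k))" for js
  proof (induction js)
    case (Cons j js)
    have "symclass h \<rho> \<delta> ((m + \<delta> * real (\<Sum>j\<leftarrow>js. \<beta> j)) + \<delta> * real (length [0..<\<beta> j]))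
      (\<lambda>k. foldr (tor1 j) [0..<\<beta> j] (foldr (\<lambda>j. foldr (tor1 j) [0..<\<beta> j]) js (\<sigma> k)))"
      by (rule 2[OF Cons])
    then show ?case by (simp add: algebra_simps)
  qed (use assms in auto)
  from sym_cmult[OF this[of coords], of "of_real (h ^ mlen \<beta>)"] show ?thesis
    by (simp add: tor_ops_def tor_op_def[abs_def] sum_list_coords mlen_def)
qed

lemma symbols_iff:
  assumes "h > 0" "\<delta> \<ge> 0"
  shows "\<sigma> \<in> symbols h \<rho> \<delta> m \<longleftrightarrow> symclass h \<rho> \<delta> m \<sigma>"
proof
  assume "\<sigma> \<in> symbols h \<rho> \<delta> m"
  then show "symclass h \<rho> \<delta> m \<sigma>"
    using multi_bounds_imp_word_bounds[OF assms] by (auto simp: symbols_iff_multi_bounds symclass_def)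
next
  assume s: "symclass h \<rho> \<delta> m \<sigma>"
  have "multi_bounds h \<rho> \<delta> m \<sigma>"
    unfolding multi_bounds_def using s assms by (auto intro!: sym_order_bound sym_tor_ops sym_lat_diffs)
  with s show "\<sigma> \<in> symbols h \<rho> \<delta> m"
    by (auto simp: symbols_iff_multi_bounds sym_smooth_sym)
qed

text \<open>Only finitely many lattice points carry such a symbol, so any power of \<open>k\<close>
  is available.\<close>

lemma sym_finite_support:
  assumes "h > 0" "\<rho> \<ge> 0" "\<delta> \<ge> 0" "smooth_sym h \<sigma>" "\<And>k \<theta>. k \<in> hlattice h \<Longrightarrow> R \<le> norm k \<Longrightarrow> \<sigma> k \<theta> = 0"
  shows "symclass h \<rho> \<delta> m \<sigma>"
  unfolding symclass_def
  by (auto intro!: assms(4) tor_bounds_imp_word_bounds[OF assms(2,3,4) _ order_refl] tor_bounds_finite_support[OF assms(1,4)] assms(5))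

text \<open>Lets a symbol be redefined near the origin at will, as long as it stays smooth in
  \<open>\<theta>\<close>.\<close>

lemma sym_eq_at_infinity:
  assumes "h > 0" "\<rho> \<ge> 0" "\<delta> \<ge> 0" "symclass h \<rho> \<delta> m \<sigma>" "smooth_sym h \<tau>"
    and "\<And>k \<theta>. k \<in> hlattice h \<Longrightarrow> R \<le> norm k \<Longrightarrow> \<tau> k \<theta> = \<sigma> k \<theta>"
  shows "symclass h \<rho> \<delta> m \<tau>"
proof -
  have "symclass h \<rho> \<delta> m (\<lambda>k \<theta>. \<tau> k \<theta> - \<sigma> k \<theta>)"
    using assms sym_smooth_sym[OF assms(4)] by (intro sym_finite_support[of h \<rho> \<delta> _ R] smooth_sym_diff) auto
  from sym_add[OF this assms(4)] show ?thesis by simp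
qed

section \<open>Composition of symbols\<close>

locale toroidal_calculus =
  fixes h \<rho> \<delta> :: real
  assumes h_pos: "0 < h" and h_le: "h \<le> 1" and d_nonneg: "0 \<le> \<delta>" and d_less: "\<delta> < \<rho>" and r_le: "\<rho> \<le> 1"
begin

lemma r_pos: "\<rho> > 0" using d_nonneg d_less by linarith

abbreviation S :: "real \<Rightarrow> 'n::finite sym \<Rightarrow> bool" where
  "S \<equiv> symclass h \<rho> \<delta>"

abbreviation lattice :: "(real ^ 'n::finite) set" where
  "lattice \<equiv> hlattice h"

lemma S_order_bound: "S m \<sigma> \<Longrightarrow> \<exists>C>0. \<forall>k\<in>lattice. \<forall>\<theta>. norm (\<sigma> k \<theta>) \<le> C * (1 + norm k) powr m"
  by (intro order_bound_pos sym_order_bound)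

lemma S_tor_diff_pow: "S m \<sigma> \<Longrightarrow> S (m + \<delta> * real P) ((tor_diff j ^^ P) \<sigma>)"
proof (induction P)
  case (Suc P)
  from sym_tor_diff[OF Suc.IH[OF Suc.prems], of j] show ?case by (simp add: algebra_simps)
qed auto

lemma tor_diff_pow_eq: "(tor_diff j ^^ P) \<sigma> k = (partial j ^^ P) (\<sigma> k)"
  by (induction P) (auto simp: tor_diff_def)

text \<open>Decay of order \<open>P\<close> takes \<open>P\<close> torus derivatives, each of which
  raises the order by \<open>\<delta>\<close>.\<close>

lemma S_fourier_coef_decay:
  fixes \<sigma> :: "'n::finite sym"
  assumes "S m \<sigma>"
  shows "\<exists>C>0. \<forall>k\<in>lattice. \<forall>p\<in>zlat. norm (fourier_coef (\<sigma> k) p) * (1 + norm p) ^ P \<le> C * (1 + norm k) powr (m + \<delta> * real P)"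
proof -
  obtain C0 where C0: "C0 > 0" "\<And>k \<theta>. k \<in> lattice \<Longrightarrow> norm (\<sigma> k \<theta>) \<le> C0 * (1 + norm k) powr m"
    using S_order_bound[OF assms] by auto
  have "\<exists>C>0. \<forall>k\<in>lattice. \<forall>\<theta>. norm ((partial j ^^ P) (\<sigma> k) \<theta>) \<le> C * (1 + norm k) powr (m + \<delta> * real P)" for j
    using S_order_bound[OF S_tor_diff_pow[OF assms, of P j]] by (simp add: tor_diff_pow_eq)
  then obtain C where C: "\<And>j. C j > 0"
      "\<And>j k \<theta>. k \<in> lattice \<Longrightarrow> norm ((partial j ^^ P) (\<sigma> k) \<theta>) \<le> C j * (1 + norm k) powr (m + \<delta> * real P)"
    by metis
  define D where "D = C0 + sum C UNIV"
  have D: "C0 \<le> D" "C j \<le> D" "D > 0" for j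
  proof -
    have nn: "sum C UNIV \<ge> 0" using C(1) by (simp add: sum_nonneg less_imp_le)
    then show "C0 \<le> D" "D > 0" using C0(1) by (auto simp: D_def)
    have "C j \<le> sum C UNIV" using C(1) by (simp add: member_le_sum less_imp_le)
    then show "C j \<le> D" using C0(1) by (simp add: D_def)
  qed
  have "norm (fourier_coef (\<sigma> k) p) * (1 + norm p) ^ P \<le> ((2 * real CARD('n)) ^ P * (2 * D)) * (1 + norm k) powr (m + \<delta> * real P)"
    if k: "k \<in> lattice" and p: "p \<in> zlat" for k p
  proof -
    have "norm (fourier_coef (\<sigma> k) p) * (1 + norm p) ^ P \<le> (2 * real CARD('n)) ^ P * (2 * (D * (1 + norm k) powr (m + \<delta> * real P)))"
    proof (rule fourier_coef_decay[OF ssmD[OF sym_smooth_sym[OF assms] k] p])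
      show "norm (\<sigma> k \<theta>) \<le> D * (1 + norm k) powr (m + \<delta> * real P)" for \<theta>
      proof -
        have "norm (\<sigma> k \<theta>) \<le> C0 * (1 + norm k) powr m" by (rule C0(2)[OF k])
        also have "\<dots> \<le> D * (1 + norm k) powr (m + \<delta> * real P)"
          using D C0(1) d_nonneg by (intro mult_mono powr_mono_weight) auto
        finally show ?thesis .
      qed
      show "norm ((partial j ^^ P) (\<sigma> k) \<theta>) \<le> D * (1 + norm k) powr (m + \<delta> * real P)" for j \<theta>
        using C(2)[OF k, of j \<theta>] D(2)[of j] by (rule order_trans[OF _ mult_right_mono]) auto
    qed
    then show ?thesis by (simp add: mult_ac)
  qed
  moreover have "(2 * real CARD('n)) ^ P * (2 * D) > 0" using D by simp
  ultimately show ?thesis by blast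
qed

text \<open>Of the available decay, \<open>2 * CARD('n)\<close> powers are spent on a summable
  weight. Their cost \<open>\<delta> * real (2 * CARD('n))\<close> is the fixed loss in the
  remainder estimate.\<close>

lemma S_fourier_coef_weight:
  fixes \<sigma> :: "'n::finite sym"
  assumes "S m \<sigma>"
  shows "\<exists>C>0. \<forall>k\<in>lattice. \<forall>p\<in>zlat. norm (fourier_coef (\<sigma> k) p) * (1 + norm p) ^ L
    \<le> C * (1 + norm k) powr (m + \<delta> * real (2 * CARD('n) + L)) * zlat_weight p"
proof -
  obtain C where C: "C > 0" "\<And>k p. k \<in> lattice \<Longrightarrow> p \<in> zlat \<Longrightarrow>
      norm (fourier_coef (\<sigma> k) p) * (1 + norm p) ^ (2 * CARD('n) + L) \<le> C * (1 + norm k) powr (m + \<delta> * real (2 * CARD('n) + L))"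
    using S_fourier_coef_decay[OF assms, of "2 * CARD('n) + L"] by auto
  have "norm (fourier_coef (\<sigma> k) p) * (1 + norm p) ^ L
    \<le> C * (1 + norm k) powr (m + \<delta> * real (2 * CARD('n) + L)) * zlat_weight p" if "k \<in> lattice" "p \<in> zlat" for k p
  proof -
    have "(1 + norm p) ^ (2 * CARD('n)) > 0" by (intro zero_less_power) (auto intro: add_pos_nonneg)
    then show ?thesis using C(2)[OF that] by (simp add: zlat_weight_def power_add divide_simps mult_ac)
  qed
  with C(1) show ?thesis by blast
qed

definition comp_sym :: "'n::finite sym \<Rightarrow> 'n sym \<Rightarrow> 'n sym" where
  "comp_sym a b k \<theta> = (\<Sum>\<^sub>\<infinity>p\<in>zlat. fourier_coef (a k) p * echar p \<theta> * b (k + h *\<^sub>R p) \<theta>)"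

text \<open>Peetre's inequality, where \<open>h \<le> 1\<close> lets the displacement
  \<open>h *\<^sub>R p\<close> be measured by \<open>p\<close> itself, and the real exponent is
  rounded up to a natural number.\<close>

lemma weight_hlattice_add:
  fixes k p :: "real ^ 'n::finite"
  assumes "real L \<ge> \<bar>m\<bar>"
  shows "(1 + norm (k + h *\<^sub>R p)) powr m \<le> (1 + norm p) ^ L * (1 + norm k) powr m"
proof -
  have "(1 + norm (h *\<^sub>R p)) powr \<bar>m\<bar> \<le> (1 + norm p) powr \<bar>m\<bar>"
    using h_pos h_le by (intro powr_mono2) (auto simp: mult_left_le_one_le intro: add_nonneg_nonneg)
  also have "\<dots> \<le> (1 + norm p) powr real L"
    by (rule powr_mono_weight[OF assms])
  also have "\<dots> = (1 + norm p) ^ L"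
    by (rule powr_realpow) (auto intro: add_pos_nonneg)
  finally have "(1 + norm (h *\<^sub>R p)) powr \<bar>m\<bar> * (1 + norm k) powr m \<le> (1 + norm p) ^ L * (1 + norm k) powr m"
    by (rule mult_right_mono) simp
  with powr_weight_add[of k "h *\<^sub>R p" m] show ?thesis by (rule order_trans)
qed

text \<open>The values \<open>b (k + h *\<^sub>R p)\<close> grow at most polynomially in
  \<open>p\<close>, and the Fourier coefficients of \<open>a k\<close> absorb this growth.\<close>

lemma comp_term_bound:
  fixes a b :: "'n::finite sym"
  assumes "S m1 a" "S m2 b" and k: "k \<in> lattice"
  shows "\<exists>C. \<forall>p\<in>zlat. \<forall>\<theta>. norm (fourier_coef (a k) p * echar p \<theta> * b (k + h *\<^sub>R p) \<theta>) \<le> C * zlat_weight p"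
proof -
  obtain L :: nat where L: "real L \<ge> \<bar>m2\<bar>" using real_arch_simple[of "\<bar>m2\<bar>"] by blast
  obtain C where C: "C > 0" "\<And>k p. k \<in> lattice \<Longrightarrow> p \<in> zlat \<Longrightarrow> norm (fourier_coef (a k) p) * (1 + norm p) ^ L
    \<le> C * (1 + norm k) powr (m1 + \<delta> * real (2 * CARD('n) + L)) * zlat_weight p"
    using S_fourier_coef_weight[OF assms(1), of L] by blast
  obtain D where D: "D > 0" "\<And>k \<theta>. k \<in> lattice \<Longrightarrow> norm (b k \<theta>) \<le> D * (1 + norm k) powr m2"
    using S_order_bound[OF assms(2)] by blast
  have "norm (fourier_coef (a k) p * echar p \<theta> * b (k + h *\<^sub>R p) \<theta>) \<le>
     (C * (1 + norm k) powr (m1 + \<delta> * real (2 * CARD('n) + L)) * D * (1 + norm k) powr m2) * zlat_weight p" if p: "p \<in> zlat" for p \<theta>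
  proof -
    have "norm (b (k + h *\<^sub>R p) \<theta>) \<le> D * (1 + norm (k + h *\<^sub>R p)) powr m2"
      by (rule D(2)[OF hlattice_add[OF k p]])
    also have "\<dots> \<le> D * ((1 + norm p) ^ L * (1 + norm k) powr m2)"
      by (rule mult_left_mono[OF weight_hlattice_add[OF L]]) (use D(1) in simp)
    finally have "norm (fourier_coef (a k) p) * norm (b (k + h *\<^sub>R p) \<theta>) \<le>
       norm (fourier_coef (a k) p) * (D * ((1 + norm p) ^ L * (1 + norm k) powr m2))"
      by (rule mult_left_mono) simp
    also have "\<dots> = (norm (fourier_coef (a k) p) * (1 + norm p) ^ L) * (D * (1 + norm k) powr m2)"
      by (simp only: mult_ac)
    also have "\<dots> \<le> (C * (1 + norm k) powr (m1 + \<delta> * real (2 * CARD('n) + L)) * zlat_weight p) * (D * (1 + norm k) powr m2)"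
      by (rule mult_right_mono[OF C(2)[OF k p]]) (use D(1) in simp)
    finally show ?thesis by (simp only: norm_mult norm_echar mult_1_right mult_ac)
  qed
  then show ?thesis by (intro exI ballI allI)
qed

lemma comp_summable:
  assumes "S m1 a" "S m2 b" "k \<in> lattice"
  shows "(\<lambda>p. fourier_coef (a k) p * echar p \<theta> * b (k + h *\<^sub>R p) \<theta>) summable_on zlat"
proof -
  obtain C where C: "\<And>p. p \<in> zlat \<Longrightarrow> norm (fourier_coef (a k) p * echar p \<theta> * b (k + h *\<^sub>R p) \<theta>) \<le> C * zlat_weight p"
    using comp_term_bound[OF assms] by blast
  show ?thesis
    by (rule abs_summable_summable[OF summable_on_comparison_test[OF summable_on_cmult_right[OF zlat_weight_summable]]])
      (use C in auto)
qed

text \<open>A derivative falling on the character multiplies the coefficient by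
  \<open>2 * pi * \<i> * p_j\<close>, which makes it a coefficient of \<open>tor_diff j a\<close>.
  Hence composition obeys the product rule, and estimates of its derivatives reduce to estimates
  without derivatives.\<close>

lemma comp_derivative:
  fixes a b :: "'n::finite sym"
  assumes a: "S m1 a" and b: "S m2 b" and k: "k \<in> lattice"
  shows "comp_sym a b k differentiable (at \<theta>)"
    and "partial j (comp_sym a b k) \<theta> = comp_sym (tor_diff j a) b k \<theta> + comp_sym a (tor_diff j b) k \<theta>"
proof -
  let ?w = "\<lambda>a b p \<theta>. fourier_coef (a k) p * echar p \<theta> * b (k + h *\<^sub>R p) \<theta>"
  have ak: "torus_smooth (a k)" by (rule ssmD[OF sym_smooth_sym[OF a] k])
  have bk: "torus_smooth (b (k + h *\<^sub>R p))" if "p \<in> zlat" for p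
    by (rule ssmD[OF sym_smooth_sym[OF b] hlattice_add[OF k that]])
  have w: "?w a b p differentiable (at \<theta>)"
      "partial i (?w a b p) \<theta> = ?w (tor_diff i a) b p \<theta> + ?w a (tor_diff i b) p \<theta>" if p: "p \<in> zlat" for p \<theta> i
  proof -
    have sm: "torus_smooth (\<lambda>\<theta>. fourier_coef (a k) p * echar p \<theta>)"
      by (intro torus_smooth_cmult torus_smooth_echar p)
    show "?w a b p differentiable (at \<theta>)"
      by (intro torus_smooth_differentiable torus_smooth_mult sm bk p)
    have "partial i (?w a b p) \<theta> = fourier_coef (a k) p * (2 * of_real pi * \<i> * of_real (p $ i) * echar p \<theta>) * b (k + h *\<^sub>R p) \<theta>
        + fourier_coef (a k) p * echar p \<theta> * partial i (b (k + h *\<^sub>R p)) \<theta>"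
      by (simp add: partial_mult torus_smooth_differentiable sm bk p partial_cmult echar_differentiable partial_echar)
    then show "partial i (?w a b p) \<theta> = ?w (tor_diff i a) b p \<theta> + ?w a (tor_diff i b) p \<theta>"
      by (simp add: tor_diff_def fourier_coef_partial[OF ak p])
  qed
  obtain C0 where C0: "\<And>p \<theta>. p \<in> zlat \<Longrightarrow> norm (?w a b p \<theta>) \<le> C0 * zlat_weight p"
    using comp_term_bound[OF a b k] by auto
  have "\<exists>C. \<forall>p\<in>zlat. \<forall>\<theta>. norm (?w (tor_diff i a) b p \<theta>) \<le> C * zlat_weight p" for i
    by (rule comp_term_bound[OF sym_tor_diff[OF a] b k])
  then obtain C1 where C1: "\<And>i p \<theta>. p \<in> zlat \<Longrightarrow> norm (?w (tor_diff i a) b p \<theta>) \<le> C1 i * zlat_weight p" by metis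
  have "\<exists>C. \<forall>p\<in>zlat. \<forall>\<theta>. norm (?w a (tor_diff i b) p \<theta>) \<le> C * zlat_weight p" for i
    by (rule comp_term_bound[OF a sym_tor_diff[OF b] k])
  then obtain C2 where C2: "\<And>i p \<theta>. p \<in> zlat \<Longrightarrow> norm (?w a (tor_diff i b) p \<theta>) \<le> C2 i * zlat_weight p" by metis
  define C where "C = \<bar>C0\<bar> + (\<Sum>i\<in>UNIV. \<bar>C1 i\<bar> + \<bar>C2 i\<bar>)"
  have C: "C0 \<le> C" "C1 i + C2 i \<le> C" for i
  proof -
    have "(\<Sum>i\<in>UNIV. \<bar>C1 i\<bar> + \<bar>C2 i\<bar>) \<ge> 0" by (intro sum_nonneg) auto
    then show "C0 \<le> C" by (simp add: C_def)
    have "\<bar>C1 i\<bar> + \<bar>C2 i\<bar> \<le> (\<Sum>i\<in>UNIV. \<bar>C1 i\<bar> + \<bar>C2 i\<bar>)"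
      by (rule member_le_sum[of i UNIV "\<lambda>i. \<bar>C1 i\<bar> + \<bar>C2 i\<bar>"]) auto
    then show "C1 i + C2 i \<le> C" by (simp add: C_def)
  qed
  have M0: "norm (?w a b p \<theta>) \<le> C * zlat_weight p" if "p \<in> zlat" for p \<theta>
    using C0[OF that, of \<theta>] mult_right_mono[OF C(1), of "zlat_weight p"] zlat_weight_pos[of p] by linarith
  have M1: "norm (partial i (?w a b p) \<theta>) \<le> C * zlat_weight p" if "p \<in> zlat" for p \<theta> i
  proof -
    have "norm (?w (tor_diff i a) b p \<theta> + ?w a (tor_diff i b) p \<theta>) \<le> C1 i * zlat_weight p + C2 i * zlat_weight p"
      by (intro norm_triangle_le add_mono C1 C2 that)
    also have "\<dots> \<le> C * zlat_weight p"
      using mult_right_mono[OF C(2)[of i], of "zlat_weight p"] zlat_weight_pos[of p] by (simp add: ring_distribs)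
    finally show ?thesis using w(2)[OF that] by simp
  qed
  have sM: "(\<lambda>p::real ^ 'n. C * zlat_weight p) summable_on zlat"
    by (rule summable_on_cmult_right[OF zlat_weight_summable])
  note P = partial_infsum[where w = "?w a b" and M = "\<lambda>p. C * zlat_weight p", OF w(1) M0 M1 sM]
  have comp_eq: "comp_sym a b k = (\<lambda>\<theta>. \<Sum>\<^sub>\<infinity>p\<in>zlat. ?w a b p \<theta>)"
    by (simp add: comp_sym_def fun_eq_iff)
  show "comp_sym a b k differentiable (at \<theta>)"
    unfolding comp_eq by (rule P(1))
  have "partial j (comp_sym a b k) \<theta> = (\<Sum>\<^sub>\<infinity>p\<in>zlat. partial j (?w a b p) \<theta>)"
    unfolding comp_eq by (rule P(2))
  also have "\<dots> = (\<Sum>\<^sub>\<infinity>p\<in>zlat. ?w (tor_diff j a) b p \<theta> + ?w a (tor_diff j b) p \<theta>)"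
    by (rule infsum_cong) (rule w(2))
  also have "\<dots> = comp_sym (tor_diff j a) b k \<theta> + comp_sym a (tor_diff j b) k \<theta>"
    unfolding comp_sym_def by (rule infsum_add) (intro comp_summable[OF sym_tor_diff[OF a] b k] comp_summable[OF a sym_tor_diff[OF b] k])+
  finally show "partial j (comp_sym a b k) \<theta> = comp_sym (tor_diff j a) b k \<theta> + comp_sym a (tor_diff j b) k \<theta>" .
qed

lemma smooth_sym_comp:
  fixes a b :: "'n::finite sym"
  assumes "S m1 a" "S m2 b"
  shows "smooth_sym h (comp_sym a b)"
  unfolding smooth_sym_def
proof
  fix k :: "real ^ 'n" assume k: "k \<in> lattice"
  \<comment> \<open>The orders are generalised as well, because each derivative changes the order of
    one of the two symbols.\<close>
  have "S m1 a \<Longrightarrow> S m2 b \<Longrightarrow> Ck n (comp_sym a b k)" for n m1 m2 a b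
  proof (induction n arbitrary: a b m1 m2)
    case 0
    show ?case
      unfolding Ck.simps continuous_on_eq_continuous_at[OF open_UNIV]
      by (intro ballI differentiable_imp_continuous_within comp_derivative(1)[OF 0 k])
  next
    case (Suc n)
    have "partial j (comp_sym a b k) = (\<lambda>\<theta>. comp_sym (tor_diff j a) b k \<theta> + comp_sym a (tor_diff j b) k \<theta>)" for j
      using comp_derivative(2)[OF Suc.prems k] by (intro ext)
    moreover have "Ck n (\<lambda>\<theta>. comp_sym (tor_diff j a) b k \<theta> + comp_sym a (tor_diff j b) k \<theta>)" for j
      by (intro Ck_add Suc.IH[OF sym_tor_diff[OF Suc.prems(1)] Suc.prems(2)] Suc.IH[OF Suc.prems(1) sym_tor_diff[OF Suc.prems(2)]])
    ultimately show ?case using comp_derivative(1)[OF Suc.prems k] by simp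
  qed
  moreover have "periodic (comp_sym a b k)"
    unfolding periodic_def comp_sym_def
  proof (intro allI impI infsum_cong)
    fix \<theta> m p :: "real ^ 'n" assume m: "\<forall>j. m $ j \<in> \<int>" and p: "p \<in> zlat"
    have "b (k + h *\<^sub>R p) (\<theta> + m) = b (k + h *\<^sub>R p) \<theta>"
      using ssmD[OF sym_smooth_sym[OF assms(2)] hlattice_add[OF k p]] m by (auto simp: torus_smooth_def periodic_def)
    then show "fourier_coef (a k) p * echar p (\<theta> + m) * b (k + h *\<^sub>R p) (\<theta> + m) = fourier_coef (a k) p * echar p \<theta> * b (k + h *\<^sub>R p) \<theta>"
      using m periodicD[OF periodic_echar[OF p]] by simp
  qed
  ultimately show "torus_smooth (comp_sym a b k)"
    unfolding torus_smooth_def using assms by blast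
qed

end

section \<open>Newton interpolation on the lattice\<close>

lemma finite_mlen_less: "finite {\<gamma> :: 'n::finite \<Rightarrow> nat. mlen \<gamma> < N}"
proof (rule finite_subset)
  show "{\<gamma> :: 'n \<Rightarrow> nat. mlen \<gamma> < N} \<subseteq> PiE UNIV (\<lambda>_. {..<N})"
    using member_le_sum[of _ UNIV "_ :: 'n \<Rightarrow> nat"] by (auto simp: mlen_def intro: le_less_trans)
qed (auto intro: finite_PiE)

lemma lat_diffs_upd: "lat_diffs h (\<alpha>(j := Suc (\<alpha> j))) \<sigma> = lat_diffs h \<alpha> (lat_diff h j \<sigma>)"
  by (intro ext) (simp add: lat_diffs_eq diff_op_upd lat_diff_def)

lemma lat_diffs_0: "lat_diffs h (\<lambda>_. 0) \<sigma> = \<sigma>"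
  by (simp add: lat_diffs_def foldr_id)

text \<open>The product over \<open>j\<close> of the binomial coefficients of \<open>p $ j\<close>
  over \<open>\<gamma> j\<close>, as polynomials and hence also for negative arguments.\<close>

definition mbinomial :: "('n::finite \<Rightarrow> nat) \<Rightarrow> real ^ 'n \<Rightarrow> complex" where
  "mbinomial \<gamma> p = falling \<gamma> p / of_nat (mfact \<gamma>)"

lemma mfact_upd: "mfact (\<gamma>(j := Suc (\<gamma> j))) = Suc (\<gamma> j) * mfact \<gamma>"
proof -
  have "mfact (\<gamma>(j := Suc (\<gamma> j))) = fact (Suc (\<gamma> j)) * (\<Prod>i\<in>UNIV - {j}. fact (\<gamma> i))"
    unfolding mfact_def by (subst prod.remove[of _ j]) auto
  also have "\<dots> = Suc (\<gamma> j) * mfact \<gamma>"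
    unfolding mfact_def by (subst (2) prod.remove[of _ j]) (auto simp: algebra_simps)
  finally show ?thesis .
qed

lemma mbinomial_axis_0:
  assumes "\<gamma> j = 0"
  shows "mbinomial \<gamma> (p + axis j 1) = mbinomial \<gamma> p"
proof -
  have "(\<Prod>l<\<gamma> i. complex_of_real ((p + axis j 1) $ i) - of_nat l) = (\<Prod>l<\<gamma> i. of_real (p $ i) - of_nat l)" for i
    using assms by (cases "i = j") (auto simp: axis_def)
  then show ?thesis by (simp add: mbinomial_def falling_def)
qed

text \<open>Pascal's rule in direction \<open>j\<close>.\<close>

lemma mbinomial_axis_Suc:
  "mbinomial (\<gamma>(j := Suc (\<gamma> j))) (p + axis j 1) = mbinomial (\<gamma>(j := Suc (\<gamma> j))) p + mbinomial \<gamma> p"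
proof -
  define R where "R = (\<Prod>i\<in>UNIV - {j}. \<Prod>l<\<gamma> i. complex_of_real (p $ i) - of_nat l)"
  define x where "x = complex_of_real (p $ j)"
  define F where "F = (\<Prod>l<\<gamma> j. x - of_nat l)"
  have R': "(\<Prod>i\<in>UNIV - {j}. \<Prod>l<\<gamma> i. complex_of_real ((p + axis j 1) $ i) - of_nat l) = R"
    unfolding R_def by (intro prod.cong refl) (auto simp: axis_def)
  have "falling (\<gamma>(j := Suc (\<gamma> j))) (p + axis j 1) = (\<Prod>l<Suc (\<gamma> j). (x + 1) - of_nat l) *
      (\<Prod>i\<in>UNIV - {j}. \<Prod>l<\<gamma> i. complex_of_real ((p + axis j 1) $ i) - of_nat l)"
    unfolding falling_def by (subst prod.remove[of _ j]) (auto simp: axis_def x_def)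
  also have "(\<Prod>l<Suc (\<gamma> j). (x + 1) - of_nat l) = (x + 1) * F"
    unfolding F_def by (subst prod.lessThan_Suc_shift) simp
  finally have 1: "falling (\<gamma>(j := Suc (\<gamma> j))) (p + axis j 1) = (x + 1) * F * R" by (simp only: R')
  have 2: "falling \<gamma> p = F * R"
    unfolding falling_def R_def F_def x_def by (subst prod.remove[of _ j]) auto
  have 3: "falling (\<gamma>(j := Suc (\<gamma> j))) p = (x - of_nat (\<gamma> j)) * (F * R)"
    by (simp add: falling_upd 2 x_def)
  have "F * R / of_nat (mfact \<gamma>) = of_nat (Suc (\<gamma> j)) * (F * R) / (of_nat (Suc (\<gamma> j)) * of_nat (mfact \<gamma>))"
    by (simp del: of_nat_Suc)
  then show ?thesis
    unfolding mbinomial_def 1 2 3 mfact_upd of_nat_mult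
    by (simp only: add_divide_distrib[symmetric]) (simp add: algebra_simps)
qed

text \<open>Newton's forward interpolation polynomial in \<open>p\<close>, of total degree less than
  \<open>N\<close>, for the function \<open>b (k + h *\<^sub>R p)\<close>. The powers of
  \<open>h\<close> undo the division by \<open>h\<close> in the differences.\<close>

definition newton :: "real \<Rightarrow> nat \<Rightarrow> 'n::finite sym \<Rightarrow> real ^ 'n \<Rightarrow> real ^ 'n \<Rightarrow> real ^ 'n \<Rightarrow> complex" where
  "newton h N b k p \<theta> = (\<Sum>\<gamma> | mlen \<gamma> < N. mbinomial \<gamma> p * of_real (h ^ mlen \<gamma>) * lat_diffs h \<gamma> b k \<theta>)"

definition newton_rem :: "real \<Rightarrow> nat \<Rightarrow> 'n::finite sym \<Rightarrow> real ^ 'n \<Rightarrow> real ^ 'n \<Rightarrow> real ^ 'n \<Rightarrow> complex" where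
  "newton_rem h N b k p \<theta> = b (k + h *\<^sub>R p) \<theta> - newton h N b k p \<theta>"

text \<open>By Pascal's rule a forward step in direction \<open>j\<close> lowers
  \<open>\<gamma> j\<close> by one and passes a difference on to \<open>b\<close>; the terms with
  \<open>\<gamma> j = 0\<close> drop out.\<close>

lemma newton_axis:
  "newton h (Suc N) b k (p + axis j 1) \<theta> - newton h (Suc N) b k p \<theta> = of_real h * newton h N (lat_diff h j b) k p \<theta>"
proof -
  have "newton h (Suc N) b k (p + axis j 1) \<theta> - newton h (Suc N) b k p \<theta> =
      (\<Sum>\<gamma> | mlen \<gamma> < Suc N. (mbinomial \<gamma> (p + axis j 1) - mbinomial \<gamma> p) * of_real (h ^ mlen \<gamma>) * lat_diffs h \<gamma> b k \<theta>)"
    unfolding newton_def by (simp add: sum_subtractf[symmetric] ring_distribs)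
  also have "\<dots> = (\<Sum>\<gamma> | mlen \<gamma> < Suc N \<and> \<gamma> j \<noteq> 0. (mbinomial \<gamma> (p + axis j 1) - mbinomial \<gamma> p) * of_real (h ^ mlen \<gamma>) * lat_diffs h \<gamma> b k \<theta>)"
    by (intro sum.mono_neutral_right finite_mlen_less) (auto simp: mbinomial_axis_0)
  also have "\<dots> = (\<Sum>\<gamma> | mlen \<gamma> < N. of_real h * (mbinomial \<gamma> p * of_real (h ^ mlen \<gamma>) * lat_diffs h \<gamma> (lat_diff h j b) k \<theta>))"
  proof (rule sum.reindex_bij_witness[where i = "\<lambda>\<gamma>. \<gamma>(j := Suc (\<gamma> j))" and j = "\<lambda>\<gamma>. \<gamma>(j := \<gamma> j - 1)"])
    fix \<gamma> :: "'a \<Rightarrow> nat" assume \<gamma>: "\<gamma> \<in> {\<gamma>. mlen \<gamma> < Suc N \<and> \<gamma> j \<noteq> 0}"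
    define \<gamma>' where "\<gamma>' = \<gamma>(j := \<gamma> j - 1)"
    have \<gamma>': "\<gamma> = \<gamma>'(j := Suc (\<gamma>' j))" using \<gamma> by (auto simp: \<gamma>'_def)
    show "(\<gamma>(j := \<gamma> j - 1))(j := Suc ((\<gamma>(j := \<gamma> j - 1)) j)) = \<gamma>" using \<gamma>' by (simp add: \<gamma>'_def)
    have "mlen \<gamma> = Suc (mlen \<gamma>')" by (subst \<gamma>') (rule mlen_upd)
    with \<gamma> show "\<gamma>(j := \<gamma> j - 1) \<in> {\<gamma>. mlen \<gamma> < N}" by (simp add: \<gamma>'_def)
    have "(mbinomial \<gamma> (p + axis j 1) - mbinomial \<gamma> p) * of_real (h ^ mlen \<gamma>) * lat_diffs h \<gamma> b k \<theta>
        = of_real h * (mbinomial \<gamma>' p * of_real (h ^ mlen \<gamma>') * lat_diffs h \<gamma>' (lat_diff h j b) k \<theta>)"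
      unfolding \<gamma>' mbinomial_axis_Suc mlen_upd lat_diffs_upd by (simp add: \<gamma>'_def)
    then show "of_real h * (mbinomial (\<gamma>(j := \<gamma> j - 1)) p * of_real (h ^ mlen (\<gamma>(j := \<gamma> j - 1))) * lat_diffs h (\<gamma>(j := \<gamma> j - 1)) (lat_diff h j b) k \<theta>)
        = (mbinomial \<gamma> (p + axis j 1) - mbinomial \<gamma> p) * of_real (h ^ mlen \<gamma>) * lat_diffs h \<gamma> b k \<theta>"
      by (simp add: \<gamma>'_def)
  next
    fix \<gamma> :: "'a \<Rightarrow> nat" assume "\<gamma> \<in> {\<gamma>. mlen \<gamma> < N}"
    then show "\<gamma>(j := Suc (\<gamma> j)) \<in> {\<gamma>. mlen \<gamma> < Suc N \<and> \<gamma> j \<noteq> 0}" by (simp add: mlen_upd)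
    show "(\<gamma>(j := Suc (\<gamma> j)))(j := (\<gamma>(j := Suc (\<gamma> j))) j - 1) = \<gamma>" by simp
  qed
  also have "\<dots> = of_real h * newton h N (lat_diff h j b) k p \<theta>"
    unfolding newton_def by (simp add: sum_distrib_left)
  finally show ?thesis .
qed

lemma newton_rem_axis:
  assumes "h \<noteq> 0"
  shows "newton_rem h (Suc N) b k (p + axis j 1) \<theta> - newton_rem h (Suc N) b k p \<theta> = of_real h * newton_rem h N (lat_diff h j b) k p \<theta>"
proof -
  have "b (k + h *\<^sub>R (p + axis j 1)) \<theta> - b (k + h *\<^sub>R p) \<theta> = of_real h * lat_diff h j b (k + h *\<^sub>R p) \<theta>"
    using assms by (simp add: lat_diff_def diff1_def scaleR_add_right add.assoc)
  moreover note newton_axis[of h N b k p j \<theta>]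
  ultimately show ?thesis unfolding newton_rem_def by (simp add: algebra_simps)
qed

lemma newton_rem_0: "newton_rem h (Suc N) b k 0 \<theta> = 0"
proof -
  have "mbinomial \<gamma> 0 = 0" if nz: "\<gamma> \<noteq> (\<lambda>_. 0)" for \<gamma> :: "'a \<Rightarrow> nat"
  proof -
    obtain j where "\<gamma> j \<noteq> 0" using nz by (auto simp: fun_eq_iff)
    then have "(\<Prod>l<\<gamma> j. complex_of_real ((0 :: real ^ 'a) $ j) - of_nat l) = 0"
      by (intro prod_zero) auto
    then show ?thesis unfolding mbinomial_def falling_def
      by (simp only: divide_eq_0_iff) (auto intro!: prod_zero simp del: zero_index)
  qed
  then have "newton h (Suc N) b k 0 \<theta> = (\<Sum>\<gamma> \<in> {\<lambda>_. 0}. mbinomial \<gamma> 0 * of_real (h ^ mlen \<gamma>) * lat_diffs h \<gamma> b k \<theta>)"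
    unfolding newton_def
    by (intro sum.mono_neutral_right finite_mlen_less) (auto simp: mlen_def)
  then show ?thesis
    by (simp add: newton_rem_def mbinomial_def falling_def mfact_def mlen_def lat_diffs_0)
qed

text \<open>Walk from \<open>p\<close> to 0 by unit steps, each shrinking a nonzero coordinate: all
  points met have norm at most \<open>norm p\<close>, and the number of steps is the sum of the
  absolute coordinates. The induction measure takes integer parts because coordinates are real
  numbers.\<close>

lemma lattice_path_bound:
  fixes R :: "real ^ 'n::finite \<Rightarrow> complex"
  assumes R0: "R 0 = 0" and B: "B \<ge> 0"
    and step: "\<And>q j. q \<in> zlat \<Longrightarrow> norm q \<le> r \<Longrightarrow> norm (R (q + axis j 1) - R q) \<le> B"
  shows "p \<in> zlat \<Longrightarrow> norm p \<le> r \<Longrightarrow> norm (R p) \<le> (\<Sum>j\<in>UNIV. \<bar>p $ j\<bar>) * B"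
proof (induction "\<Sum>j\<in>UNIV. nat \<lfloor>\<bar>p $ j\<bar>\<rfloor>" arbitrary: p rule: less_induct)
  case (less p)
  show ?case
  proof (cases "p = 0")
    case True
    then show ?thesis using R0 by simp
  next
    case False
    then obtain j where j: "p $ j \<noteq> 0" by (auto simp: vec_eq_iff)
    define s :: real where "s = sgn (p $ j)"
    have s: "s = 1 \<and> p $ j > 0 \<or> s = -1 \<and> p $ j < 0" using j by (auto simp: s_def sgn_if)
    define q where "q = p - s *\<^sub>R axis j 1"
    have pz: "p $ i \<in> \<int>" for i using less.prems by (auto simp: zlat_def)
    have q_nth: "q $ i = (if i = j then p $ j - s else p $ i)" for i
      by (auto simp: q_def axis_def)
    have ge1: "\<bar>p $ j\<bar> \<ge> 1" using pz[of j] j by (auto elim!: Ints_cases)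
    have qj: "\<bar>q $ j\<bar> = \<bar>p $ j\<bar> - 1" using s ge1 by (auto simp: q_nth)
    have q_le: "\<bar>q $ i\<bar> \<le> \<bar>p $ i\<bar>" for i using qj by (cases "i = j") (auto simp: q_nth)
    have qz: "q \<in> zlat" using pz s by (auto simp: zlat_def q_nth)
    have nq: "norm q \<le> norm p" using q_le by (intro norm_le_componentwise_cart) auto
    have "(\<Sum>i\<in>UNIV. nat \<lfloor>\<bar>q $ i\<bar>\<rfloor>) < (\<Sum>i\<in>UNIV. nat \<lfloor>\<bar>p $ i\<bar>\<rfloor>)"
    proof (rule sum_strict_mono_ex1)
      show "\<forall>i\<in>UNIV. nat \<lfloor>\<bar>q $ i\<bar>\<rfloor> \<le> nat \<lfloor>\<bar>p $ i\<bar>\<rfloor>"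
        by (intro ballI nat_mono floor_mono q_le)
      have "nat \<lfloor>\<bar>q $ j\<bar>\<rfloor> < nat \<lfloor>\<bar>p $ j\<bar>\<rfloor>" using qj ge1 by linarith
      then show "\<exists>i\<in>UNIV. nat \<lfloor>\<bar>q $ i\<bar>\<rfloor> < nat \<lfloor>\<bar>p $ i\<bar>\<rfloor>" by blast
    qed simp
    from less.hyps[OF this qz] nq less.prems have IH: "norm (R q) \<le> (\<Sum>i\<in>UNIV. \<bar>q $ i\<bar>) * B" by linarith
    have "(\<Sum>i\<in>UNIV. \<bar>p $ i\<bar>) = (\<Sum>i\<in>UNIV. \<bar>q $ i\<bar>) + 1"
      using qj by (subst (1 2) sum.remove[of _ j]) (auto simp: q_nth)
    moreover have "norm (R p - R q) \<le> B"
      using s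
    proof
      assume "s = 1 \<and> p $ j > 0"
      then have "p = q + axis j 1" by (simp add: q_def)
      then show ?thesis using step[OF qz, of j] nq less.prems by simp
    next
      \<comment> \<open>For a negative coordinate the forward step leads from \<open>p\<close> to
        \<open>q\<close>, so the increment is taken at \<open>p\<close>.\<close>
      assume "s = -1 \<and> p $ j < 0"
      then have "q = p + axis j 1" by (simp add: q_def)
      then show ?thesis using step[of p j] less.prems by (simp add: norm_minus_commute)
    qed
    moreover have "norm (R p) \<le> norm (R q) + norm (R p - R q)"
      using norm_triangle_ineq[of "R q" "R p - R q"] by simp
    ultimately show ?thesis using IH by (simp add: ring_distribs)
  qed
qed

text \<open>The increments of the remainder are remainders of one order less, so it can be estimated along
  a path from \<open>0\<close> to \<open>p\<close> in the box spanned by \<open>p\<close>.\<close>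

lemma newton_rem_bound:
  fixes b :: "'n::finite sym"
  assumes h: "0 < h" "h \<le> 1" and \<Phi>: "\<And>r s. r \<le> s \<Longrightarrow> \<Phi> r \<le> \<Phi> s" "\<Phi> 0 \<ge> 0"
  shows "(\<And>js q. length js = N \<Longrightarrow> q \<in> zlat \<Longrightarrow> norm (foldr (lat_diff h) js b (k + h *\<^sub>R q) \<theta>) \<le> \<Phi> (norm q)) \<Longrightarrow>
    p \<in> zlat \<Longrightarrow> norm (newton_rem h N b k p \<theta>) \<le> (real CARD('n) * norm p) ^ N * \<Phi> (norm p)"
proof (induction N arbitrary: b p)
  case 0
  from 0(1)[of "[]" p] 0(2) show ?case by (simp add: newton_rem_def newton_def)
next
  case (Suc N)
  \<comment> \<open>Monotonicity of \<open>\<Phi>\<close> bounds the lower-order remainders at all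
    points of norm at most \<open>norm p\<close> by this value.\<close>
  define B where "B = (real CARD('n) * norm p) ^ N * \<Phi> (norm p)"
  have \<Phi>_nn: "\<Phi> r \<ge> 0" if "r \<ge> 0" for r using \<Phi>(1)[OF that] \<Phi>(2) by simp
  have B: "B \<ge> 0" by (simp add: B_def \<Phi>_nn)
  have "norm (newton_rem h (Suc N) b k p \<theta>) \<le> (\<Sum>j\<in>UNIV. \<bar>p $ j\<bar>) * B"
  proof (rule lattice_path_bound[where r = "norm p"])
    fix q :: "real ^ 'n" and j assume q: "q \<in> zlat" "norm q \<le> norm p"
    have "norm (newton_rem h N (lat_diff h j b) k q \<theta>) \<le> (real CARD('n) * norm q) ^ N * \<Phi> (norm q)"
    proof (rule Suc.IH[OF _ q(1)])
      fix js :: "'n list" and q :: "real ^ 'n" assume "length js = N" "q \<in> zlat"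
      then show "norm (foldr (lat_diff h) js (lat_diff h j b) (k + h *\<^sub>R q) \<theta>) \<le> \<Phi> (norm q)"
        using Suc.prems(1)[of "js @ [j]" q] by simp
    qed
    also have "\<dots> \<le> B"
      unfolding B_def using q(2) by (intro mult_mono power_mono mult_left_mono \<Phi>) (auto intro: \<Phi>_nn)
    finally have "h * norm (newton_rem h N (lat_diff h j b) k q \<theta>) \<le> 1 * B"
      using h B by (intro mult_mono) auto
    then show "norm (newton_rem h (Suc N) b k (q + axis j 1) \<theta> - newton_rem h (Suc N) b k q \<theta>) \<le> B"
      using h by (simp add: newton_rem_axis norm_mult)
  qed (auto simp: newton_rem_0 B Suc.prems)
  also have "\<dots> \<le> (real CARD('n) * norm p) * B"
    using sum_bounded_above[of UNIV "\<lambda>j. \<bar>p $ j\<bar>" "norm p"] component_le_norm_cart[of p]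
    by (intro mult_right_mono B) auto
  finally show ?case by (simp add: B_def mult.assoc)
qed

text \<open>If \<open>q\<close> is at most half as large as \<open>k\<close>, then
  \<open>k + h *\<^sub>R q\<close> is comparable with \<open>k\<close>. Otherwise the left-hand side
  is merely at most 1, but \<open>1 + norm k\<close> is at most \<open>2 * (1 + norm q)\<close>, so
  powers of \<open>q\<close> buy any decay in \<open>k\<close>.\<close>

lemma weight_region_bound:
  fixes k q :: "real ^ 'n::finite"
  assumes h: "0 < h" "h \<le> 1" and s: "s \<le> 0"
  shows "(1 + norm (k + h *\<^sub>R q)) powr s \<le> 2 powr (- s) * (1 + norm k) powr s + 2 ^ L * (1 + norm q) ^ L * (1 + norm k) powr (- real L)"
proof (cases "norm q \<le> norm k / 2")
  case True
  have "norm (h *\<^sub>R q) \<le> norm q" using h by (simp add: mult_left_le_one_le)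
  then have "(1 + norm k) / 2 \<le> 1 + norm (k + h *\<^sub>R q)"
    using True norm_triangle_ineq4[of "k + h *\<^sub>R q" "h *\<^sub>R q"] by (simp add: field_simps)
  then have "(1 + norm (k + h *\<^sub>R q)) powr s \<le> ((1 + norm k) / 2) powr s"
    using s by (intro powr_mono2') (auto intro: add_pos_nonneg)
  also have "\<dots> = 2 powr (- s) * (1 + norm k) powr s"
    by (simp add: powr_divide powr_minus divide_simps)
  finally show ?thesis by (simp add: add_increasing2)
next
  case False
  have "(1 + norm (k + h *\<^sub>R q)) powr s \<le> (1 + norm (k + h *\<^sub>R q)) powr 0"
    by (rule powr_mono_weight[OF s])
  also have "\<dots> = 1" by (simp add: add_nonneg_eq_0_iff)
  also have "1 = (1 + norm k) ^ L * (1 + norm k) powr (- real L)"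
    by (simp add: powr_minus powr_realpow add_pos_nonneg add_nonneg_eq_0_iff)
  also have "\<dots> \<le> (2 * (1 + norm q)) ^ L * (1 + norm k) powr (- real L)"
    using False by (intro mult_right_mono power_mono) auto
  also have "\<dots> = 2 ^ L * (1 + norm q) ^ L * (1 + norm k) powr (- real L)"
    by (simp only: power_mult_distrib)
  finally show ?thesis by (simp add: add_increasing)
qed

lemma finite_lists_length: "finite {js :: 'n::finite list. length js = N}"
  using finite_lists_length_eq[of "UNIV :: 'n set" N] by simp

context toroidal_calculus
begin

lemma S_foldr_lat_diff: "S m b \<Longrightarrow> S (m - \<rho> * real (length js)) (foldr (lat_diff h) js b)"
proof (induction js)
  case (Cons j js)
  from sym_lat_diff[OF Cons.IH[OF Cons.prems], of j] show ?case by (simp add: algebra_simps)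
qed auto

text \<open>The two summands come from the two regions of \<open>weight_region_bound\<close>. The
  assumption on \<open>m\<close> makes the exponent of the \<open>N\<close>-th differences
  nonpositive, and \<open>L\<close> stays free until it is balanced against the cost of Fourier
  decay.\<close>

lemma newton_rem_S:
  fixes b :: "'n::finite sym"
  assumes b: "S m b" and m: "m \<le> \<rho> * real N"
  shows "\<exists>C>0. \<forall>k\<in>lattice. \<forall>p\<in>zlat. \<forall>\<theta>. norm (newton_rem h N b k p \<theta>) \<le>
    C * ((1 + norm p) ^ N * (1 + norm k) powr (m - \<rho> * real N) + (1 + norm p) ^ (N + L) * (1 + norm k) powr (- real L))"
proof -
  let ?s = "m - \<rho> * real N"
  have "\<exists>C>0. \<forall>k\<in>lattice. \<forall>\<theta>. norm (foldr (lat_diff h) js b k \<theta>) \<le> C * (1 + norm k) powr (m - \<rho> * real (length js))" for js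
    by (rule S_order_bound[OF S_foldr_lat_diff[OF b]])
  then obtain C where C: "\<And>js. C js > 0"
    "\<And>js k \<theta>. k \<in> lattice \<Longrightarrow> norm (foldr (lat_diff h) js b k \<theta>) \<le> C js * (1 + norm k) powr (m - \<rho> * real (length js))"
    by metis
  \<comment> \<open>There are finitely many words of length \<open>N\<close>, so one constant serves
    all of them.\<close>
  define D where "D = (\<Sum>js | length js = N. C js)"
  have D: "C js \<le> D" if "length js = N" for js
    unfolding D_def using that C(1) by (intro member_le_sum finite_lists_length) (auto intro: less_imp_le)
  have "D > 0" using D[of "replicate N undefined"] C(1)[of "replicate N undefined"] by simp
  define E where "E = D * max (2 powr (- ?s)) (2 ^ L)"
  have E: "E > 0" using \<open>D > 0\<close> by (auto simp: E_def max_def)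
  define F where "F = real CARD('n) ^ N * E"
  have F: "F > 0" using E by (simp add: F_def)
  have "norm (newton_rem h N b k p \<theta>) \<le> F * ((1 + norm p) ^ N * (1 + norm k) powr ?s + (1 + norm p) ^ (N + L) * (1 + norm k) powr (- real L))"
    if k: "k \<in> lattice" and p: "p \<in> zlat" for k p \<theta>
  proof -
    \<comment> \<open>The maximum with 0 makes \<open>\<Phi>\<close> monotone on all reals, as
      \<open>newton_rem_bound\<close> demands.\<close>
    define \<Phi> where "\<Phi> = (\<lambda>r. E * ((1 + norm k) powr ?s + (1 + max r 0) ^ L * (1 + norm k) powr (- real L)))"
    have "norm (newton_rem h N b k p \<theta>) \<le> (real CARD('n) * norm p) ^ N * \<Phi> (norm p)"
    proof (rule newton_rem_bound[OF h_pos h_le _ _ _ p])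
      show "\<Phi> r \<le> \<Phi> s" if "r \<le> s" for r s
        unfolding \<Phi>_def using that E by (intro mult_left_mono add_left_mono mult_right_mono power_mono) auto
      show "\<Phi> 0 \<ge> 0" unfolding \<Phi>_def using E by simp
      fix js :: "'n list" and q :: "real ^ 'n" assume js: "length js = N" and q: "q \<in> zlat"
      have "norm (foldr (lat_diff h) js b (k + h *\<^sub>R q) \<theta>) \<le> C js * (1 + norm (k + h *\<^sub>R q)) powr ?s"
        using C(2)[OF hlattice_add[OF k q], of js \<theta>] js by simp
      also have "\<dots> \<le> D * (2 powr (- ?s) * (1 + norm k) powr ?s + 2 ^ L * (1 + norm q) ^ L * (1 + norm k) powr (- real L))"
        using D[OF js] C(1)[of js] m \<open>D > 0\<close> h_pos h_le by (intro mult_mono weight_region_bound) auto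
      also have "\<dots> \<le> D * (max (2 powr (- ?s)) (2 ^ L) * (1 + norm k) powr ?s + max (2 powr (- ?s)) (2 ^ L) * ((1 + norm q) ^ L * (1 + norm k) powr (- real L)))"
        unfolding mult.assoc[of "2 ^ L"]
        using \<open>D > 0\<close> by (intro mult_left_mono add_mono mult_right_mono) (auto intro!: mult_nonneg_nonneg)
      also have "\<dots> = \<Phi> (norm q)" by (simp add: \<Phi>_def E_def algebra_simps)
      finally show "norm (foldr (lat_diff h) js b (k + h *\<^sub>R q) \<theta>) \<le> \<Phi> (norm q)" .
    qed
    also have "(real CARD('n) * norm p) ^ N * \<Phi> (norm p) \<le> (real CARD('n) * (1 + norm p)) ^ N * \<Phi> (norm p)"
      using E by (intro mult_right_mono power_mono mult_left_mono) (auto simp: \<Phi>_def)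
    also have "\<dots> = F * ((1 + norm p) ^ N * (1 + norm k) powr ?s + (1 + norm p) ^ (N + L) * (1 + norm k) powr (- real L))"
      unfolding \<Phi>_def F_def max_absorb1[OF norm_ge_zero] power_mult_distrib power_add
      by (simp only: ring_distribs mult_ac)
    finally show ?thesis .
  qed
  then show ?thesis using F by blast
qed

end

section \<open>The remainder of the composition expansion\<close>

lemma has_sum_sum_finite:
  fixes f :: "'i \<Rightarrow> 'a \<Rightarrow> 'b::real_normed_vector"
  assumes "\<And>i. i \<in> I \<Longrightarrow> (f i has_sum s i) A"
  shows "((\<lambda>x. \<Sum>i\<in>I. f i x) has_sum (\<Sum>i\<in>I. s i)) A"
  using assms by (induction I rule: infinite_finite_induct) (auto intro: has_sum_add)

lemma has_sum_diff:
  fixes f g :: "'a \<Rightarrow> 'b::real_normed_vector"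
  assumes "(f has_sum s) A" "(g has_sum t) A"
  shows "((\<lambda>x. f x - g x) has_sum (s - t)) A"
  using has_sum_add[OF assms(1), of "\<lambda>x. - g x" "- t"] assms(2) by (simp add: has_sum_uminus)

lemma fourier_has_sum:
  fixes f :: "real ^ 'n::finite \<Rightarrow> complex"
  assumes f: "torus_smooth f"
  shows "((\<lambda>p. fourier_coef f p * echar p \<theta>) has_sum f \<theta>) zlat"
proof -
  obtain C where C: "\<And>p. p \<in> zlat \<Longrightarrow> norm (fourier_coef f p) * (1 + norm p) ^ (2 * CARD('n)) \<le> C"
    using fourier_coef_decay_ex[OF f] by metis
  have "(\<lambda>p. fourier_coef f p * echar p \<theta>) summable_on zlat"
    by (rule zlat_weight_comparison(2)[where C = C]) (simp add: norm_mult C)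
  then show ?thesis using fourier_inversion[OF f, of \<theta>] by (metis has_sum_infsum)
qed

lemma partial_tor_op:
  assumes f: "torus_smooth f"
  shows "partial j (tor_op h \<beta> f) = tor_op h \<beta> (partial j f)"
  by (rule torus_smooth_fourier_coef_eqI)
    (auto intro: torus_smooth_partial torus_smooth_tor_op f simp: fourier_coef_partial fourier_coef_tor_op torus_smooth_partial torus_smooth_tor_op f)

lemma tor_diff_tor_ops: "smooth_sym h \<sigma> \<Longrightarrow> k \<in> hlattice h \<Longrightarrow> tor_diff j (tor_ops h \<beta> \<sigma>) k = tor_ops h \<beta> (tor_diff j \<sigma>) k"
  by (simp add: tor_diff_def tor_ops_def partial_tor_op ssmD)

lemma tor_bounds_add:
  "smooth_sym h \<sigma> \<Longrightarrow> smooth_sym h \<tau> \<Longrightarrow> tor_bounds h r m \<sigma> \<Longrightarrow> tor_bounds h r m \<tau> \<Longrightarrow> tor_bounds h r m (\<lambda>k \<theta>. \<sigma> k \<theta> + \<tau> k \<theta>)"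
proof (induction r arbitrary: \<sigma> \<tau>)
  case (Suc r)
  have "tor_bounds h r m (tor_diff j (\<lambda>k \<theta>. \<sigma> k \<theta> + \<tau> k \<theta>))" for j
    using Suc.prems by (intro tor_bounds_cong[OF tor_diff_add, THEN iffD2] Suc.IH smooth_sym_tor_diff) auto
  with Suc.prems show ?case by (auto intro: order_bound_add)
qed (auto intro: order_bound_add)

context toroidal_calculus
begin

definition comp_term :: "('n::finite \<Rightarrow> nat) \<Rightarrow> 'n sym \<Rightarrow> 'n sym \<Rightarrow> 'n sym" where
  "comp_term \<gamma> a b = (\<lambda>k \<theta>. 1 / of_nat (mfact \<gamma>) * tor_ops h \<gamma> a k \<theta> * lat_diffs h \<gamma> b k \<theta>)"

definition comp_rem :: "nat \<Rightarrow> 'n::finite sym \<Rightarrow> 'n sym \<Rightarrow> 'n sym" where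
  "comp_rem N a b = (\<lambda>k \<theta>. comp_sym a b k \<theta> - (\<Sum>\<gamma> | mlen \<gamma> < N. comp_term \<gamma> a b k \<theta>))"

lemma S_comp_term:
  assumes "S m1 a" "S m2 b"
  shows "S (m1 + m2 - (\<rho> - \<delta>) * real (mlen \<gamma>)) (comp_term \<gamma> a b)"
proof -
  have "S ((m1 + \<delta> * real (mlen \<gamma>)) + (m2 - \<rho> * real (mlen \<gamma>))) (comp_term \<gamma> a b)"
    unfolding comp_term_def
    by (intro sym_mult sym_cmult sym_tor_ops sym_lat_diffs assms d_nonneg)
  then show ?thesis by (simp add: algebra_simps)
qed

lemma smooth_sym_comp_rem:
  assumes "S m1 a" "S m2 b"
  shows "smooth_sym h (comp_rem N a b)"
proof -
  have "smooth_sym h (\<lambda>k \<theta>. \<Sum>\<gamma> | mlen \<gamma> < N. comp_term \<gamma> a b k \<theta>)"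
    using sym_smooth_sym[OF S_comp_term[OF assms]] by (auto simp: smooth_sym_def intro: torus_smooth_sum)
  then show ?thesis
    unfolding comp_rem_def by (intro smooth_sym_diff smooth_sym_comp[OF assms])
qed

text \<open>The Fourier coefficients of \<open>tor_op h \<gamma> (a k)\<close> carry the factor
  \<open>h ^ mlen \<gamma> * falling \<gamma> p\<close>, which after division by
  \<open>mfact \<gamma>\<close> is exactly what multiplies the differences of \<open>b\<close> in
  Newton's polynomial. This is why toroidal operators are paired with forward differences.\<close>

lemma comp_rem_has_sum:
  fixes a b :: "'n::finite sym"
  assumes a: "S m1 a" and b: "S m2 b" and k: "k \<in> lattice"
  shows "((\<lambda>p. fourier_coef (a k) p * echar p \<theta> * newton_rem h N b k p \<theta>) has_sum comp_rem N a b k \<theta>) zlat"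
proof -
  have ak: "torus_smooth (a k)" by (rule ssmD[OF sym_smooth_sym[OF a] k])
  have T: "((\<lambda>p. 1 / of_nat (mfact \<gamma>) * (fourier_coef (tor_op h \<gamma> (a k)) p * echar p \<theta>) * lat_diffs h \<gamma> b k \<theta>) has_sum comp_term \<gamma> a b k \<theta>) zlat" for \<gamma>
    unfolding comp_term_def tor_ops_def
    by (intro has_sum_cmult_left has_sum_cmult_right fourier_has_sum torus_smooth_tor_op ak)
  have "((\<lambda>p. fourier_coef (a k) p * echar p \<theta> * b (k + h *\<^sub>R p) \<theta> -
     (\<Sum>\<gamma> | mlen \<gamma> < N. 1 / of_nat (mfact \<gamma>) * (fourier_coef (tor_op h \<gamma> (a k)) p * echar p \<theta>) * lat_diffs h \<gamma> b k \<theta>)) has_sum comp_rem N a b k \<theta>) zlat"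
    unfolding comp_rem_def comp_sym_def
    by (intro has_sum_diff has_sum_sum_finite T has_sum_infsum comp_summable[OF a b k])
  moreover have "fourier_coef (a k) p * echar p \<theta> * b (k + h *\<^sub>R p) \<theta> -
     (\<Sum>\<gamma> | mlen \<gamma> < N. 1 / of_nat (mfact \<gamma>) * (fourier_coef (tor_op h \<gamma> (a k)) p * echar p \<theta>) * lat_diffs h \<gamma> b k \<theta>)
     = fourier_coef (a k) p * echar p \<theta> * newton_rem h N b k p \<theta>" if p: "p \<in> zlat" for p
    by (simp add: newton_rem_def newton_def fourier_coef_tor_op[OF ak p] right_diff_distrib sum_distrib_left mbinomial_def mult_ac)
  ultimately show ?thesis
    by (simp cong: has_sum_cong)
qed

text \<open>For small \<open>p\<close>, the \<open>N\<close> powers of Fourier decay cost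
  \<open>\<delta> * N\<close> against the gain \<open>\<rho> * N\<close> of the differences. For
  large \<open>p\<close>, another \<open>L\<close> powers cost \<open>\<delta> * L\<close> and gain
  \<open>L\<close>.\<close>

lemma order_bound_comp_rem:
  fixes a b :: "'n::finite sym"
  assumes a: "S m1 a" and b: "S m2 b" and N: "m2 \<le> \<rho> * real N"
  shows "order_bound h (m1 + m2 + \<delta> * real (2 * CARD('n)) - (\<rho> - \<delta>) * real N) (comp_rem N a b)"
proof -
  define e where "e = m1 + m2 + \<delta> * real (2 * CARD('n)) - (\<rho> - \<delta>) * real N"
  \<comment> \<open>Possible since \<open>\<delta> < 1\<close>: the net gain
    \<open>(1 - \<delta>) * L\<close> for large \<open>p\<close> has to reach
    \<open>\<rho> * N - m2\<close>.\<close>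
  obtain L :: nat where L: "(\<rho> * real N - m2) / (1 - \<delta>) \<le> real L" using real_arch_simple by blast
  have d1: "1 - \<delta> > 0" using d_less r_le by linarith
  then have L': "\<rho> * real N - m2 \<le> (1 - \<delta>) * real L"
    using L by (simp add: divide_simps mult_ac)
  obtain C where C: "C > 0" "\<And>k p \<theta>. k \<in> lattice \<Longrightarrow> p \<in> zlat \<Longrightarrow> norm (newton_rem h N b k p \<theta>) \<le>
    C * ((1 + norm p) ^ N * (1 + norm k) powr (m2 - \<rho> * real N) + (1 + norm p) ^ (N + L) * (1 + norm k) powr (- real L))"
    using newton_rem_S[OF b N, of L] by blast
  obtain C1 where C1: "C1 > 0" "\<And>k p. k \<in> lattice \<Longrightarrow> p \<in> zlat \<Longrightarrow> norm (fourier_coef (a k) p) * (1 + norm p) ^ N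
    \<le> C1 * (1 + norm k) powr (m1 + \<delta> * real (2 * CARD('n) + N)) * zlat_weight p"
    using S_fourier_coef_weight[OF a, of N] by blast
  obtain C2 where C2: "C2 > 0" "\<And>k p. k \<in> lattice \<Longrightarrow> p \<in> zlat \<Longrightarrow> norm (fourier_coef (a k) p) * (1 + norm p) ^ (N + L)
    \<le> C2 * (1 + norm k) powr (m1 + \<delta> * real (2 * CARD('n) + (N + L))) * zlat_weight p"
    using S_fourier_coef_weight[OF a, of "N + L"] by blast
  have trm: "norm (fourier_coef (a k) p * echar p \<theta> * newton_rem h N b k p \<theta>) \<le> (C * (C1 + C2) * (1 + norm k) powr e) * zlat_weight p"
    if k: "k \<in> lattice" and p: "p \<in> zlat" for k p \<theta>
  proof -
    have z: "zlat_weight p \<ge> 0" using zlat_weight_pos[of p] by simp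
    have "norm (fourier_coef (a k) p) * (1 + norm p) ^ N * (1 + norm k) powr (m2 - \<rho> * real N)
       \<le> (C1 * (1 + norm k) powr (m1 + \<delta> * real (2 * CARD('n) + N)) * zlat_weight p) * (1 + norm k) powr (m2 - \<rho> * real N)"
      by (rule mult_right_mono[OF C1(2)[OF k p]]) simp
    also have "\<dots> = C1 * (1 + norm k) powr e * zlat_weight p"
      by (simp add: e_def powr_add[symmetric] mult_ac algebra_simps)
    finally have 1: "norm (fourier_coef (a k) p) * (1 + norm p) ^ N * (1 + norm k) powr (m2 - \<rho> * real N) \<le> C1 * (1 + norm k) powr e * zlat_weight p" .
    have "norm (fourier_coef (a k) p) * (1 + norm p) ^ (N + L) * (1 + norm k) powr (- real L)
       \<le> (C2 * (1 + norm k) powr (m1 + \<delta> * real (2 * CARD('n) + (N + L))) * zlat_weight p) * (1 + norm k) powr (- real L)"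
      by (rule mult_right_mono[OF C2(2)[OF k p]]) simp
    also have "\<dots> = C2 * (1 + norm k) powr (m1 + \<delta> * real (2 * CARD('n) + (N + L)) + - real L) * zlat_weight p"
      by (simp only: powr_add mult_ac)
    also have "\<dots> \<le> C2 * (1 + norm k) powr e * zlat_weight p"
      using L' C2(1) z by (intro mult_right_mono mult_left_mono powr_mono_weight) (auto simp: e_def algebra_simps)
    finally have 2: "norm (fourier_coef (a k) p) * (1 + norm p) ^ (N + L) * (1 + norm k) powr (- real L) \<le> C2 * (1 + norm k) powr e * zlat_weight p" .
    have "norm (fourier_coef (a k) p * echar p \<theta> * newton_rem h N b k p \<theta>) = norm (fourier_coef (a k) p) * norm (newton_rem h N b k p \<theta>)"
      by (simp add: norm_mult)
    also have "\<dots> \<le> norm (fourier_coef (a k) p) * (C * ((1 + norm p) ^ N * (1 + norm k) powr (m2 - \<rho> * real N) + (1 + norm p) ^ (N + L) * (1 + norm k) powr (- real L)))"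
      by (rule mult_left_mono[OF C(2)[OF k p]]) simp
    also have "\<dots> = C * (norm (fourier_coef (a k) p) * (1 + norm p) ^ N * (1 + norm k) powr (m2 - \<rho> * real N)
       + norm (fourier_coef (a k) p) * (1 + norm p) ^ (N + L) * (1 + norm k) powr (- real L))"
      by (simp only: ring_distribs mult_ac)
    also have "\<dots> \<le> C * (C1 * (1 + norm k) powr e * zlat_weight p + C2 * (1 + norm k) powr e * zlat_weight p)"
      using C(1) by (intro mult_left_mono add_mono 1 2) auto
    also have "\<dots> = (C * (C1 + C2) * (1 + norm k) powr e) * zlat_weight p"
      by (simp only: ring_distribs mult_ac)
    finally show ?thesis .
  qed
  have "norm (comp_rem N a b k \<theta>) \<le> (C * (C1 + C2) * infsum zlat_weight (zlat :: (real ^ 'n) set)) * (1 + norm k) powr e" if k: "k \<in> lattice" for k \<theta>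
  proof -
    have "((\<lambda>p :: real ^ 'n. (C * (C1 + C2) * (1 + norm k) powr e) * zlat_weight p) has_sum (C * (C1 + C2) * (1 + norm k) powr e) * infsum zlat_weight (zlat :: (real ^ 'n) set)) zlat"
      by (intro has_sum_cmult_right has_sum_infsum zlat_weight_summable)
    from norm_infsum_le[OF comp_rem_has_sum[OF a b k] this trm[OF k]] show ?thesis by (simp only: mult_ac)
  qed
  then show ?thesis unfolding e_def by (rule bndI)
qed

text \<open>The product rule holds for the composition and for each term of the expansion
  separately, hence for their difference.\<close>

lemma tor_diff_comp_rem:
  fixes a b :: "'n::finite sym"
  assumes a: "S m1 a" and b: "S m2 b" and k: "k \<in> lattice"
  shows "tor_diff j (comp_rem N a b) k = (\<lambda>\<theta>. comp_rem N (tor_diff j a) b k \<theta> + comp_rem N a (tor_diff j b) k \<theta>)"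
proof
  fix \<theta>
  have sa: "smooth_sym h a" and sb: "smooth_sym h b" using a b by (auto intro: sym_smooth_sym)
  have ct: "torus_smooth (comp_term \<gamma> a b k)" for \<gamma>
    by (rule ssmD[OF sym_smooth_sym[OF S_comp_term[OF a b]] k])
  have cp: "torus_smooth (comp_sym a b k)" by (rule ssmD[OF smooth_sym_comp[OF a b] k])
  have 1: "partial j (comp_term \<gamma> a b k) \<theta> = comp_term \<gamma> (tor_diff j a) b k \<theta> + comp_term \<gamma> a (tor_diff j b) k \<theta>" for \<gamma>
  proof -
    have T: "torus_smooth (tor_ops h \<gamma> a k)" and D: "torus_smooth (lat_diffs h \<gamma> b k)"
      by (auto intro!: ssmD[OF _ k] smooth_sym_tor_ops smooth_sym_lat_diffs sa sb)
    have "partial j (tor_ops h \<gamma> a k) = tor_ops h \<gamma> (tor_diff j a) k"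
      using tor_diff_tor_ops[OF sa k, of j \<gamma>] by (simp add: tor_diff_def)
    moreover have "partial j (lat_diffs h \<gamma> b k) = lat_diffs h \<gamma> (tor_diff j b) k"
      using tor_diff_lat_diffs[OF sb k, of j \<gamma>] by (simp add: tor_diff_def)
    moreover have "partial j (\<lambda>\<theta>. (1 / of_nat (mfact \<gamma>) * tor_ops h \<gamma> a k \<theta>) * lat_diffs h \<gamma> b k \<theta>) \<theta> =
       (1 / of_nat (mfact \<gamma>) * partial j (tor_ops h \<gamma> a k) \<theta>) * lat_diffs h \<gamma> b k \<theta>
       + (1 / of_nat (mfact \<gamma>) * tor_ops h \<gamma> a k \<theta>) * partial j (lat_diffs h \<gamma> b k) \<theta>"
      by (subst partial_mult, intro torus_smooth_differentiable torus_smooth_cmult T, intro torus_smooth_differentiable D,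
          subst partial_cmult, intro torus_smooth_differentiable T, rule refl)
    ultimately show ?thesis by (simp add: comp_term_def)
  qed
  have "tor_diff j (comp_rem N a b) k \<theta> = partial j (comp_sym a b k) \<theta> - (\<Sum>\<gamma> | mlen \<gamma> < N. partial j (comp_term \<gamma> a b k) \<theta>)"
    unfolding tor_diff_def comp_rem_def
    by (subst partial_diff) (auto intro!: torus_smooth_sum ct cp simp: partial_sum[OF ct])
  also have "partial j (comp_sym a b k) \<theta> = comp_sym (tor_diff j a) b k \<theta> + comp_sym a (tor_diff j b) k \<theta>"
    by (rule comp_derivative(2)[OF a b k])
  finally show "tor_diff j (comp_rem N a b) k \<theta> = comp_rem N (tor_diff j a) b k \<theta> + comp_rem N a (tor_diff j b) k \<theta>"
    by (simp add: comp_rem_def 1 sum.distrib)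
qed

text \<open>Induction through the product rule: each derivative raises the order of one of the two
  symbols by \<open>\<delta>\<close>, and the summands \<open>\<delta> * real r\<close> in the
  hypotheses pay for that.\<close>

lemma tor_bounds_comp_rem:
  fixes a b :: "'n::finite sym"
  shows "S m1 a \<Longrightarrow> S m2 b \<Longrightarrow> m2 + \<delta> * real r \<le> \<rho> * real N \<Longrightarrow>
    m1 + m2 + \<delta> * real (2 * CARD('n)) - (\<rho> - \<delta>) * real N + \<delta> * real r \<le> s \<Longrightarrow> tor_bounds h r s (comp_rem N a b)"
proof (induction r arbitrary: m1 m2 a b)
  case 0
  then show ?case using order_bound_mono[OF _ order_bound_comp_rem[OF 0(1,2)]] by simp
next
  case (Suc r)
  have dr: "\<delta> * real (Suc r) = \<delta> * real r + \<delta>" "\<delta> * real r \<ge> 0" by (auto simp: algebra_simps d_nonneg)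
  have "tor_bounds h r s (tor_diff j (comp_rem N a b))" for j
  proof (intro tor_bounds_cong[OF tor_diff_comp_rem[OF Suc.prems(1,2)], THEN iffD2] tor_bounds_add)
    show "tor_bounds h r s (comp_rem N (tor_diff j a) b)"
      by (rule Suc.IH[OF sym_tor_diff[OF Suc.prems(1)] Suc.prems(2)]) (use Suc.prems(3,4) dr d_nonneg in linarith)+
    show "tor_bounds h r s (comp_rem N a (tor_diff j b))"
      by (rule Suc.IH[OF Suc.prems(1) sym_tor_diff[OF Suc.prems(2)]]) (use Suc.prems(3,4) dr d_nonneg in linarith)+
    show "smooth_sym h (comp_rem N (tor_diff j a) b)" by (rule smooth_sym_comp_rem[OF sym_tor_diff[OF Suc.prems(1)] Suc.prems(2)])
    show "smooth_sym h (comp_rem N a (tor_diff j b))" by (rule smooth_sym_comp_rem[OF Suc.prems(1) sym_tor_diff[OF Suc.prems(2)]])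
  qed
  moreover have "order_bound h s (comp_rem N a b)"
    by (rule order_bound_mono[OF _ order_bound_comp_rem[OF Suc.prems(1,2)]]) (use Suc.prems(3,4) dr d_nonneg in linarith)+
  ultimately show ?case by simp
qed

text \<open>Passing to a much larger \<open>N\<close> absorbs the losses in the remainder estimate: the terms
  in between have the right order.\<close>

lemma S_comp_rem:
  fixes a b :: "'n::finite sym"
  assumes a: "S m1 a" and b: "S m2 b"
  shows "S (m1 + m2 - (\<rho> - \<delta>) * real N) (comp_rem N a b)"
proof -
  let ?m = "m1 + m2 - (\<rho> - \<delta>) * real N"
  have "word_bounds h \<rho> \<delta> r ?m (comp_rem N a b)" for r
  proof -
    have rd: "\<rho> - \<delta> > 0" using d_less by simp
    \<comment> \<open>The first entry makes the remainder estimate applicable after \<open>r\<close>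
      derivatives; the second lowers its order enough to cover the fixed loss, the \<open>r\<close>
      derivatives and \<open>r\<close> differences.\<close>
    define A where "A = max ((m2 + \<delta> * real r) / \<rho>)
      ((\<delta> * real (2 * CARD('n)) + \<delta> * real r + (\<rho> - \<delta>) * real N + \<rho> * real r) / (\<rho> - \<delta>))"
    obtain N0 :: nat where N0: "A \<le> real N0" using real_arch_simple by blast
    define N' where "N' = max N N0"
    have N': "N \<le> N'" "A \<le> real N'" using N0 by (auto simp: N'_def)
    have 1: "m2 + \<delta> * real r \<le> \<rho> * real N'"
      using N'(2) r_pos by (simp add: A_def divide_simps mult_ac)
    have 2: "\<delta> * real (2 * CARD('n)) + \<delta> * real r + (\<rho> - \<delta>) * real N + \<rho> * real r \<le> (\<rho> - \<delta>) * real N'"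
      using N'(2) rd by (simp add: A_def divide_simps mult_ac)
    have "tor_bounds h r (?m - \<rho> * real r) (comp_rem N' a b)"
      by (rule tor_bounds_comp_rem[OF a b 1]) (use 2 in linarith)
    then have e: "word_bounds h \<rho> \<delta> r ?m (comp_rem N' a b)"
      using r_pos d_nonneg by (intro tor_bounds_imp_word_bounds[OF _ _ smooth_sym_comp_rem[OF a b]]) auto
    have t: "S ?m (\<lambda>k \<theta>. \<Sum>\<gamma> | N \<le> mlen \<gamma> \<and> mlen \<gamma> < N'. comp_term \<gamma> a b k \<theta>)"
      using rd by (intro sym_sum sym_mono[OF S_comp_term[OF a b]]) auto
    have "comp_rem N a b = (\<lambda>k \<theta>. comp_rem N' a b k \<theta> + (\<Sum>\<gamma> | N \<le> mlen \<gamma> \<and> mlen \<gamma> < N'. comp_term \<gamma> a b k \<theta>))"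
    proof (intro ext)
      fix k \<theta>
      have "{\<gamma> :: 'n \<Rightarrow> nat. mlen \<gamma> < N'} = {\<gamma>. mlen \<gamma> < N} \<union> {\<gamma>. N \<le> mlen \<gamma> \<and> mlen \<gamma> < N'}"
        using N'(1) by auto
      moreover have "finite {\<gamma> :: 'n \<Rightarrow> nat. N \<le> mlen \<gamma> \<and> mlen \<gamma> < N'}"
        by (rule finite_subset[OF _ finite_mlen_less[of N']]) auto
      ultimately have "(\<Sum>\<gamma> | mlen \<gamma> < N'. comp_term \<gamma> a b k \<theta>) =
         (\<Sum>\<gamma> | mlen \<gamma> < N. comp_term \<gamma> a b k \<theta>) + (\<Sum>\<gamma> | N \<le> mlen \<gamma> \<and> mlen \<gamma> < N'. comp_term \<gamma> a b k \<theta>)"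
        by (simp only:) (rule sum.union_disjoint, auto intro: finite_mlen_less)
      then show "comp_rem N a b k \<theta> = comp_rem N' a b k \<theta> + (\<Sum>\<gamma> | N \<le> mlen \<gamma> \<and> mlen \<gamma> < N'. comp_term \<gamma> a b k \<theta>)"
        by (simp add: comp_rem_def)
    qed
    then show ?thesis
      using word_bounds_add[OF smooth_sym_comp_rem[OF a b] sym_smooth_sym[OF t] e sym_word_bounds[OF t]] by simp
  qed
  then show ?thesis unfolding symclass_def using smooth_sym_comp_rem[OF a b] by blast
qed

lemma S_comp: "S m1 a \<Longrightarrow> S m2 b \<Longrightarrow> S (m1 + m2) (comp_sym a b)"
  using S_comp_rem[of m1 a m2 b 0] by (simp add: comp_rem_def)

end

section \<open>Operators on rapidly decreasing functions\<close>

context toroidal_calculus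
begin

lemma norm_zlat_le_lattice: "1 + norm p \<le> (1 / h) * (1 + norm (h *\<^sub>R p))"
  using h_pos h_le by (simp add: field_simps)

lemma norm_lattice_le_zlat: "1 + norm (h *\<^sub>R p) \<le> 1 + norm p"
  using h_pos h_le by (simp add: mult_left_le_one_le)

lemma lattice_iff: "k \<in> lattice \<longleftrightarrow> (\<exists>p\<in>zlat. k = h *\<^sub>R p)"
  by (auto simp: hlattice_eq)

lemma schwartz_zlat:
  assumes "f \<in> schwartz h"
  shows "\<exists>C>0. \<forall>q\<in>zlat. norm (f (h *\<^sub>R q)) * (1 + norm q) ^ M \<le> C"
proof -
  obtain C where C: "\<And>k. k \<in> lattice \<Longrightarrow> (1 + norm k) ^ M * norm (f k) \<le> C"
    using assms unfolding schwartz_def mem_Collect_eq by meson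
  have "norm (f (h *\<^sub>R q)) * (1 + norm q) ^ M \<le> max 1 ((1 / h) ^ M * C)" if q: "q \<in> zlat" for q
  proof -
    have "(1 + norm q) ^ M \<le> ((1 / h) * (1 + norm (h *\<^sub>R q))) ^ M"
      by (intro power_mono norm_zlat_le_lattice) (auto intro: add_nonneg_nonneg)
    then have "norm (f (h *\<^sub>R q)) * (1 + norm q) ^ M \<le> norm (f (h *\<^sub>R q)) * ((1 / h) * (1 + norm (h *\<^sub>R q))) ^ M"
      by (rule mult_left_mono) simp
    also have "\<dots> = (1 / h) ^ M * ((1 + norm (h *\<^sub>R q)) ^ M * norm (f (h *\<^sub>R q)))"
      by (simp only: power_mult_distrib mult_ac)
    also have "\<dots> \<le> (1 / h) ^ M * C"
      using h_pos q by (intro mult_left_mono C) (auto simp: lattice_iff)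
    finally show ?thesis by simp
  qed
  then show ?thesis by (intro exI[of _ "max 1 ((1 / h) ^ M * C)"]) auto
qed

lemma schwartz_weight:
  fixes f :: "real ^ 'n::finite \<Rightarrow> complex"
  assumes "f \<in> schwartz h"
  shows "\<exists>C>0. \<forall>q\<in>zlat. norm (f (h *\<^sub>R q)) * (1 + norm q) ^ M \<le> C * zlat_weight q"
proof -
  obtain C where C: "C > 0" "\<And>q. q \<in> zlat \<Longrightarrow> norm (f (h *\<^sub>R q)) * (1 + norm q) ^ (M + 2 * CARD('n)) \<le> C"
    using schwartz_zlat[OF assms, of "M + 2 * CARD('n)"] by blast
  have "norm (f (h *\<^sub>R q)) * (1 + norm q) ^ M \<le> C * zlat_weight q" if "q \<in> zlat" for q
  proof -
    have "(1 + norm q) ^ (2 * CARD('n)) > 0" by (intro zero_less_power) (auto intro: add_pos_nonneg)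
    then show ?thesis using C(2)[OF that] by (simp add: zlat_weight_def power_add divide_simps mult_ac)
  qed
  with C(1) show ?thesis by blast
qed

lemma schwartz_norm_summable:
  fixes f :: "real ^ 'n::finite \<Rightarrow> complex"
  assumes "f \<in> schwartz h"
  shows "(\<lambda>q. norm (f (h *\<^sub>R q))) summable_on zlat"
proof -
  obtain C where C: "\<And>q. q \<in> zlat \<Longrightarrow> norm (f (h *\<^sub>R q)) * (1 + norm q) ^ 0 \<le> C * zlat_weight q"
    using schwartz_weight[OF assms, of 0] by blast
  show ?thesis
    by (rule summable_on_comparison_test[OF summable_on_cmult_right[OF zlat_weight_summable]]) (use C in auto)
qed

lemma sfourier_zlat: "sfourier h f \<theta> = (\<Sum>\<^sub>\<infinity>q\<in>zlat. echar (- q) \<theta> * f (h *\<^sub>R q))"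
proof -
  have "inj_on ((*\<^sub>R) h) (zlat :: (real ^ 'a) set)" using h_pos by (auto simp: inj_on_def)
  then have "sfourier h f \<theta> = (\<Sum>\<^sub>\<infinity>q\<in>zlat. exp (- 2 * of_real pi * (\<i> / of_real h) * of_real ((h *\<^sub>R q) \<bullet> \<theta>)) * f (h *\<^sub>R q))"
    unfolding sfourier_def hlattice_eq by (subst infsum_reindex) (auto simp: o_def)
  moreover have "exp (- 2 * of_real pi * (\<i> / of_real h) * of_real ((h *\<^sub>R q) \<bullet> \<theta>)) = echar (- q) \<theta>" for q
    using h_pos by (simp add: echar_def cis_conv_exp mult_ac)
  ultimately show ?thesis by simp
qed

text \<open>The series for \<open>sfourier\<close> is exchanged with the integral, with majorant
  \<open>B * norm (f (h *\<^sub>R q))\<close>. This matrix form carries the later computations with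
  compositions and symbols.\<close>

lemma Op_kernel:
  fixes f :: "real ^ 'n::finite \<Rightarrow> complex"
  assumes f: "f \<in> schwartz h" and s: "smooth_sym h \<sigma>" and r: "r \<in> zlat"
  shows "((\<lambda>q. fourier_coef (\<sigma> (h *\<^sub>R r)) (q - r) * f (h *\<^sub>R q)) has_sum Op h \<sigma> f (h *\<^sub>R r)) zlat"
proof -
  have sm: "torus_smooth (\<sigma> (h *\<^sub>R r))" using r by (intro ssmD[OF s]) (auto simp: lattice_iff)
  obtain B where B: "\<And>\<theta>. norm (\<sigma> (h *\<^sub>R r) \<theta>) \<le> B"
    by (meson torus_bounded torus_smooth_continuous[OF sm] sm torus_smooth_def)
  define w where "w = (\<lambda>q \<theta>. echar r \<theta> * \<sigma> (h *\<^sub>R r) \<theta> * (echar (- q) \<theta> * f (h *\<^sub>R q)))"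
  have "((\<lambda>q. integral (cbox 0 1) (w q)) has_sum integral (cbox 0 1) (\<lambda>\<theta>. \<Sum>\<^sub>\<infinity>q\<in>zlat. w q \<theta>)) zlat"
  proof (rule infsum_continuous_integral(2)[where M = "\<lambda>q. B * norm (f (h *\<^sub>R q))"])
    show "continuous_on UNIV (w q)" for q
      unfolding w_def by (intro continuous_intros echar_continuous torus_smooth_continuous sm)
    show "norm (w q \<theta>) \<le> B * norm (f (h *\<^sub>R q))" for q \<theta>
      using B[of \<theta>] by (simp add: w_def norm_mult mult_right_mono)
    show "(\<lambda>q. B * norm (f (h *\<^sub>R q))) summable_on zlat"
      by (intro summable_on_cmult_right schwartz_norm_summable f)
  qed
  moreover have "integral (cbox 0 1) (w q) = fourier_coef (\<sigma> (h *\<^sub>R r)) (q - r) * f (h *\<^sub>R q)" for q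
  proof -
    have "w q = (\<lambda>\<theta>. (echar (- (q - r)) \<theta> * \<sigma> (h *\<^sub>R r) \<theta>) * f (h *\<^sub>R q))"
      using echar_add[of r "- q"] by (auto simp: w_def fun_eq_iff)
    then show ?thesis unfolding fourier_coef_def by (simp only: integral_mult_left)
  qed
  moreover have "integral (cbox 0 1) (\<lambda>\<theta>. \<Sum>\<^sub>\<infinity>q\<in>zlat. w q \<theta>) = Op h \<sigma> f (h *\<^sub>R r)"
  proof -
    have "exp (2 * of_real pi * (\<i> / of_real h) * of_real ((h *\<^sub>R r) \<bullet> \<theta>)) = echar r \<theta>" for \<theta>
      using h_pos by (simp add: echar_def cis_conv_exp mult_ac)
    then show ?thesis
      unfolding Op_def sfourier_zlat w_def by (simp add: infsum_cmult_right')
  qed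
  ultimately show ?thesis by simp
qed

text \<open>Values off the lattice are arbitrary; this allows functions that agree only on the
  lattice to be exchanged inside \<open>Op\<close>.\<close>

lemma Op_cong_fun:
  assumes "\<And>k. k \<in> lattice \<Longrightarrow> f k = g k"
  shows "Op h \<sigma> f = Op h \<sigma> g"
proof -
  have "sfourier h f = sfourier h g"
    using assms by (auto simp: sfourier_def fun_eq_iff intro!: infsum_cong)
  then show ?thesis by (simp add: Op_def fun_eq_iff)
qed

lemma Op_schwartz:
  fixes f :: "real ^ 'n::finite \<Rightarrow> complex"
  assumes f: "f \<in> schwartz h" and s: "S m \<sigma>"
  shows "Op h \<sigma> f \<in> schwartz h"
  unfolding schwartz_def mem_Collect_eq
proof
  fix M :: nat
  have d1: "1 - \<delta> > 0" using d_less r_le by linarith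
  \<comment> \<open>The weight \<open>M\<close> on the output calls for decay \<open>P\<close> with
    \<open>M + m + \<delta> * P \<le> P\<close>, which is solvable since
    \<open>\<delta> < 1\<close>.\<close>
  obtain P :: nat where P: "(real M + m) / (1 - \<delta>) \<le> real P" using real_arch_simple by blast
  then have P': "real M + (m + \<delta> * real P) \<le> real P"
    using d1 by (simp add: divide_simps algebra_simps)
  obtain C where C: "C > 0" "\<And>k p. k \<in> lattice \<Longrightarrow> p \<in> zlat \<Longrightarrow>
      norm (fourier_coef (\<sigma> k) p) * (1 + norm p) ^ P \<le> C * (1 + norm k) powr (m + \<delta> * real P)"
    using S_fourier_coef_decay[OF s, of P] by blast
  obtain D where D: "D > 0" "\<And>q. q \<in> zlat \<Longrightarrow> norm (f (h *\<^sub>R q)) * (1 + norm q) ^ P \<le> D * zlat_weight q"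
    using schwartz_weight[OF f, of P] by blast
  have "(1 + norm k) ^ M * norm (Op h \<sigma> f k) \<le> C * D * infsum zlat_weight (zlat :: (real ^ 'n) set)" if k: "k \<in> lattice" for k
  proof -
    obtain r where r: "r \<in> zlat" "k = h *\<^sub>R r" using k by (auto simp: lattice_iff)
    have K: "(1 + norm k) ^ L = (1 + norm k) powr (real L)" for L
      by (rule powr_realpow[symmetric]) (auto intro: add_pos_nonneg)
    have nK: "norm (complex_of_real ((1 + norm k) ^ M)) = (1 + norm k) ^ M"
      unfolding norm_of_real by (intro abs_of_nonneg zero_le_power) (auto intro: add_nonneg_nonneg)
    have trm: "norm (of_real ((1 + norm k) ^ M) * (fourier_coef (\<sigma> k) (q - r) * f (h *\<^sub>R q))) \<le> (C * D) * zlat_weight q" if q: "q \<in> zlat" for q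
    proof -
      define c where "c = norm (fourier_coef (\<sigma> k) (q - r))"
      define g where "g = norm (f (h *\<^sub>R q))"
      define x where "x = 1 + norm (q - r)"
      have x: "x > 0" by (auto simp: x_def intro: add_pos_nonneg)
      have cx: "c * x ^ P \<le> C * (1 + norm k) powr (m + \<delta> * real P)"
        unfolding c_def x_def by (rule C(2)[OF k zlat_diff[OF q r(1)]])
      have "(1 + norm k) ^ M * c * x ^ P \<le> (1 + norm k) ^ M * (C * (1 + norm k) powr (m + \<delta> * real P))"
        using mult_left_mono[OF cx, of "(1 + norm k) ^ M"] by (simp add: mult_ac)
      also have "\<dots> = C * (1 + norm k) powr (real M + (m + \<delta> * real P))"
        unfolding K by (simp only: powr_add mult_ac)
      also have "\<dots> \<le> C * (1 + norm k) powr real P"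
        using C(1) by (intro mult_left_mono powr_mono_weight P') auto
      also have "\<dots> = C * (1 + norm k) ^ P" by (simp add: K)
      \<comment> \<open>The weight in \<open>k\<close> splits into a weight in \<open>q\<close> and
        one in \<open>q - r\<close>; the latter cancels against the decay of the matrix
        entry.\<close>
      also have "\<dots> \<le> C * ((1 + norm q) * x) ^ P"
      proof -
        have "norm k \<le> norm r" using norm_lattice_le_zlat[of r] r(2) by simp
        moreover have "norm r \<le> norm q + norm (q - r)"
          using norm_triangle_ineq4[of q "q - r"] by simp
        ultimately have "1 + norm k \<le> (1 + norm q) * x"
          using mult_nonneg_nonneg[OF norm_ge_zero norm_ge_zero, of q "q - r"] unfolding x_def ring_distribs by linarith
        then show ?thesis using C(1) by (intro mult_left_mono power_mono) auto
      qed
      also have "\<dots> = (C * (1 + norm q) ^ P) * x ^ P" by (simp only: power_mult_distrib mult_ac)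
      finally have "(1 + norm k) ^ M * c \<le> C * (1 + norm q) ^ P"
        using x by (simp add: mult_le_cancel_right)
      then have "(1 + norm k) ^ M * c * g \<le> C * (1 + norm q) ^ P * g"
        by (rule mult_right_mono) (simp add: g_def)
      also have "\<dots> = C * (g * (1 + norm q) ^ P)" by (simp only: mult_ac)
      also have "\<dots> \<le> C * (D * zlat_weight q)"
        using C(1) D(2)[OF q] unfolding g_def by (intro mult_left_mono) auto
      finally show ?thesis unfolding norm_mult nK c_def g_def by (simp only: mult_ac)
    qed
    have 1: "((\<lambda>q. of_real ((1 + norm k) ^ M) * (fourier_coef (\<sigma> k) (q - r) * f (h *\<^sub>R q))) has_sum (of_real ((1 + norm k) ^ M) * Op h \<sigma> f k)) zlat"
      using Op_kernel[OF f sym_smooth_sym[OF s] r(1)] unfolding r(2) by (rule has_sum_cmult_right)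
    have 2: "((\<lambda>q :: real ^ 'n. (C * D) * zlat_weight q) has_sum (C * D) * infsum zlat_weight (zlat :: (real ^ 'n) set)) zlat"
      by (intro has_sum_cmult_right has_sum_infsum zlat_weight_summable)
    have "norm (of_real ((1 + norm k) ^ M) * Op h \<sigma> f k) \<le> C * D * infsum zlat_weight (zlat :: (real ^ 'n) set)"
      by (rule norm_infsum_le[OF 1 2 trm])
    then show ?thesis unfolding norm_mult nK .
  qed
  then show "\<exists>C. \<forall>k\<in>lattice. (1 + norm k) ^ M * norm (Op h \<sigma> f k) \<le> C" by blast
qed

lemma summable_on_product_bound:
  fixes g :: "'a \<times> 'b \<Rightarrow> 'c::banach" and x :: "'a \<Rightarrow> real" and y :: "'b \<Rightarrow> real"
  assumes x: "x summable_on A" and y: "y summable_on B"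
    and g: "\<And>a b. a \<in> A \<Longrightarrow> b \<in> B \<Longrightarrow> norm (g (a, b)) \<le> x a * y b"
    and nn: "\<And>a. a \<in> A \<Longrightarrow> x a \<ge> 0" "\<And>b. b \<in> B \<Longrightarrow> y b \<ge> 0"
  shows "g summable_on A \<times> B"
proof -
  have "(\<lambda>(a, b). x a * y b) summable_on Sigma A (\<lambda>_. B)"
  proof (rule summable_on_SigmaI)
    show "((\<lambda>b. case (a, b) of (a, b) \<Rightarrow> x a * y b) has_sum (x a * infsum y B)) B" for a
      using has_sum_cmult_right[OF has_sum_infsum[OF y]] by simp
    show "(\<lambda>a. x a * infsum y B) summable_on A" by (rule summable_on_cmult_left[OF x])
  qed (use nn in auto)
  then have "(\<lambda>ab. norm (g ab)) summable_on A \<times> B"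
    by (rule summable_on_comparison_test) (use g in auto)
  then show ?thesis by (rule abs_summable_summable)
qed

text \<open>These are the entries of the matrix product: the coefficients of the series for
  \<open>comp_sym\<close> are taken termwise and reindexed by \<open>t = q - r\<close>.\<close>

lemma fourier_coef_comp:
  fixes a b :: "'n::finite sym"
  assumes a: "S m1 a" and b: "S m2 b" and r: "r \<in> zlat"
  shows "((\<lambda>q. fourier_coef (a (h *\<^sub>R r)) (q - r) * fourier_coef (b (h *\<^sub>R q)) (p - q)) has_sum fourier_coef (comp_sym a b (h *\<^sub>R r)) (p - r)) zlat"
proof -
  let ?k = "h *\<^sub>R r"
  have k: "?k \<in> lattice" using r by (auto simp: lattice_iff)
  let ?w = "\<lambda>t \<theta>. fourier_coef (a ?k) t * echar t \<theta> * b (?k + h *\<^sub>R t) \<theta>"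
  obtain C where C: "\<And>t \<theta>. t \<in> zlat \<Longrightarrow> norm (?w t \<theta>) \<le> C * zlat_weight t"
    using comp_term_bound[OF a b k] by blast
  have "((\<lambda>t. fourier_coef (?w t) (p - r)) has_sum fourier_coef (\<lambda>\<theta>. \<Sum>\<^sub>\<infinity>t\<in>zlat. ?w t \<theta>) (p - r)) zlat"
  proof (rule fourier_coef_infsum[where M = "\<lambda>t. C * zlat_weight t"])
    show "continuous_on UNIV (?w t)" if "t \<in> zlat" for t
      by (intro continuous_intros echar_continuous torus_smooth_continuous ssmD[OF sym_smooth_sym[OF b]] hlattice_add k that)
    show "(\<lambda>t :: real ^ 'n. C * zlat_weight t) summable_on zlat" by (rule summable_on_cmult_right[OF zlat_weight_summable])
  qed (rule C)
  moreover have "fourier_coef (?w t) (p - r) = fourier_coef (a ?k) t * fourier_coef (b (?k + h *\<^sub>R t)) (p - r - t)" for t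
    unfolding mult.assoc fourier_coef_cmult fourier_coef_echar_mult ..
  moreover have "(\<lambda>\<theta>. \<Sum>\<^sub>\<infinity>t\<in>zlat. ?w t \<theta>) = comp_sym a b ?k" by (simp add: comp_sym_def fun_eq_iff)
  ultimately have "((\<lambda>t. fourier_coef (a ?k) t * fourier_coef (b (?k + h *\<^sub>R t)) (p - r - t)) has_sum fourier_coef (comp_sym a b ?k) (p - r)) zlat"
    by simp
  moreover have "bij_betw (\<lambda>q. q - r) zlat zlat"
    by (rule bij_betwI[of _ _ _ "\<lambda>q. q + r"]) (use r in \<open>auto intro: zlat_diff zlat_add\<close>)
  ultimately have "((\<lambda>q. fourier_coef (a ?k) (q - r) * fourier_coef (b (?k + h *\<^sub>R (q - r))) (p - r - (q - r))) has_sum fourier_coef (comp_sym a b ?k) (p - r)) zlat"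
    by (subst (asm) has_sum_reindex_bij_betw[symmetric])
  then show ?thesis by (simp add: scaleR_diff_right)
qed

text \<open>Associativity of the matrix product, by Fubini. The entries of \<open>b\<close> may grow
  like the power \<open>L\<close> of their row index \<open>q\<close>; the decay of the single row
  of \<open>a\<close> at \<open>k\<close> absorbs this.\<close>

lemma Op_comp:
  fixes f :: "real ^ 'n::finite \<Rightarrow> complex"
  assumes f: "f \<in> schwartz h" and a: "S m1 a" and b: "S m2 b" and k: "k \<in> lattice"
  shows "Op h a (Op h b f) k = Op h (comp_sym a b) f k"
proof -
  obtain r where r: "r \<in> zlat" "k = h *\<^sub>R r" using k by (auto simp: lattice_iff)
  let ?g = "\<lambda>q p. fourier_coef (a k) (q - r) * (fourier_coef (b (h *\<^sub>R q)) (p - q) * f (h *\<^sub>R p))"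
  obtain L :: nat where L: "real L \<ge> \<bar>m2\<bar>" using real_arch_simple[of "\<bar>m2\<bar>"] by blast
  obtain C where C: "C > 0" "\<And>k p. k \<in> lattice \<Longrightarrow> p \<in> zlat \<Longrightarrow> norm (fourier_coef (b k) p) * (1 + norm p) ^ 0 \<le> C * (1 + norm k) powr (m2 + \<delta> * real 0)"
    using S_fourier_coef_decay[OF b, of 0] by blast
  have bC: "norm (fourier_coef (b (h *\<^sub>R q)) p) \<le> C * (1 + norm q) ^ L" if "q \<in> zlat" "p \<in> zlat" for q p
  proof -
    have "norm (fourier_coef (b (h *\<^sub>R q)) p) \<le> C * (1 + norm (h *\<^sub>R q)) powr m2"
      using C(2)[of "h *\<^sub>R q" p] that by (auto simp: lattice_iff)
    also have "(1 + norm (0 + h *\<^sub>R q)) powr m2 \<le> (1 + norm q) ^ L * (1 + norm (0 :: real ^ 'n)) powr m2"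
      by (rule weight_hlattice_add[OF L])
    then have "C * (1 + norm (h *\<^sub>R q)) powr m2 \<le> C * (1 + norm q) ^ L"
      using C(1) by simp
    finally show ?thesis .
  qed
  \<comment> \<open>\<open>L\<close> powers against the growth of \<open>b\<close>, the others for
    the summable weight.\<close>
  define W where "W = L + 2 * CARD('n)"
  obtain A where A: "A > 0" "\<And>p. p \<in> zlat \<Longrightarrow> norm (fourier_coef (a k) p) * (1 + norm p) ^ W \<le> A * (1 + norm k) powr (m1 + \<delta> * real W)"
    using S_fourier_coef_decay[OF a, of W] k by blast
  define A' where "A' = A * (1 + norm k) powr (m1 + \<delta> * real W)"
  have aA: "norm (fourier_coef (a k) (q - r)) * (1 + norm q) ^ L \<le> A' * (1 + norm r) ^ W * zlat_weight q" if q: "q \<in> zlat" for q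
  proof -
    have "norm q \<le> norm r + norm (q - r)" using norm_triangle_ineq[of r "q - r"] by simp
    then have "1 + norm q \<le> (1 + norm r) * (1 + norm (q - r))"
      using mult_nonneg_nonneg[OF norm_ge_zero norm_ge_zero, of r "q - r"] unfolding ring_distribs by linarith
    then have "(1 + norm q) ^ W \<le> ((1 + norm r) * (1 + norm (q - r))) ^ W"
      by (intro power_mono) (auto intro: add_nonneg_nonneg)
    then have "norm (fourier_coef (a k) (q - r)) * (1 + norm q) ^ W \<le> norm (fourier_coef (a k) (q - r)) * ((1 + norm r) * (1 + norm (q - r))) ^ W"
      by (rule mult_left_mono) simp
    also have "\<dots> = (norm (fourier_coef (a k) (q - r)) * (1 + norm (q - r)) ^ W) * (1 + norm r) ^ W"
      by (simp only: power_mult_distrib mult_ac)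
    also have "\<dots> \<le> A' * (1 + norm r) ^ W"
      unfolding A'_def by (intro mult_right_mono A(2) zlat_diff q r) (auto intro: add_nonneg_nonneg)
    finally have "norm (fourier_coef (a k) (q - r)) * (1 + norm q) ^ W \<le> A' * (1 + norm r) ^ W" .
    moreover have "(1 + norm q) ^ (2 * CARD('n)) > 0" by (intro zero_less_power) (auto intro: add_pos_nonneg)
    ultimately show ?thesis by (simp add: zlat_weight_def W_def power_add divide_simps mult_ac)
  qed
  obtain D where D: "D > 0" "\<And>q. q \<in> zlat \<Longrightarrow> norm (f (h *\<^sub>R q)) * (1 + norm q) ^ 0 \<le> D * zlat_weight q"
    using schwartz_weight[OF f, of 0] by blast
  have sum: "(\<lambda>(q, p). ?g q p) summable_on zlat \<times> zlat"
  proof (rule summable_on_product_bound)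
    show "(\<lambda>q :: real ^ 'n. (C * A' * (1 + norm r) ^ W) * zlat_weight q) summable_on zlat"
      "(\<lambda>q :: real ^ 'n. D * zlat_weight q) summable_on zlat"
      by (rule summable_on_cmult_right[OF zlat_weight_summable])+
    have z: "zlat_weight q \<ge> 0" for q :: "real ^ 'n" using zlat_weight_pos[of q] by simp
    show "0 \<le> (C * A' * (1 + norm r) ^ W) * zlat_weight q" "0 \<le> D * zlat_weight q" for q :: "real ^ 'n"
      using C(1) A(1) D(1) z by (auto simp: A'_def intro!: mult_nonneg_nonneg zero_le_power add_nonneg_nonneg)
    fix q p :: "real ^ 'n" assume q: "q \<in> zlat" and p: "p \<in> zlat"
    have "norm (?g q p) = norm (fourier_coef (a k) (q - r)) * norm (fourier_coef (b (h *\<^sub>R q)) (p - q)) * norm (f (h *\<^sub>R p))"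
      by (simp add: norm_mult)
    also have "\<dots> \<le> norm (fourier_coef (a k) (q - r)) * (C * (1 + norm q) ^ L) * (D * zlat_weight p)"
      using D(2)[OF p] bC[OF q zlat_diff[OF p q]] C(1) by (intro mult_mono) (auto intro!: mult_nonneg_nonneg zero_le_power add_nonneg_nonneg)
    also have "\<dots> = (norm (fourier_coef (a k) (q - r)) * (1 + norm q) ^ L) * (C * (D * zlat_weight p))"
      by (simp only: mult_ac)
    also have "\<dots> \<le> (A' * (1 + norm r) ^ W * zlat_weight q) * (C * (D * zlat_weight p))"
      using C(1) D(1) z by (intro mult_right_mono aA q) auto
    also have "\<dots> = (C * A' * (1 + norm r) ^ W) * zlat_weight q * (D * zlat_weight p)" by (simp only: mult_ac)
    finally show "norm (case (q, p) of (q, p) \<Rightarrow> ?g q p) \<le> (C * A' * (1 + norm r) ^ W) * zlat_weight q * (D * zlat_weight p)" by simp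
  qed
  have "Op h a (Op h b f) k = (\<Sum>\<^sub>\<infinity>q\<in>zlat. fourier_coef (a k) (q - r) * Op h b f (h *\<^sub>R q))"
    using Op_kernel[OF Op_schwartz[OF f b] sym_smooth_sym[OF a] r(1)] by (simp add: r(2) infsumI)
  also have "\<dots> = (\<Sum>\<^sub>\<infinity>q\<in>zlat. \<Sum>\<^sub>\<infinity>p\<in>zlat. ?g q p)"
  proof (rule infsum_cong)
    fix q :: "real ^ 'n" assume q: "q \<in> zlat"
    show "fourier_coef (a k) (q - r) * Op h b f (h *\<^sub>R q) = (\<Sum>\<^sub>\<infinity>p\<in>zlat. ?g q p)"
      by (rule infsumI[OF has_sum_cmult_right[OF Op_kernel[OF f sym_smooth_sym[OF b] q]], symmetric])
  qed
  also have "\<dots> = (\<Sum>\<^sub>\<infinity>p\<in>zlat. \<Sum>\<^sub>\<infinity>q\<in>zlat. ?g q p)"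
    by (rule infsum_swap_banach[OF sum])
  also have "\<dots> = (\<Sum>\<^sub>\<infinity>p\<in>zlat. fourier_coef (comp_sym a b k) (p - r) * f (h *\<^sub>R p))"
  proof (rule infsum_cong)
    fix p :: "real ^ 'n"
    have "((\<lambda>q. (fourier_coef (a k) (q - r) * fourier_coef (b (h *\<^sub>R q)) (p - q)) * f (h *\<^sub>R p)) has_sum (fourier_coef (comp_sym a b k) (p - r) * f (h *\<^sub>R p))) zlat"
      unfolding r(2) by (rule has_sum_cmult_left[OF fourier_coef_comp[OF a b r(1)]])
    then show "(\<Sum>\<^sub>\<infinity>q\<in>zlat. ?g q p) = fourier_coef (comp_sym a b k) (p - r) * f (h *\<^sub>R p)"
      by (simp add: infsumI mult.assoc)
  qed
  also have "\<dots> = Op h (comp_sym a b) f k"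
    using Op_kernel[OF f smooth_sym_comp[OF a b] r(1)] by (simp add: r(2) infsumI)
  finally show ?thesis .
qed

lemma Op_one:
  fixes f :: "real ^ 'n::finite \<Rightarrow> complex"
  assumes f: "f \<in> schwartz h" and k: "k \<in> lattice"
  shows "Op h (\<lambda>k \<theta>. 1) f k = f k"
proof -
  obtain r where r: "r \<in> zlat" "k = h *\<^sub>R r" using k by (auto simp: lattice_iff)
  have "((\<lambda>q. fourier_coef (\<lambda>\<theta>. 1) (q - r) * f (h *\<^sub>R q)) has_sum f (h *\<^sub>R r)) zlat"
    by (rule has_sum_finite_neutralI[where B = "{r}"]) (use r in \<open>auto simp: fourier_coef_const_0 zlat_diff zlat_0\<close>)
  with Op_kernel[OF f smooth_sym_const r(1), of 1] show ?thesis
    unfolding r(2) by (rule has_sum_unique)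
qed

lemma Op_add_sym:
  fixes f :: "real ^ 'n::finite \<Rightarrow> complex"
  assumes f: "f \<in> schwartz h" and s: "smooth_sym h \<sigma>" and t: "smooth_sym h \<tau>" and k: "k \<in> lattice"
  shows "Op h (\<lambda>k \<theta>. \<sigma> k \<theta> + \<tau> k \<theta>) f k = Op h \<sigma> f k + Op h \<tau> f k"
proof -
  obtain r where r: "r \<in> zlat" "k = h *\<^sub>R r" using k by (auto simp: lattice_iff)
  have "fourier_coef (\<lambda>\<theta>. \<sigma> (h *\<^sub>R r) \<theta> + \<tau> (h *\<^sub>R r) \<theta>) p = fourier_coef (\<sigma> (h *\<^sub>R r)) p + fourier_coef (\<tau> (h *\<^sub>R r)) p" for p
    using k r(2) by (intro fourier_coef_add torus_smooth_continuous ssmD[OF s] ssmD[OF t]) auto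
  with has_sum_add[OF Op_kernel[OF f s r(1)] Op_kernel[OF f t r(1)]]
  have "((\<lambda>q. fourier_coef (\<lambda>\<theta>. \<sigma> (h *\<^sub>R r) \<theta> + \<tau> (h *\<^sub>R r) \<theta>) (q - r) * f (h *\<^sub>R q)) has_sum (Op h \<sigma> f (h *\<^sub>R r) + Op h \<tau> f (h *\<^sub>R r))) zlat"
    by (simp add: ring_distribs)
  with Op_kernel[OF f smooth_sym_add[OF s t] r(1)] show ?thesis
    unfolding r(2) by (rule has_sum_unique)
qed

lemma Op_cmult_sym: "Op h (\<lambda>k \<theta>. c * \<sigma> k \<theta>) f k = c * Op h \<sigma> f k"
proof -
  have "(\<lambda>\<theta>. exp (2 * of_real pi * (\<i> / of_real h) * of_real (k \<bullet> \<theta>)) * (c * \<sigma> k \<theta>) * sfourier h f \<theta>)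
      = (\<lambda>\<theta>. c * (exp (2 * of_real pi * (\<i> / of_real h) * of_real (k \<bullet> \<theta>)) * \<sigma> k \<theta> * sfourier h f \<theta>))"
    by (simp add: mult_ac)
  then show ?thesis unfolding Op_def by (simp only: integral_mult_right)
qed

lemma schwartz_add: "f \<in> schwartz h \<Longrightarrow> g \<in> schwartz h \<Longrightarrow> (\<lambda>k. f k + g k) \<in> schwartz h"
  unfolding schwartz_def mem_Collect_eq
proof
  fix m :: nat
  assume "\<forall>m. \<exists>C. \<forall>k\<in>lattice. (1 + norm k) ^ m * norm (f k) \<le> C" "\<forall>m. \<exists>C. \<forall>k\<in>lattice. (1 + norm k) ^ m * norm (g k) \<le> C"
  then obtain C D where C: "\<And>k. k \<in> lattice \<Longrightarrow> (1 + norm k) ^ m * norm (f k) \<le> C"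
    and D: "\<And>k. k \<in> lattice \<Longrightarrow> (1 + norm k) ^ m * norm (g k) \<le> D" by metis
  have "(1 + norm k) ^ m * norm (f k + g k) \<le> C + D" if "k \<in> lattice" for k
  proof -
    have "(1 + norm k) ^ m * norm (f k + g k) \<le> (1 + norm k) ^ m * (norm (f k) + norm (g k))"
      by (intro mult_left_mono norm_triangle_ineq zero_le_power) (auto intro: add_nonneg_nonneg)
    then show ?thesis using C[OF that] D[OF that] by (simp add: ring_distribs)
  qed
  then show "\<exists>C. \<forall>k\<in>lattice. (1 + norm k) ^ m * norm (f k + g k) \<le> C" by blast
qed

lemma Op_add_fun:
  fixes f g :: "real ^ 'n::finite \<Rightarrow> complex"
  assumes f: "f \<in> schwartz h" and g: "g \<in> schwartz h" and s: "smooth_sym h \<sigma>" and k: "k \<in> lattice"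
  shows "Op h \<sigma> (\<lambda>k. f k + g k) k = Op h \<sigma> f k + Op h \<sigma> g k"
proof -
  obtain r where r: "r \<in> zlat" "k = h *\<^sub>R r" using k by (auto simp: lattice_iff)
  from has_sum_add[OF Op_kernel[OF f s r(1)] Op_kernel[OF g s r(1)]]
  have "((\<lambda>q. fourier_coef (\<sigma> (h *\<^sub>R r)) (q - r) * (f (h *\<^sub>R q) + g (h *\<^sub>R q))) has_sum (Op h \<sigma> f (h *\<^sub>R r) + Op h \<sigma> g (h *\<^sub>R r))) zlat"
    by (simp add: ring_distribs)
  with Op_kernel[OF schwartz_add[OF f g] s r(1)] show ?thesis
    unfolding r(2) by (rule has_sum_unique)
qed

lemma schwartz_delta: "(\<lambda>x. if x = y then 1 else 0) \<in> schwartz h"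
  unfolding schwartz_def mem_Collect_eq
proof
  fix m
  show "\<exists>C. \<forall>k\<in>lattice. (1 + norm k) ^ m * norm (if k = y then 1 else 0 :: complex) \<le> C"
    by (intro exI[of _ "(1 + norm y) ^ m"] ballI) (auto intro: zero_le_power add_nonneg_nonneg)
qed

text \<open>Point masses at lattice points pick out single matrix entries, that is, single Fourier
  coefficients of the symbol.\<close>

lemma symbol_unique:
  fixes \<sigma> \<tau> :: "'n::finite sym"
  assumes s: "smooth_sym h \<sigma>" and t: "smooth_sym h \<tau>" and eq: "\<And>f k. f \<in> schwartz h \<Longrightarrow> k \<in> lattice \<Longrightarrow> Op h \<sigma> f k = Op h \<tau> f k"
    and k: "k \<in> lattice"
  shows "\<sigma> k = \<tau> k"
proof (rule torus_smooth_fourier_coef_eqI[OF ssmD[OF s k] ssmD[OF t k]])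
  fix p :: "real ^ 'n" assume p: "p \<in> zlat"
  obtain r where r: "r \<in> zlat" "k = h *\<^sub>R r" using k by (auto simp: lattice_iff)
  define f :: "real ^ 'n \<Rightarrow> complex" where "f = (\<lambda>x. if x = h *\<^sub>R (r + p) then 1 else 0)"
  have f: "f \<in> schwartz h" unfolding f_def by (rule schwartz_delta)
  have *: "Op h \<upsilon> f k = fourier_coef (\<upsilon> k) p" if "smooth_sym h \<upsilon>" for \<upsilon>
  proof -
    have "((\<lambda>q. fourier_coef (\<upsilon> (h *\<^sub>R r)) (q - r) * f (h *\<^sub>R q)) has_sum fourier_coef (\<upsilon> (h *\<^sub>R r)) p) zlat"
      by (rule has_sum_finite_neutralI[where B = "{r + p}"]) (use h_pos r p in \<open>auto simp: f_def zlat_add\<close>)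
    with Op_kernel[OF f that r(1)] show ?thesis
      unfolding r(2) by (rule has_sum_unique)
  qed
  show "fourier_coef (\<sigma> k) p = fourier_coef (\<tau> k) p"
    using eq[OF f k] *[OF s] *[OF t] by simp
qed

end

section \<open>Asymptotic sums and parametrices\<close>

lemma tor_diff_apply: "tor_diff j \<sigma> k = partial j (\<sigma> k)"
  by (simp add: tor_diff_def)

lemma word_bounds_param_mono:
  assumes "\<rho> \<le> \<rho>'" "\<delta>' \<le> \<delta>"
  shows "word_bounds h \<rho>' \<delta>' r m \<sigma> \<Longrightarrow> word_bounds h \<rho> \<delta> r m \<sigma>"
proof (induction r arbitrary: m \<sigma>)
  case (Suc r)
  have e: "word_bounds h \<rho> \<delta> r (m - \<rho>') (lat_diff h j \<sigma>)" "word_bounds h \<rho> \<delta> r (m + \<delta>') (tor_diff j \<sigma>)" for j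
    using Suc.prems by (auto intro: Suc.IH)
  have "word_bounds h \<rho> \<delta> r (m - \<rho>) (lat_diff h j \<sigma>)" "word_bounds h \<rho> \<delta> r (m + \<delta>) (tor_diff j \<sigma>)" for j
    using assms by (auto intro: word_bounds_mono[OF _ e(1)] word_bounds_mono[OF _ e(2)])
  then show ?case using Suc.prems by simp
qed simp

text \<open>The exponent after all \<open>r\<close> torus derivatives is the largest and serves for
  all of them.\<close>

lemma word_bounds_imp_tor_bounds:
  assumes "\<delta> \<ge> 0"
  shows "word_bounds h \<rho> \<delta> r m \<sigma> \<Longrightarrow> tor_bounds h r (m + \<delta> * real r) \<sigma>"
proof (induction r arbitrary: m \<sigma>)
  case (Suc r)
  have "tor_bounds h r (m + \<delta> + \<delta> * real r) (tor_diff j \<sigma>)" for j using Suc.prems by (intro Suc.IH) simp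
  moreover have "order_bound h (m + \<delta> * real (Suc r)) \<sigma>"
    by (rule order_bound_mono[OF _ word_bounds_imp_order_bound[OF Suc.prems]]) (use assms in simp)
  ultimately show ?case by (simp add: algebra_simps)
qed simp

lemma tor_bounds_words:
  "(\<And>ds. length ds \<le> r \<Longrightarrow> order_bound h s (foldr tor_diff ds \<sigma>)) \<Longrightarrow> tor_bounds h r s \<sigma>"
proof (induction r arbitrary: \<sigma>)
  case 0
  from 0[of "[]"] show ?case by simp
next
  case (Suc r)
  have "tor_bounds h r s (tor_diff j \<sigma>)" for j
  proof (rule Suc.IH)
    fix ds :: "'a list" assume "length ds \<le> r"
    with Suc.prems[of "ds @ [j]"] show "order_bound h s (foldr tor_diff ds (tor_diff j \<sigma>))" by simp
  qed
  with Suc.prems[of "[]"] show ?case by simp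
qed

section \<open>The operator classes and the smoothing operators\<close>

context toroidal_calculus
begin

abbreviation R :: "real \<Rightarrow> 'n::finite opr set" where
  "R m \<equiv> OpS h (symbols h \<rho> \<delta> m)"

lemma R_iff: "A \<in> R m \<longleftrightarrow> (\<exists>\<sigma>. S m \<sigma> \<and> has_symbol h A \<sigma>)"
  using symbols_iff[OF h_pos d_nonneg] by (auto simp: OpS_def)

lemma RI: "S m \<sigma> \<Longrightarrow> has_symbol h A \<sigma> \<Longrightarrow> A \<in> R m"
  by (auto simp: R_iff)

lemma has_symbolD: "has_symbol h A \<sigma> \<Longrightarrow> f \<in> schwartz h \<Longrightarrow> k \<in> lattice \<Longrightarrow> A f k = Op h \<sigma> f k"
  by (auto simp: has_symbol_def)

lemma has_symbol_Op: "has_symbol h (Op h \<sigma>) \<sigma>"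
  by (simp add: has_symbol_def)

lemma has_symbol_unique:
  assumes "S m \<sigma>" "S m' \<tau>" "has_symbol h A \<sigma>" "has_symbol h A \<tau>" "k \<in> lattice"
  shows "\<sigma> k = \<tau> k"
  using assms by (intro symbol_unique[OF sym_smooth_sym sym_smooth_sym]) (auto simp: has_symbol_def)

lemma R_mono: "A \<in> R m \<Longrightarrow> m \<le> m' \<Longrightarrow> A \<in> R m'"
  by (auto simp: R_iff intro: sym_mono)

lemma R_cong:
  "A \<in> R m \<Longrightarrow> (\<And>f k. f \<in> schwartz h \<Longrightarrow> k \<in> lattice \<Longrightarrow> B f k = A f k) \<Longrightarrow> B \<in> R m"
  by (auto simp: R_iff has_symbol_def)

lemma has_symbol_add:
  "smooth_sym h \<sigma> \<Longrightarrow> smooth_sym h \<tau> \<Longrightarrow> has_symbol h A \<sigma> \<Longrightarrow> has_symbol h B \<tau> \<Longrightarrow>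
    has_symbol h (\<lambda>f k. A f k + B f k) (\<lambda>k \<theta>. \<sigma> k \<theta> + \<tau> k \<theta>)"
  by (auto simp: has_symbol_def Op_add_sym)

lemma has_symbol_cmult: "has_symbol h A \<sigma> \<Longrightarrow> has_symbol h (\<lambda>f k. c * A f k) (\<lambda>k \<theta>. c * \<sigma> k \<theta>)"
  by (auto simp: has_symbol_def Op_cmult_sym)

lemma has_symbol_diff:
  "smooth_sym h \<sigma> \<Longrightarrow> smooth_sym h \<tau> \<Longrightarrow> has_symbol h A \<sigma> \<Longrightarrow> has_symbol h B \<tau> \<Longrightarrow>
    has_symbol h (\<lambda>f k. A f k - B f k) (\<lambda>k \<theta>. \<sigma> k \<theta> - \<tau> k \<theta>)"
  using has_symbol_add[OF _ smooth_sym_cmult _ has_symbol_cmult, of \<sigma> \<tau> A B "-1"] by simp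

lemma has_symbol_0: "has_symbol h (\<lambda>f k. 0) (\<lambda>k \<theta>. 0)"
  by (simp add: has_symbol_def Op_def)

lemma has_symbol_sum:
  "(\<And>i. i \<in> I \<Longrightarrow> smooth_sym h (\<sigma> i)) \<Longrightarrow> (\<And>i. i \<in> I \<Longrightarrow> has_symbol h (A i) (\<sigma> i)) \<Longrightarrow>
    has_symbol h (\<lambda>f k. \<Sum>i\<in>I. A i f k) (\<lambda>k \<theta>. \<Sum>i\<in>I. \<sigma> i k \<theta>)"
proof (induction I rule: infinite_finite_induct)
  case (insert i I)
  have "smooth_sym h (\<lambda>k \<theta>. \<Sum>i\<in>I. \<sigma> i k \<theta>)"
    using insert.prems(1) by (auto simp: smooth_sym_def intro: torus_smooth_sum)
  with insert show ?case by (simp add: has_symbol_add)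
qed (auto simp: has_symbol_0)

lemma has_symbol_id: "has_symbol h id (\<lambda>k \<theta>. 1)"
  by (simp add: has_symbol_def Op_one)

lemma R_add: "A \<in> R m \<Longrightarrow> B \<in> R m \<Longrightarrow> (\<lambda>f k. A f k + B f k) \<in> R m"
  unfolding R_iff by (blast intro: has_symbol_add sym_add sym_smooth_sym)

lemma R_diff: "A \<in> R m \<Longrightarrow> B \<in> R m \<Longrightarrow> (\<lambda>f k. A f k - B f k) \<in> R m"
  unfolding R_iff by (blast intro: has_symbol_diff sym_diff sym_smooth_sym)

lemma R_sum: "(\<And>i. i \<in> I \<Longrightarrow> A i \<in> R m) \<Longrightarrow> (\<lambda>f k. \<Sum>i\<in>I. A i f k) \<in> R m"
proof (induction I rule: infinite_finite_induct)
  case (insert i I)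
  then show ?case by (simp add: R_add)
qed (auto intro: RI[OF sym_zero has_symbol_0])

lemma schwartz_cong: "f \<in> schwartz h \<Longrightarrow> (\<And>k. k \<in> lattice \<Longrightarrow> g k = f k) \<Longrightarrow> g \<in> schwartz h"
  by (simp add: schwartz_def)

lemma schwartz_zero: "(\<lambda>k. 0) \<in> schwartz h"
  by (auto simp: schwartz_def)

lemma schwartz_cmult: "f \<in> schwartz h \<Longrightarrow> (\<lambda>k. c * f k) \<in> schwartz h"
  unfolding schwartz_def mem_Collect_eq
proof
  fix m :: nat
  assume "\<forall>m. \<exists>C. \<forall>k\<in>lattice. (1 + norm k) ^ m * norm (f k) \<le> C"
  then obtain C where C: "\<And>k. k \<in> lattice \<Longrightarrow> (1 + norm k) ^ m * norm (f k) \<le> C" by meson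
  have "(1 + norm k) ^ m * norm (c * f k) \<le> norm c * C" if "k \<in> lattice" for k
    using mult_left_mono[OF C[OF that], of "norm c"] by (simp add: norm_mult mult_ac)
  then show "\<exists>C. \<forall>k\<in>lattice. (1 + norm k) ^ m * norm (c * f k) \<le> C" by blast
qed

lemma schwartz_diff: "f \<in> schwartz h \<Longrightarrow> g \<in> schwartz h \<Longrightarrow> (\<lambda>k. f k - g k) \<in> schwartz h"
  using schwartz_add[OF _ schwartz_cmult, of f g "-1"] by simp

lemma R_schwartz:
  assumes "A \<in> R m" "f \<in> schwartz h"
  shows "A f \<in> schwartz h"
proof -
  obtain \<sigma> where s: "S m \<sigma>" "has_symbol h A \<sigma>" using assms(1) by (auto simp: R_iff)
  show ?thesis
    by (rule schwartz_cong[OF Op_schwartz[OF assms(2) s(1)]]) (rule has_symbolD[OF s(2) assms(2)])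
qed

text \<open>Membership in a class does not constrain values off the lattice, so exchanging arguments
  that agree only on the lattice takes a detour through the symbol.\<close>

lemma R_cong_fun:
  assumes A: "A \<in> R m" and f: "f \<in> schwartz h" and eq: "\<And>k. k \<in> lattice \<Longrightarrow> g k = f k" and k: "k \<in> lattice"
  shows "A g k = A f k"
proof -
  obtain \<sigma> where s: "has_symbol h A \<sigma>" using A by (auto simp: R_iff)
  have "g \<in> schwartz h" by (rule schwartz_cong[OF f eq])
  moreover have "Op h \<sigma> g = Op h \<sigma> f" by (rule Op_cong_fun[OF eq])
  ultimately show ?thesis using has_symbolD[OF s _ k] f by simp
qed

lemma R_add_fun:
  assumes A: "A \<in> R m" and f: "f \<in> schwartz h" and g: "g \<in> schwartz h" and k: "k \<in> lattice"
  shows "A (\<lambda>k. f k + g k) k = A f k + A g k"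
proof -
  obtain \<sigma> where s: "S m \<sigma>" "has_symbol h A \<sigma>" using A by (auto simp: R_iff)
  show ?thesis
    using has_symbolD[OF s(2) _ k] Op_add_fun[OF f g sym_smooth_sym[OF s(1)] k] schwartz_add[OF f g] f g by simp
qed

lemma R_diff_fun:
  assumes A: "A \<in> R m" and f: "f \<in> schwartz h" and g: "g \<in> schwartz h" and k: "k \<in> lattice"
  shows "A (\<lambda>k. f k - g k) k = A f k - A g k"
  using R_add_fun[OF A schwartz_diff[OF f g] g k] by simp

lemma schwartz_sum: "(\<And>i. i \<in> I \<Longrightarrow> f i \<in> schwartz h) \<Longrightarrow> (\<lambda>k. \<Sum>i\<in>I. f i k) \<in> schwartz h"
  by (induction I rule: infinite_finite_induct) (auto intro: schwartz_add schwartz_zero)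

lemma R_sum_fun:
  assumes A: "A \<in> R m" and k: "k \<in> lattice"
  shows "(\<And>i. i \<in> I \<Longrightarrow> f i \<in> schwartz h) \<Longrightarrow> A (\<lambda>k. \<Sum>i\<in>I. f i k) k = (\<Sum>i\<in>I. A (f i) k)"
proof -
  have 0: "A (\<lambda>k. 0) k = 0"
    using R_diff_fun[OF A schwartz_zero schwartz_zero k] by simp
  show "(\<And>i. i \<in> I \<Longrightarrow> f i \<in> schwartz h) \<Longrightarrow> A (\<lambda>k. \<Sum>i\<in>I. f i k) k = (\<Sum>i\<in>I. A (f i) k)"
    by (induction I rule: infinite_finite_induct) (auto simp: 0 R_add_fun[OF A _ _ k] schwartz_sum)
qed

lemma has_symbol_comp:
  fixes A B :: "'n::finite opr"
  assumes a: "S m1 a" "has_symbol h A a" and b: "S m2 b" "has_symbol h B b"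
  shows "has_symbol h (A \<circ> B) (comp_sym a b)"
  unfolding has_symbol_def
proof (intro ballI)
  fix f :: "real ^ 'n \<Rightarrow> complex" and k :: "real ^ 'n" assume f: "f \<in> schwartz h" and k: "k \<in> lattice"
  have AR: "A \<in> R m1" using a by (rule RI)
  have "(A \<circ> B) f k = A (Op h b f) k"
    unfolding o_def by (rule R_cong_fun[OF AR Op_schwartz[OF f b(1)] has_symbolD[OF b(2) f] k])
  also have "\<dots> = Op h a (Op h b f) k"
    by (rule has_symbolD[OF a(2) Op_schwartz[OF f b(1)] k])
  finally show "(A \<circ> B) f k = Op h (comp_sym a b) f k"
    by (simp add: Op_comp[OF f a(1) b(1) k])
qed

lemma R_comp: "A \<in> R m1 \<Longrightarrow> B \<in> R m2 \<Longrightarrow> A \<circ> B \<in> R (m1 + m2)"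
  unfolding R_iff by (blast intro: S_comp has_symbol_comp)

text \<open>At order minus infinity the type is immaterial: torus derivatives cost a multiple of
  \<open>\<delta>\<close> and differences cost nothing, and any such cost can be afforded. A priori
  each order comes with its own symbol; uniqueness shows that these agree on the lattice.\<close>

lemma smoothing_iff: "A \<in> OpS h (smoothing_symbols h) \<longleftrightarrow> (\<forall>m. A \<in> R m)"
proof
  assume "A \<in> OpS h (smoothing_symbols h)"
  then obtain \<sigma> where \<sigma>: "has_symbol h A \<sigma>" "\<And>m. \<sigma> \<in> symbols h 1 0 m"
    by (auto simp: OpS_def smoothing_symbols_def)
  have "S m \<sigma>" for m
    using \<sigma>(2)[of m]
    by (auto simp: symbols_iff[OF h_pos order_refl] symclass_def intro: word_bounds_param_mono[OF r_le d_nonneg])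
  with \<sigma>(1) show "\<forall>m. A \<in> R m" by (auto intro: RI)
next
  assume A: "\<forall>m. A \<in> R m"
  then obtain \<sigma> where \<sigma>: "S 0 \<sigma>" "has_symbol h A \<sigma>" by (auto simp: R_iff)
  have Sm: "S m \<sigma>" for m
  proof -
    obtain \<tau> where \<tau>: "S m \<tau>" "has_symbol h A \<tau>" using A by (auto simp: R_iff)
    show ?thesis
      using \<tau>(1) sym_cong[of h \<sigma> \<tau>] has_symbol_unique[OF \<sigma>(1) \<tau>(1) \<sigma>(2) \<tau>(2)] by blast
  qed
  have "symclass h 1 0 \<mu> \<sigma>" for \<mu>
    unfolding symclass_def
  proof (intro conjI allI)
    fix r
    \<comment> \<open>The order \<open>\<mu> - real r - \<delta> * real r\<close> leaves room for
      \<open>r\<close> torus derivatives of cost \<open>\<delta>\<close> and for \<open>r\<close>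
      differences, each of which has to gain one order in type (1,0).\<close>
    have "tor_bounds h r (\<mu> - 1 * real r) \<sigma>"
      using word_bounds_imp_tor_bounds[OF d_nonneg sym_word_bounds[OF Sm], of r "\<mu> - real r - \<delta> * real r"] by simp
    then show "word_bounds h 1 0 r \<mu> \<sigma>"
      by (intro tor_bounds_imp_word_bounds[OF _ _ sym_smooth_sym[OF Sm]]) auto
  qed (rule sym_smooth_sym[OF Sm])
  then have "\<sigma> \<in> smoothing_symbols h"
    by (auto simp: smoothing_symbols_def symbols_iff[OF h_pos order_refl])
  with \<sigma>(2) show "A \<in> OpS h (smoothing_symbols h)" by (auto simp: OpS_def)
qed

lemma op_sim_iff: "op_sim h A B \<longleftrightarrow> (\<forall>m. (\<lambda>f k. A f k - B f k) \<in> R m)"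
  by (simp add: op_sim_def smoothing_iff)

section \<open>Asymptotic summation of symbols\<close>

lemma S_words: "S m \<sigma> \<Longrightarrow> S (m + \<delta> * real (length ds)) (foldr tor_diff ds \<sigma>)"
proof (induction ds)
  case (Cons j ds)
  from sym_tor_diff[OF Cons.IH[OF Cons.prems], of j] show ?case by (simp add: algebra_simps)
qed auto

text \<open>The index set may depend on the lattice point but not on \<open>\<theta>\<close>, so
  torus derivatives do not notice a cutoff in \<open>k\<close>.\<close>

lemma foldr_tor_diff_sum:
  assumes "k \<in> lattice" "\<And>j. j \<in> I k \<Longrightarrow> smooth_sym h (q j)"
  shows "foldr tor_diff ds (\<lambda>k \<theta>. \<Sum>j\<in>I k. q j k \<theta>) k = (\<lambda>\<theta>. \<Sum>j\<in>I k. foldr tor_diff ds (q j) k \<theta>)"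
proof (induction ds)
  case (Cons i ds)
  have "smooth_sym h (foldr tor_diff ds (q j))" if "j \<in> I k" for j
    using assms(2)[OF that] by (induction ds) (auto intro: smooth_sym_tor_diff)
  then have "torus_smooth (foldr tor_diff ds (q j) k)" if "j \<in> I k" for j
    using that assms(1) by (auto intro: ssmD)
  then have *: "partial i (\<lambda>\<theta>. \<Sum>j\<in>I k. foldr tor_diff ds (q j) k \<theta>) \<theta> = (\<Sum>j\<in>I k. partial i (foldr tor_diff ds (q j) k) \<theta>)" for \<theta>
    by (rule partial_sum)
  show ?case by (rule ext) (simp only: foldr.simps o_apply tor_diff_apply[of i] Cons.IH *)
qed auto

text \<open>Sharp cutoffs suffice for asymptotic summation, because on the lattice they cost nothing:
  cutting off changes a symbol at finitely many points only.\<close>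

lemma asymptotic_sum:
  fixes q :: "nat \<Rightarrow> 'n::finite sym"
  assumes q: "\<And>j. S (m - \<epsilon> * real j) (q j)" and \<epsilon>: "\<epsilon> > 0"
  shows "\<exists>\<sigma>. \<forall>N. S (m - \<epsilon> * real N) (\<lambda>k \<theta>. \<sigma> k \<theta> - (\<Sum>j<N. q j k \<theta>))"
proof -
  have qs: "smooth_sym h (q j)" for j using q by (rule sym_smooth_sym)
  have "\<exists>C>0. \<forall>k\<in>lattice. \<forall>\<theta>. norm (foldr tor_diff ds (q j) k \<theta>) \<le> C * (1 + norm k) powr (m - \<epsilon> * real j + \<delta> * real (length ds))" for ds j
    by (rule S_order_bound[OF S_words[OF q]])
  then obtain C where C: "\<And>ds j. C ds j > 0" "\<And>ds j k \<theta>. k \<in> lattice \<Longrightarrow>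
      norm (foldr tor_diff ds (q j) k \<theta>) \<le> C ds j * (1 + norm k) powr (m - \<epsilon> * real j + \<delta> * real (length ds))"
    by metis
  \<comment> \<open>One constant for all words of length at most \<open>j\<close>; for a given
    length this covers all late terms.\<close>
  define D where "D = (\<lambda>j. \<Sum>ds | length ds \<le> j. C ds j)"
  have fin: "finite {ds :: 'n list. length ds \<le> j}" for j
    using finite_lists_length_le[of "UNIV :: 'n set" j] by simp
  have D: "C ds j \<le> D j" if "length ds \<le> j" for ds j
    unfolding D_def using that C(1) fin by (intro member_le_sum) (auto intro: less_imp_le)
  \<comment> \<open>The bound \<open>real j\<close> makes every sum finite. The bound
    \<open>2 ^ j * D j\<close> turns \<open>D j\<close> into at most
    \<open>(1 / 2) ^ j * (1 + norm k)\<close>, a convergent series at the cost of one order.\<close>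
  define r where "r = (\<lambda>j. max (real j) (2 ^ j * D j))"
  define I where "I = (\<lambda>(J::nat) (k::real ^ 'n). {j. J \<le> j \<and> r j \<le> norm k})"
  have finI: "finite (I J k)" for J k
  proof (rule finite_subset)
    show "I J k \<subseteq> {..nat \<lfloor>norm k\<rfloor>}"
      unfolding I_def r_def by (auto simp: le_nat_floor)
  qed simp
  define t where "t = (\<lambda>J k \<theta>. \<Sum>j\<in>I J k. q j k \<theta>)"
  have ts: "smooth_sym h (t J)" for J
    unfolding t_def smooth_sym_def by (intro ballI torus_smooth_sum ssmD[OF qs])
  have tail: "order_bound h (m - \<epsilon> * real J + \<delta> * real L + 1) (foldr tor_diff ds (t J))" if ds: "length ds \<le> L" "L \<le> J" for ds J L
  proof (rule bndI[of _ _ 2])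
    fix k :: "real ^ 'n" and \<theta> assume k: "k \<in> lattice"
    let ?e = "m - \<epsilon> * real J + \<delta> * real L + 1"
    have "foldr tor_diff ds (t J) k \<theta> = (\<Sum>j\<in>I J k. foldr tor_diff ds (q j) k \<theta>)"
      unfolding t_def using fun_cong[OF foldr_tor_diff_sum[OF k qs, where I = "I J" and ds = ds], where x = \<theta>] by simp
    also have "norm \<dots> \<le> (\<Sum>j\<in>I J k. (1 / 2) ^ j * (1 + norm k) powr ?e)"
    proof (rule sum_norm_le)
      fix j assume "j \<in> I J k"
      then have j: "J \<le> j" "2 ^ j * D j \<le> norm k" by (auto simp: I_def r_def)
      have "norm (foldr tor_diff ds (q j) k \<theta>) \<le> C ds j * (1 + norm k) powr (m - \<epsilon> * real j + \<delta> * real (length ds))"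
        by (rule C(2)[OF k])
      also have "\<dots> \<le> D j * (1 + norm k) powr (m - \<epsilon> * real J + \<delta> * real L)"
      proof (rule mult_mono)
        show "C ds j \<le> D j" using D ds j by auto
        then show "0 \<le> D j" using C(1)[of ds j] by linarith
        have "\<epsilon> * real J \<le> \<epsilon> * real j" using \<epsilon> j(1) by simp
        moreover have "\<delta> * real (length ds) \<le> \<delta> * real L" using d_nonneg ds(1) by (intro mult_left_mono) auto
        ultimately show "(1 + norm k) powr (m - \<epsilon> * real j + \<delta> * real (length ds)) \<le> (1 + norm k) powr (m - \<epsilon> * real J + \<delta> * real L)"
          by (intro powr_mono_weight) linarith
      qed simp
      also have "D j \<le> (1 / 2) ^ j * (1 + norm k) powr 1"
        using j(2) by (simp add: power_one_over field_simps add_nonneg_nonneg)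
      then have "D j * (1 + norm k) powr (m - \<epsilon> * real J + \<delta> * real L)
          \<le> ((1 / 2) ^ j * (1 + norm k) powr 1) * (1 + norm k) powr (m - \<epsilon> * real J + \<delta> * real L)"
        by (rule mult_right_mono) simp
      also have "\<dots> = (1 / 2) ^ j * (1 + norm k) powr ?e"
        by (simp only: powr_add mult_ac)
      finally show "norm (foldr tor_diff ds (q j) k \<theta>) \<le> (1 / 2) ^ j * (1 + norm k) powr ?e" .
    qed
    also have "\<dots> = (\<Sum>j\<in>I J k. (1 / 2) ^ j) * (1 + norm k) powr ?e"
      by (simp add: sum_distrib_right)
    also have "\<dots> \<le> 2 * (1 + norm k) powr ?e"
    proof (rule mult_right_mono)
      have "(\<Sum>j\<in>I J k. (1 / 2 :: real) ^ j) \<le> (\<Sum>j. (1 / 2) ^ j)"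
        by (intro sum_le_suminf finI summable_geometric) auto
      also have "\<dots> = 2" by (subst suminf_geometric) auto
      finally show "(\<Sum>j\<in>I J k. (1 / 2 :: real) ^ j) \<le> 2" .
    qed simp
    finally show "norm (foldr tor_diff ds (t J) k \<theta>) \<le> 2 * (1 + norm k) powr ?e" .
  qed
  have "S (m - \<epsilon> * real N) (\<lambda>k \<theta>. t 0 k \<theta> - (\<Sum>j<N. q j k \<theta>))" for N
  proof -
    let ?m = "m - \<epsilon> * real N" and ?\<sigma> = "\<lambda>k \<theta>. t 0 k \<theta> - (\<Sum>j<N. q j k \<theta>)"
    have "smooth_sym h (\<lambda>k \<theta>. \<Sum>j<N. q j k \<theta>)" unfolding smooth_sym_def by (intro ballI torus_smooth_sum ssmD[OF qs])
    then have ss: "smooth_sym h ?\<sigma>" by (rule smooth_sym_diff[OF ts])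
    have "word_bounds h \<rho> \<delta> L ?m ?\<sigma>" for L
    proof -
      \<comment> \<open>The tail has to absorb its own loss of one order, \<open>L\<close>
        derivatives and \<open>L\<close> differences; starting it late enough achieves this.\<close>
      obtain J0 :: nat where J0: "(\<delta> * real L + 1 + \<epsilon> * real N + \<rho> * real L) / \<epsilon> \<le> real J0"
        using real_arch_simple by blast
      define J where "J = max J0 (max N L)"
      have J: "N \<le> J" "L \<le> J" by (auto simp: J_def)
      have "real J0 \<le> real J" by (simp add: J_def)
      with J0 have "(\<delta> * real L + 1 + \<epsilon> * real N + \<rho> * real L) / \<epsilon> \<le> real J" by linarith
      then have J': "\<delta> * real L + 1 + \<epsilon> * real N + \<rho> * real L \<le> \<epsilon> * real J"
        using \<epsilon> by (simp add: divide_simps mult_ac)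
      have "tor_bounds h L (?m - \<rho> * real L) (t J)"
      proof (rule tor_bounds_words)
        fix ds :: "'n list" assume "length ds \<le> L"
        from tail[OF this J(2)] show "order_bound h (?m - \<rho> * real L) (foldr tor_diff ds (t J))"
          by (rule order_bound_mono[rotated]) (use J' in linarith)
      qed
      then have eT: "word_bounds h \<rho> \<delta> L ?m (t J)"
        using r_pos d_nonneg by (intro tor_bounds_imp_word_bounds[OF _ _ ts]) auto
      \<comment> \<open>The part of \<open>q j\<close> removed by the cutoff, which lives on
        finitely many lattice points.\<close>
      define g where "g = (\<lambda>j k \<theta>. if r j \<le> norm k then 0 else q j k \<theta>)"
      have gs: "smooth_sym h (g j)" for j
        unfolding smooth_sym_def
      proof
        fix k :: "real ^ 'n" assume "k \<in> lattice"
        then show "torus_smooth (g j k)"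
          using ssmD[OF qs] by (cases "r j \<le> norm k") (simp_all add: g_def torus_smooth_const)
      qed
      have g: "S ?m (g j)" for j
        by (rule sym_finite_support[where R = "r j"]) (use h_pos r_pos d_nonneg gs in \<open>auto simp: g_def\<close>)
      have mid: "S ?m (\<lambda>k \<theta>. (\<Sum>j\<in>{N..<J}. q j k \<theta>) - (\<Sum>j<J. g j k \<theta>))"
        using \<epsilon> by (intro sym_diff sym_sum g sym_mono[OF q]) auto
      have "?\<sigma> = (\<lambda>k \<theta>. t J k \<theta> + ((\<Sum>j\<in>{N..<J}. q j k \<theta>) - (\<Sum>j<J. g j k \<theta>)))"
      proof (intro ext)
        fix k \<theta>
        have "I 0 k = I J k \<union> {j. j < J \<and> r j \<le> norm k}" by (auto simp: I_def)
        then have "t 0 k \<theta> = t J k \<theta> + (\<Sum>j | j < J \<and> r j \<le> norm k. q j k \<theta>)"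
          unfolding t_def by (simp only:) (rule sum.union_disjoint, auto simp: finI, auto simp: I_def)
        moreover have "(\<Sum>j<J. q j k \<theta>) - (\<Sum>j<J. g j k \<theta>) = (\<Sum>j | j < J \<and> r j \<le> norm k. q j k \<theta>)"
          unfolding sum_subtractf[symmetric]
          by (rule sum.mono_neutral_cong_right) (auto simp: g_def)
        moreover have "(\<Sum>j<J. q j k \<theta>) = (\<Sum>j<N. q j k \<theta>) + (\<Sum>j\<in>{N..<J}. q j k \<theta>)"
          using J(1) by (simp add: lessThan_atLeast0 sum.atLeastLessThan_concat)
        ultimately show "?\<sigma> k \<theta> = t J k \<theta> + ((\<Sum>j\<in>{N..<J}. q j k \<theta>) - (\<Sum>j<J. g j k \<theta>))"
          by (simp add: algebra_simps)
      qed
      with word_bounds_add[OF ts sym_smooth_sym[OF mid] eT sym_word_bounds[OF mid]] show ?thesis by simp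
    qed
    with ss show ?thesis by (simp add: symclass_def)
  qed
  then show ?thesis by blast
qed

end

section \<open>Neumann series, ellipticity and parametrices\<close>

context toroidal_calculus
begin

abbreviation smoothing :: "'n::finite opr \<Rightarrow> bool" where
  "smoothing A \<equiv> \<forall>m. A \<in> R m"

lemma smoothing_comp_left:
  assumes "smoothing A" "B \<in> R m"
  shows "smoothing (A \<circ> B)"
proof
  fix m'
  have "A \<circ> B \<in> R ((m' - m) + m)" using assms by (intro R_comp) auto
  then show "A \<circ> B \<in> R m'" by simp
qed

lemma smoothing_comp_right:
  assumes "smoothing A" "B \<in> R m"
  shows "smoothing (B \<circ> A)"
proof
  fix m'
  have "B \<circ> A \<in> R (m + (m' - m))" using assms by (intro R_comp) auto
  then show "B \<circ> A \<in> R m'" by simp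
qed

lemma R_all_orders:
  assumes "\<epsilon> > 0" "\<And>N. A \<in> R (- \<epsilon> * real N)"
  shows "smoothing A"
proof
  fix m
  obtain N :: nat where "- m / \<epsilon> \<le> real N" using real_arch_simple by blast
  then have "- \<epsilon> * real N \<le> m" using assms(1) by (simp add: field_simps)
  with assms(2) show "A \<in> R m" by (rule R_mono)
qed

text \<open>With \<open>B = I - A\<close>, the asymptotic sum \<open>Q\<close> of the powers of
  \<open>B\<close> differs from the partial sum \<open>P N\<close> by order
  \<open>- \<epsilon> * N\<close>, and multiplying \<open>P N\<close> by \<open>A\<close> on either
  side telescopes to \<open>I - B ^^ N\<close>. Hence one \<open>Q\<close> serves both
  sides.\<close>

lemma neumann:
  fixes A :: "'n::finite opr"
  assumes \<epsilon>: "\<epsilon> > 0" and A: "A \<in> R 0" and B: "(\<lambda>f k. f k - A f k) \<in> R (- \<epsilon>)"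
  shows "\<exists>Q\<in>R 0. op_sim h (Q \<circ> A) id \<and> op_sim h (A \<circ> Q) id"
proof -
  define B where "B = (\<lambda>f k. f k - A f k)"
  obtain b where b: "S (- \<epsilon>) b" "has_symbol h B b" using B by (auto simp: R_iff B_def)
  have BR: "B \<in> R (- \<epsilon>)" using b by (rule RI)
  define p where "p = (\<lambda>j. (comp_sym b ^^ j) (\<lambda>k \<theta>. 1))"
  have p: "S (0 - \<epsilon> * real j) (p j)" "has_symbol h (B ^^ j) (p j)" for j
  proof (induction j)
    case 0
    show "S (0 - \<epsilon> * real 0) (p 0)" by (simp add: p_def sym_const)
    show "has_symbol h (B ^^ 0) (p 0)" using has_symbol_id by (simp add: p_def id_def)
  next
    case (Suc j)
    show "S (0 - \<epsilon> * real (Suc j)) (p (Suc j))"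
      using S_comp[OF b(1) Suc(1)] by (simp add: p_def algebra_simps)
    show "has_symbol h (B ^^ Suc j) (p (Suc j))"
      using has_symbol_comp[OF b Suc] by (simp add: p_def)
  qed
  have pR: "B ^^ j \<in> R (- \<epsilon> * real j)" for j using RI[OF p] by simp
  have p0: "B ^^ j \<in> R 0" for j using \<epsilon> by (intro R_mono[OF pR]) simp
  obtain q where q: "\<And>N. S (0 - \<epsilon> * real N) (\<lambda>k \<theta>. q k \<theta> - (\<Sum>j<N. p j k \<theta>))"
    using asymptotic_sum[of 0 \<epsilon> p, OF p(1) \<epsilon>] by blast
  have q0: "S 0 q" using q[of 0] by simp
  define Q where "Q = Op h q"
  have Q: "has_symbol h Q q" by (simp add: Q_def has_symbol_Op)
  have QR: "Q \<in> R 0" by (rule RI[OF q0 Q])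
  define P where "P = (\<lambda>N f k. \<Sum>j<N. (B ^^ j) f k)"
  have ps: "smooth_sym h (p j)" for j by (rule sym_smooth_sym[OF p(1)])
  have Psym: "has_symbol h (P N) (\<lambda>k \<theta>. \<Sum>j<N. p j k \<theta>)" for N
    unfolding P_def by (intro has_symbol_sum ps p(2))
  have PR: "P N \<in> R 0" for N
    unfolding P_def by (intro R_sum p0)
  have QP: "(\<lambda>f k. Q f k - P N f k) \<in> R (- \<epsilon> * real N)" for N
  proof (rule RI)
    show "S (- \<epsilon> * real N) (\<lambda>k \<theta>. q k \<theta> - (\<Sum>j<N. p j k \<theta>))" using q[of N] by simp
    show "has_symbol h (\<lambda>f k. Q f k - P N f k) (\<lambda>k \<theta>. q k \<theta> - (\<Sum>j<N. p j k \<theta>))"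
      by (intro has_symbol_diff Q Psym sym_smooth_sym[OF q0]) (auto simp: smooth_sym_def intro!: torus_smooth_sum ssmD[OF ps])
  qed
  have Af: "A f = (\<lambda>k. f k - B f k)" for f by (simp add: B_def)
  have tele: "(\<Sum>j<N. g j - g (Suc j)) = g 0 - g N" for g :: "nat \<Rightarrow> complex" and N
    by (induction N) auto
  have PA: "P N (A f) k = f k - (B ^^ N) f k" if f: "f \<in> schwartz h" and k: "k \<in> lattice" for f N k
  proof -
    have "(B ^^ j) (A f) k = (B ^^ j) f k - (B ^^ Suc j) f k" for j
      unfolding Af using R_diff_fun[OF p0 f R_schwartz[OF BR f] k, of j] by (simp add: funpow_swap1)
    then show ?thesis using tele[of "\<lambda>j. (B ^^ j) f k" N] by (simp add: P_def)
  qed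
  have AP: "A (P N f) k = f k - (B ^^ N) f k" if f: "f \<in> schwartz h" and k: "k \<in> lattice" for f N k
  proof -
    have "B (P N f) k = (\<Sum>j<N. (B ^^ Suc j) f k)"
      unfolding P_def using R_sum_fun[OF BR k, of "{..<N}" "\<lambda>j. (B ^^ j) f"] R_schwartz[OF p0 f] by simp
    then have "A (P N f) k = (\<Sum>j<N. (B ^^ j) f k - (B ^^ Suc j) f k)"
      by (simp add: Af P_def sum_subtractf)
    then show ?thesis using tele[of "\<lambda>j. (B ^^ j) f k" N] by simp
  qed
  have 1: "(\<lambda>f k. (Q \<circ> A) f k - id f k) \<in> R (- \<epsilon> * real N)" for N
  proof -
    have "(\<lambda>f k. Q f k - P N f k) \<circ> A \<in> R (- \<epsilon> * real N)"
      using R_comp[OF QP A, of N] by (simp only: add_0_right)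
    from R_diff[OF this pR] show ?thesis by (rule R_cong) (simp add: PA)
  qed
  have 2: "(\<lambda>f k. (A \<circ> Q) f k - id f k) \<in> R (- \<epsilon> * real N)" for N
  proof -
    have "A \<circ> (\<lambda>f k. Q f k - P N f k) \<in> R (- \<epsilon> * real N)"
      using R_comp[OF A QP, of N] by (simp only: add_0)
    from R_diff[OF this pR] show ?thesis
    proof (rule R_cong)
      fix f :: "real ^ 'n \<Rightarrow> complex" and k :: "real ^ 'n" assume f: "f \<in> schwartz h" and k: "k \<in> lattice"
      have "A (\<lambda>k. Q f k - P N f k) k = A (Q f) k - A (P N f) k"
        by (rule R_diff_fun[OF A R_schwartz[OF QR f] R_schwartz[OF PR f] k])
      then show "(A \<circ> Q) f k - id f k = (A \<circ> (\<lambda>f k. Q f k - P N f k)) f k - (B ^^ N) f k"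
        by (simp add: AP[OF f k])
    qed
  qed
  show ?thesis
    unfolding op_sim_iff using QR R_all_orders[OF \<epsilon> 1] R_all_orders[OF \<epsilon> 2] by blast
qed

text \<open>Modulo smoothing operators \<open>V = V (U W) = (V U) W = W\<close>, so \<open>V\<close>
  may replace the right inverse \<open>W\<close>.\<close>

lemma left_right_parametrix:
  fixes U :: "'n::finite opr"
  assumes U: "U \<in> R \<mu>" and V: "V \<in> R m" and W: "W \<in> R m'"
    and VU: "op_sim h (V \<circ> U) id" and UW: "op_sim h (U \<circ> W) id"
  shows "op_sim h (U \<circ> V) id"
proof -
  define E1 where "E1 = (\<lambda>f k. (V \<circ> U) f k - id f k)"
  define E2 where "E2 = (\<lambda>f k. (U \<circ> W) f k - id f k)"
  have E: "smoothing E1" "smoothing E2" using VU UW by (auto simp: op_sim_iff E1_def E2_def)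
  have VE: "smoothing (V \<circ> E2)" by (rule smoothing_comp_right[OF E(2) V])
  have EW: "smoothing (E1 \<circ> W)" by (rule smoothing_comp_left[OF E(1) W])
  define D where "D = (\<lambda>f k. V f k - W f k)"
  have D: "smoothing D"
  proof
    fix n
    have "(\<lambda>f k. (E1 \<circ> W) f k - (V \<circ> E2) f k) \<in> R n" by (intro R_diff VE[rule_format] EW[rule_format])
    then show "D \<in> R n"
    proof (rule R_cong)
      fix f :: "real ^ 'n \<Rightarrow> complex" and k :: "real ^ 'n" assume f: "f \<in> schwartz h" and k: "k \<in> lattice"
      have Wf: "W f \<in> schwartz h" by (rule R_schwartz[OF W f])
      have "V (E2 f) k = V (U (W f)) k - V f k"
        unfolding E2_def using R_diff_fun[OF V R_schwartz[OF U Wf] f k] by simp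
      then show "D f k = (E1 \<circ> W) f k - (V \<circ> E2) f k" by (simp add: D_def E1_def)
    qed
  qed
  have UD: "smoothing (U \<circ> D)" by (rule smoothing_comp_right[OF D U])
  show ?thesis
    unfolding op_sim_iff
  proof
    fix n
    have "(\<lambda>f k. E2 f k + (U \<circ> D) f k) \<in> R n" by (intro R_add E(2)[rule_format] UD[rule_format])
    then show "(\<lambda>f k. (U \<circ> V) f k - id f k) \<in> R n"
    proof (rule R_cong)
      fix f :: "real ^ 'n \<Rightarrow> complex" and k :: "real ^ 'n" assume f: "f \<in> schwartz h" and k: "k \<in> lattice"
      have "U (D f) k = U (V f) k - U (W f) k"
        unfolding D_def by (rule R_diff_fun[OF U R_schwartz[OF V f] R_schwartz[OF W f] k])
      then show "(U \<circ> V) f k - id f k = E2 f k + (U \<circ> D) f k" by (simp add: E2_def)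
    qed
  qed
qed

lemma tor_ops_0: "tor_ops h (\<lambda>_. 0) \<sigma> = \<sigma>"
  by (intro ext) (simp add: tor_ops_def tor_op_def mlen_def foldr_id)

lemma mlen_eq_0_iff: "mlen \<gamma> = 0 \<longleftrightarrow> \<gamma> = (\<lambda>_. 0)"
  by (auto simp: mlen_def fun_eq_iff)

lemma comp_term_0: "comp_term (\<lambda>_. 0) a b k \<theta> = a k \<theta> * b k \<theta>"
  by (simp add: comp_term_def tor_ops_0 lat_diffs_0 mfact_def)

lemma comp_rem_1: "comp_rem 1 a b k \<theta> = comp_sym a b k \<theta> - a k \<theta> * b k \<theta>"
  by (simp add: comp_rem_def mlen_eq_0_iff comp_term_0)

lemma elliptic_inverse:
  fixes u v :: "'n::finite sym"
  assumes u: "S \<mu> u" and ell: "elliptic_symbol h \<mu> u" and v: "smooth_sym h v"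
    and vu: "\<And>k \<theta>. k \<in> lattice \<Longrightarrow> M \<le> norm k \<Longrightarrow> v k \<theta> = 1 / u k \<theta>"
  shows "S (- \<mu>) v"
proof -
  obtain C M' where C: "C > 0" "M' > 0" "\<And>k \<theta>. k \<in> lattice \<Longrightarrow> M' \<le> norm k \<Longrightarrow> C * (1 + norm k) powr \<mu> \<le> norm (u k \<theta>)"
    using ell unfolding elliptic_symbol_def by blast
  \<comment> \<open>Replaced by 1 near the origin, the symbol has a lower bound at every lattice
    point, so that \<open>sym_inverse\<close> applies; the changed points are finitely many.\<close>
  define w where "w = (\<lambda>k \<theta>. if M' \<le> norm k then u k \<theta> else 1)"
  have "smooth_sym h w"
    unfolding smooth_sym_def
  proof
    fix k :: "real ^ 'n" assume "k \<in> lattice"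
    then show "torus_smooth (w k)"
      using ssmD[OF sym_smooth_sym[OF u]] by (cases "M' \<le> norm k") (simp_all add: w_def torus_smooth_const)
  qed
  then have w: "S \<mu> w"
    using h_pos r_pos d_nonneg by (intro sym_eq_at_infinity[OF _ _ _ u, where R = M']) (auto simp: w_def)
  \<comment> \<open>The second entry keeps the weight below the constant value 1 on the ball of
    radius \<open>M'\<close>, for either sign of \<open>\<mu>\<close>.\<close>
  define c where "c = min C (1 / (1 + M') powr \<bar>\<mu>\<bar>)"
  have c: "c > 0" using C by (simp add: c_def)
  have "c * (1 + norm k) powr \<mu> \<le> norm (w k \<theta>)" if k: "k \<in> lattice" for k \<theta>
  proof (cases "M' \<le> norm k")
    case True
    have "c * (1 + norm k) powr \<mu> \<le> C * (1 + norm k) powr \<mu>" by (intro mult_right_mono) (auto simp: c_def)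
    with C(3)[OF k True, of \<theta>] True show ?thesis by (simp add: w_def)
  next
    case False
    have "(1 + norm k) powr \<mu> \<le> (1 + norm k) powr \<bar>\<mu>\<bar>" by (rule powr_mono_weight) simp
    also have "\<dots> \<le> (1 + M') powr \<bar>\<mu>\<bar>" using False by (intro powr_mono2) auto
    finally have "c * (1 + norm k) powr \<mu> \<le> (1 / (1 + M') powr \<bar>\<mu>\<bar>) * (1 + M') powr \<bar>\<mu>\<bar>"
      using c by (intro mult_mono) (auto simp: c_def)
    also have "\<dots> = 1" using C(2) by simp
    finally show ?thesis using False by (simp add: w_def)
  qed
  from sym_inverse[OF w c this] have "S (- \<mu>) (\<lambda>k \<theta>. inverse (w k \<theta>))" .
  then show ?thesis
  proof (rule sym_eq_at_infinity[OF h_pos less_imp_le[OF r_pos] d_nonneg _ v, where R = "max M M'"])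
    show "v k \<theta> = inverse (w k \<theta>)" if "k \<in> lattice" "max M M' \<le> norm k" for k \<theta>
      using that by (simp add: vu w_def inverse_eq_divide)
  qed
qed

lemma elliptic_symbol_nonzero:
  assumes "elliptic_symbol h \<mu> u"
  shows "\<exists>M>0. \<forall>k\<in>lattice. M \<le> norm k \<longrightarrow> (\<forall>\<theta>. u k \<theta> \<noteq> 0)"
proof -
  obtain C M where C: "C > 0" "M > 0" "\<And>k \<theta>. k \<in> lattice \<Longrightarrow> M \<le> norm k \<Longrightarrow> C * (1 + norm k) powr \<mu> \<le> norm (u k \<theta>)"
    using assms unfolding elliptic_symbol_def by blast
  have "u k \<theta> \<noteq> 0" if "k \<in> lattice" "M \<le> norm k" for k \<theta>
  proof -
    have "C * (1 + norm k) powr \<mu> > 0"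
      using C(1) by (intro mult_pos_pos) (auto simp: add_nonneg_eq_0_iff)
    with C(3)[OF that, of \<theta>] show ?thesis by auto
  qed
  with C(2) show ?thesis by blast
qed

text \<open>The Neumann series for \<open>V \<circ> U\<close> and for \<open>U \<circ> V\<close>
  yield a left and a right parametrix that are constructed separately;
  \<open>left_right_parametrix\<close> shows that the left one works on both sides.\<close>

lemma parametrix_exists:
  fixes U :: "'n::finite opr"
  assumes u: "S \<mu> u" and U: "has_symbol h U u" and ell: "elliptic_symbol h \<mu> u"
  shows "\<exists>V\<in>R (- \<mu>). parametrix h V U"
proof -
  define \<epsilon> where "\<epsilon> = \<rho> - \<delta>"
  have \<epsilon>: "\<epsilon> > 0" using d_less by (simp add: \<epsilon>_def)
  have UR: "U \<in> R \<mu>" by (rule RI[OF u U])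
  obtain M where M: "M > 0" "\<And>k \<theta>. k \<in> lattice \<Longrightarrow> M \<le> norm k \<Longrightarrow> u k \<theta> \<noteq> 0"
    using elliptic_symbol_nonzero[OF ell] by blast
  define v where "v = (\<lambda>k \<theta>. if M \<le> norm k then inverse (u k \<theta>) else 0)"
  have vs: "smooth_sym h v"
    unfolding smooth_sym_def
  proof
    fix k :: "real ^ 'n" assume k: "k \<in> lattice"
    show "torus_smooth (v k)"
    proof (cases "M \<le> norm k")
      case True
      have "torus_smooth (\<lambda>\<theta>. inverse (u k \<theta>))"
        by (rule torus_smooth_inverse[OF ssmD[OF sym_smooth_sym[OF u] k] M(2)[OF k True]])
      with True show ?thesis by (simp add: v_def)
    qed (simp add: v_def torus_smooth_const)
  qed
  have v: "S (- \<mu>) v"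
    by (rule elliptic_inverse[OF u ell vs, of M]) (simp add: v_def inverse_eq_divide)
  define V where "V = Op h v"
  have V: "has_symbol h V v" by (simp add: V_def has_symbol_Op)
  have VR: "V \<in> R (- \<mu>)" by (rule RI[OF v V])
  have prod: "S (- \<epsilon>) (\<lambda>k \<theta>. 1 - a k \<theta> * b k \<theta>)" if "S m a" "S m' b" "\<And>k \<theta>. k \<in> lattice \<Longrightarrow> M \<le> norm k \<Longrightarrow> a k \<theta> * b k \<theta> = 1" for a b :: "'n sym" and m m'
    using h_pos r_pos d_nonneg that sym_smooth_sym[OF that(1)] sym_smooth_sym[OF that(2)]
    by (intro sym_finite_support[where R = M] smooth_sym_diff smooth_sym_const smooth_sym_mult) auto
  \<comment> \<open>The symbol of \<open>I - A B\<close> is \<open>1 - a * b\<close>, supported at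
    finitely many points, minus the remainder after the leading term of the composition.\<close>
  have one: "(\<lambda>f k. f k - (A \<circ> B) f k) \<in> R (- \<epsilon>)"
    if a: "S m a" "has_symbol h A a" and b: "S (- m) b" "has_symbol h B b"
      and ab: "\<And>k \<theta>. k \<in> lattice \<Longrightarrow> M \<le> norm k \<Longrightarrow> a k \<theta> * b k \<theta> = 1" for A B :: "'n opr" and a b m
  proof (rule RI)
    have "S (- \<epsilon>) (\<lambda>k \<theta>. (1 - a k \<theta> * b k \<theta>) - comp_rem 1 a b k \<theta>)"
      using S_comp_rem[OF a(1) b(1), of 1] by (intro sym_diff prod[OF a(1) b(1) ab]) (simp_all add: \<epsilon>_def)
    then show "S (- \<epsilon>) (\<lambda>k \<theta>. 1 - comp_sym a b k \<theta>)" by (simp add: comp_rem_1[unfolded One_nat_def])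
    have "has_symbol h (\<lambda>f k. id f k - (A \<circ> B) f k) (\<lambda>k \<theta>. 1 - comp_sym a b k \<theta>)"
      by (rule has_symbol_diff[OF smooth_sym_const smooth_sym_comp[OF a(1) b(1)] has_symbol_id has_symbol_comp[OF a b]])
    then show "has_symbol h (\<lambda>f k. f k - (A \<circ> B) f k) (\<lambda>k \<theta>. 1 - comp_sym a b k \<theta>)" by simp
  qed
  have "(\<lambda>f k. f k - (V \<circ> U) f k) \<in> R (- \<epsilon>)"
    by (rule one[OF v V _ U]) (use u M(2) in \<open>auto simp: v_def\<close>)
  moreover have "V \<circ> U \<in> R 0" using R_comp[OF VR UR] by simp
  ultimately obtain Q where Q: "Q \<in> R 0" "op_sim h (Q \<circ> (V \<circ> U)) id"
    using neumann[OF \<epsilon>, of "V \<circ> U"] by blast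
  have "(\<lambda>f k. f k - (U \<circ> V) f k) \<in> R (- \<epsilon>)"
    by (rule one[OF u U v V]) (use M(2) in \<open>auto simp: v_def\<close>)
  moreover have "U \<circ> V \<in> R 0" using R_comp[OF UR VR] by simp
  ultimately obtain Q' where Q': "Q' \<in> R 0" "op_sim h ((U \<circ> V) \<circ> Q') id"
    using neumann[OF \<epsilon>, of "U \<circ> V"] by blast
  have L: "Q \<circ> V \<in> R (- \<mu>)" using R_comp[OF Q(1) VR] by simp
  have "V \<circ> Q' \<in> R (- \<mu>)" using R_comp[OF VR Q'(1)] by simp
  moreover have QVU: "op_sim h ((Q \<circ> V) \<circ> U) id" using Q(2) by (simp add: o_assoc)
  moreover have "op_sim h (U \<circ> (V \<circ> Q')) id" using Q'(2) by (simp add: o_assoc)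
  ultimately have "op_sim h (U \<circ> (Q \<circ> V)) id"
    using left_right_parametrix[OF UR L] by blast
  with L QVU show ?thesis unfolding parametrix_def by blast
qed

text \<open>For large \<open>k\<close> the product \<open>v * u\<close> is within 1/2 of 1, so the
  upper bound on \<open>v\<close> becomes a lower bound on \<open>u\<close>.\<close>

lemma elliptic_symbolI:
  fixes u v :: "'n::finite sym"
  assumes v: "S (- \<mu>) v" and vu: "S (- \<epsilon>) (\<lambda>k \<theta>. v k \<theta> * u k \<theta> - 1)" and \<epsilon>: "\<epsilon> > 0"
  shows "elliptic_symbol h \<mu> u"
proof -
  obtain C where C: "C > 0" "\<And>k \<theta>. k \<in> lattice \<Longrightarrow> norm (v k \<theta>) \<le> C * (1 + norm k) powr (- \<mu>)"
    using S_order_bound[OF v] by blast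
  obtain D where D: "D > 0" "\<And>k \<theta>. k \<in> lattice \<Longrightarrow> norm (v k \<theta> * u k \<theta> - 1) \<le> D * (1 + norm k) powr (- \<epsilon>)"
    using S_order_bound[OF vu] by blast
  \<comment> \<open>Chosen so that \<open>D * (1 + norm k) powr (- \<epsilon>)\<close> is at most
    1/2 once \<open>norm k \<ge> M\<close>.\<close>
  define M where "M = (2 * D) powr (1 / \<epsilon>)"
  have M: "M > 0" using D by (simp add: M_def)
  have "(1 / (2 * C)) * (1 + norm k) powr \<mu> \<le> norm (u k \<theta>)" if k: "k \<in> lattice" "M \<le> norm k" for k \<theta>
  proof -
    have pos: "(1 + norm k) powr \<mu> > 0" "(1 + norm k) powr \<epsilon> > 0" by (auto simp: add_nonneg_eq_0_iff)
    have "2 * D = M powr \<epsilon>" using D(1) \<epsilon> by (simp add: M_def powr_powr)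
    also have "\<dots> \<le> (1 + norm k) powr \<epsilon>" using k(2) M \<epsilon> by (intro powr_mono2) auto
    finally have "D * (1 + norm k) powr (- \<epsilon>) \<le> 1 / 2"
      using pos by (simp add: powr_minus divide_simps)
    with D(2)[OF k(1), of \<theta>] have "norm (v k \<theta> * u k \<theta> - 1) \<le> 1 / 2" by linarith
    then have "1 / 2 \<le> norm (v k \<theta> * u k \<theta>)"
      using norm_triangle_ineq2[of 1 "1 - v k \<theta> * u k \<theta>"] by (simp add: norm_minus_commute)
    also have "\<dots> \<le> (C * (1 + norm k) powr (- \<mu>)) * norm (u k \<theta>)"
      unfolding norm_mult by (intro mult_right_mono C k) auto
    finally show ?thesis
      using pos C(1) by (simp add: powr_minus divide_simps mult_ac)
  qed
  moreover have "1 / (2 * C) > 0" using C by simp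
  ultimately show ?thesis unfolding elliptic_symbol_def using M by blast
qed

text \<open>Uniqueness of symbols identifies the symbol of the error \<open>V U - I\<close> with
  \<open>comp_sym v u - 1\<close>, and \<open>comp_sym v u\<close> differs from \<open>v * u\<close>
  by the remainder after the leading term.\<close>

lemma left_parametrix_symbol:
  fixes U V :: "'n::finite opr"
  assumes u: "S \<mu> u" "has_symbol h U u" and v: "S (- \<mu>) v" "has_symbol h V v" and VU: "op_sim h (V \<circ> U) id"
  shows "S (- (\<rho> - \<delta>)) (\<lambda>k \<theta>. v k \<theta> * u k \<theta> - 1)"
proof -
  have "(\<lambda>f k. (V \<circ> U) f k - id f k) \<in> R (- (\<rho> - \<delta>))" using VU by (simp add: op_sim_iff)
  then obtain s where s: "S (- (\<rho> - \<delta>)) s" "has_symbol h (\<lambda>f k. (V \<circ> U) f k - id f k) s"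
    by (auto simp: R_iff)
  have vu: "S 0 (comp_sym v u)" using S_comp[OF v(1) u(1)] by simp
  have "has_symbol h (\<lambda>f k. (V \<circ> U) f k - id f k) (\<lambda>k \<theta>. comp_sym v u k \<theta> - 1)"
    by (rule has_symbol_diff[OF sym_smooth_sym[OF vu] smooth_sym_const has_symbol_comp[OF v u] has_symbol_id])
  then have "(\<lambda>\<theta>. comp_sym v u k \<theta> - 1) = s k" if "k \<in> lattice" for k
    using has_symbol_unique[OF sym_diff[OF vu sym_const] s(1) _ s(2) that] by simp
  then have "S (- (\<rho> - \<delta>)) (\<lambda>k \<theta>. comp_sym v u k \<theta> - 1)"
    using sym_cong[of h "\<lambda>k \<theta>. comp_sym v u k \<theta> - 1" s] s(1) by simp
  moreover have "S (- (\<rho> - \<delta>)) (comp_rem 1 v u)"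
    using S_comp_rem[OF v(1) u(1), of 1] by simp
  ultimately have "S (- (\<rho> - \<delta>)) (\<lambda>k \<theta>. (comp_sym v u k \<theta> - 1) - comp_rem 1 v u k \<theta>)"
    by (rule sym_diff)
  then show ?thesis by (simp add: comp_rem_1[unfolded One_nat_def])
qed

end

section \<open>The recursion\<close>

declare sum.cong [fundef_cong]

text \<open>One solution of the recursion, set to 0 near the origin. The termination proof sees the
  bound \<open>j < N\<close> of the outer sum through the congruence rule declared above.\<close>

function recursive_symbols :: "real \<Rightarrow> real \<Rightarrow> (nat \<Rightarrow> 'n::finite sym) \<Rightarrow> nat \<Rightarrow> 'n sym" where
  "recursive_symbols h M u N = (\<lambda>k \<theta>. if norm k < M then 0 else if N = 0 then 1 / u 0 k \<theta> else
     - 1 / u 0 k \<theta> * (\<Sum>j<N. \<Sum>l\<le>N. \<Sum>\<gamma> | mlen \<gamma> + j + l = N.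
        1 / of_nat (mfact \<gamma>) * tor_op h \<gamma> (recursive_symbols h M u j k) \<theta> * diff_op h \<gamma> (\<lambda>\<kappa>. u l \<kappa> \<theta>) k))"
  by auto
termination by (relation "Wellfounded.measure (\<lambda>(h, M, u, N). N)") auto

declare recursive_symbols.simps [simp del]

lemma recursive_symbols_0: "M \<le> norm k \<Longrightarrow> recursive_symbols h M u 0 k \<theta> = 1 / u 0 k \<theta>"
  by (subst recursive_symbols.simps) simp

lemma recursive_symbols_eq:
  "M \<le> norm k \<Longrightarrow> N \<ge> 1 \<Longrightarrow> recursive_symbols h M u N k \<theta> = - 1 / u 0 k \<theta> * (\<Sum>j<N. \<Sum>l\<le>N. \<Sum>\<gamma> | mlen \<gamma> + j + l = N.
        1 / of_nat (mfact \<gamma>) * tor_op h \<gamma> (recursive_symbols h M u j k) \<theta> * diff_op h \<gamma> (\<lambda>\<kappa>. u l \<kappa> \<theta>) k)"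
  by (subst recursive_symbols.simps) simp

lemma recursive_symbols_inner: "norm k < M \<Longrightarrow> recursive_symbols h M u N k = (\<lambda>\<theta>. 0)"
  by (subst recursive_symbols.simps) simp

context toroidal_calculus
begin

lemma recursion_exists:
  fixes u :: "nat \<Rightarrow> 'n::finite sym"
  assumes u: "\<And>l. smooth_sym h (u l)" and nv: "nonvanishing_from h M (u 0)"
  shows "\<exists>v. parametrix_recursion h M u v"
proof -
  have "torus_smooth (recursive_symbols h M u N k)" if k: "k \<in> lattice" for N k
  proof (induction N rule: less_induct)
    case (less N)
    show ?case
    proof (cases "norm k < M")
      case True
      then show ?thesis by (simp add: recursive_symbols_inner torus_smooth_const)
    next
      case False
      then have M: "M \<le> norm k" by simp
      have "torus_smooth (\<lambda>\<theta>. inverse (u 0 k \<theta>))"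
        using nv k M by (intro torus_smooth_inverse ssmD[OF u k]) (auto simp: nonvanishing_from_def)
      then have inv: "torus_smooth (\<lambda>\<theta>. 1 / u 0 k \<theta>)" by (simp add: inverse_eq_divide)
      show ?thesis
      proof (cases "N = 0")
        case True
        have "recursive_symbols h M u 0 k = (\<lambda>\<theta>. 1 / u 0 k \<theta>)" by (rule ext) (rule recursive_symbols_0[OF M])
        with inv True show ?thesis by simp
      next
        case False
        then have N: "N \<ge> 1" by simp
        have D: "torus_smooth (\<lambda>\<theta>. diff_op h \<gamma> (\<lambda>\<kappa>. u l \<kappa> \<theta>) k)" for \<gamma> l
          using ssmD[OF smooth_sym_lat_diffs[OF u] k, of \<gamma> l] by (simp add: lat_diffs_eq[symmetric])
        have "torus_smooth (\<lambda>\<theta>. (-1 * (1 / u 0 k \<theta>)) * (\<Sum>j<N. \<Sum>l\<le>N. \<Sum>\<gamma> | mlen \<gamma> + j + l = N.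
          (1 / of_nat (mfact \<gamma>) * tor_op h \<gamma> (recursive_symbols h M u j k) \<theta>) * diff_op h \<gamma> (\<lambda>\<kappa>. u l \<kappa> \<theta>) k))"
          by (intro torus_smooth_mult torus_smooth_cmult torus_smooth_sum inv D torus_smooth_const torus_smooth_tor_op less.IH) simp_all
        moreover have "recursive_symbols h M u N k = (\<lambda>\<theta>. (-1 * (1 / u 0 k \<theta>)) * (\<Sum>j<N. \<Sum>l\<le>N. \<Sum>\<gamma> | mlen \<gamma> + j + l = N.
          (1 / of_nat (mfact \<gamma>) * tor_op h \<gamma> (recursive_symbols h M u j k) \<theta>) * diff_op h \<gamma> (\<lambda>\<kappa>. u l \<kappa> \<theta>) k))"
          by (rule ext) (simp add: recursive_symbols_eq[OF M N])
        ultimately show ?thesis by simp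
      qed
    qed
  qed
  then have "parametrix_recursion h M u (recursive_symbols h M u)"
    unfolding parametrix_recursion_def by (auto simp: recursive_symbols_0 recursive_symbols_eq)
  then show ?thesis by blast
qed

text \<open>The condition \<open>mlen \<gamma> + j + l = N\<close> gives every term of the sum the
  order \<open>- (\<rho> - \<delta>) * N\<close>. The recursion fixes \<open>v N\<close> only for
  \<open>norm k \<ge> M\<close>, which suffices since finitely many points remain.\<close>

lemma S_recursion:
  fixes u v :: "nat \<Rightarrow> 'n::finite sym"
  assumes u: "\<And>l. S (\<mu> - (\<rho> - \<delta>) * real l) (u l)" and ell: "elliptic_symbol h \<mu> (u 0)"
    and rec: "parametrix_recursion h M u v"
  shows "S (- \<mu> - (\<rho> - \<delta>) * real N) (v N)"
proof (induction N rule: less_induct)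
  case (less N)
  have vs: "smooth_sym h (v N)" for N using rec by (auto simp: parametrix_recursion_def smooth_sym_def)
  have v0: "v 0 k \<theta> = 1 / u 0 k \<theta>" if "k \<in> lattice" "M \<le> norm k" for k \<theta>
    using rec that by (simp add: parametrix_recursion_def)
  have u0: "S \<mu> (u 0)" using u[of 0] by simp
  have S0: "S (- \<mu>) (v 0)" by (rule elliptic_inverse[OF u0 ell vs v0])
  show ?case
  proof (cases "N = 0")
    case False
    let ?r = "\<lambda>k \<theta>. \<Sum>j<N. \<Sum>l\<le>N. \<Sum>\<gamma> | mlen \<gamma> + j + l = N. comp_term \<gamma> (v j) (u l) k \<theta>"
    have r: "S (- (\<rho> - \<delta>) * real N) ?r"
    proof (intro sym_sum)
      fix j l and \<gamma> :: "'n \<Rightarrow> nat" assume *: "j \<in> {..<N}" "\<gamma> \<in> {\<gamma>. mlen \<gamma> + j + l = N}"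
      then have "S ((- \<mu> - (\<rho> - \<delta>) * real j) + (\<mu> - (\<rho> - \<delta>) * real l) - (\<rho> - \<delta>) * real (mlen \<gamma>)) (comp_term \<gamma> (v j) (u l))"
        by (intro S_comp_term less u) simp
      moreover have "real N = real (mlen \<gamma>) + real j + real l" using * by (simp flip: of_nat_add)
      then have "(- \<mu> - (\<rho> - \<delta>) * real j) + (\<mu> - (\<rho> - \<delta>) * real l) - (\<rho> - \<delta>) * real (mlen \<gamma>) = - (\<rho> - \<delta>) * real N"
        by (simp add: algebra_simps)
      ultimately show "S (- (\<rho> - \<delta>) * real N) (comp_term \<gamma> (v j) (u l))" by simp
    qed
    \<comment> \<open>\<open>v 0\<close> stands in for \<open>1 / u 0\<close>, which need not be a
      smooth symbol near the origin.\<close>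
    have w: "S (- \<mu> + - (\<rho> - \<delta>) * real N) (\<lambda>k \<theta>. (-1 * v 0 k \<theta>) * ?r k \<theta>)"
      by (rule sym_mult[OF sym_cmult[OF S0] r])
    have "S (- \<mu> + - (\<rho> - \<delta>) * real N) (v N)"
    proof (rule sym_eq_at_infinity[OF h_pos less_imp_le[OF r_pos] d_nonneg w vs, where R = M])
      fix k \<theta> :: "real ^ 'n" assume k: "k \<in> lattice" "M \<le> norm k"
      have "v N k \<theta> = - 1 / u 0 k \<theta> * ?r k \<theta>"
        using rec k False unfolding parametrix_recursion_def comp_term_def tor_ops_def lat_diffs_eq by simp
      then show "v N k \<theta> = (-1 * v 0 k \<theta>) * ?r k \<theta>" by (simp add: v0[OF k])
    qed
    then show ?thesis by (simp add: algebra_simps)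
  qed (use S0 in simp)
qed

text \<open>In the product of the two truncated expansions the terms of total order \<open>s\<close> cancel for
  \<open>0 < s < N\<close>: this is exactly the recursion.\<close>

lemma truncated_product:
  fixes u v :: "nat \<Rightarrow> 'n::finite sym"
  assumes u: "\<And>l. S (\<mu> - (\<rho> - \<delta>) * real l) (u l)" and ell: "elliptic_symbol h \<mu> (u 0)"
    and rec: "parametrix_recursion h M u v" and N: "N \<ge> 1"
  shows "S (- (\<rho> - \<delta>) * real N) (\<lambda>k \<theta>. (\<Sum>j<N. \<Sum>l<N. \<Sum>\<gamma> | mlen \<gamma> < N. comp_term \<gamma> (v j) (u l) k \<theta>) - 1)"
proof -
  \<comment> \<open>Index triples, to be sorted by their total order
    \<open>j + l + mlen \<gamma>\<close>; a term of total order \<open>s\<close> has symbol order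
    \<open>- (\<rho> - \<delta>) * s\<close>.\<close>
  define T where "T = {..<N} \<times> {..<N} \<times> {\<gamma> :: 'n \<Rightarrow> nat. mlen \<gamma> < N}"
  define ord where "ord = (\<lambda>(j :: nat, l :: nat, \<gamma> :: 'n \<Rightarrow> nat). j + l + mlen \<gamma>)"
  define F where "F = (\<lambda>(j, l, \<gamma>). comp_term \<gamma> (v j) (u l))"
  have finT: "finite T" by (simp add: T_def finite_mlen_less)
  have v: "S (- \<mu> - (\<rho> - \<delta>) * real j) (v j)" for j by (rule S_recursion[OF u ell rec])
  have F: "S (- (\<rho> - \<delta>) * real (ord t)) (F t)" for t
  proof (cases t)
    case (fields j l \<gamma>)
    have "S ((- \<mu> - (\<rho> - \<delta>) * real j) + (\<mu> - (\<rho> - \<delta>) * real l) - (\<rho> - \<delta>) * real (mlen \<gamma>)) (comp_term \<gamma> (v j) (u l))"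
      by (intro S_comp_term v u)
    then show ?thesis by (simp add: fields ord_def F_def algebra_simps)
  qed
  define G where "G = (\<lambda>s k \<theta>. \<Sum>t | t \<in> T \<and> ord t = s. F t k \<theta>)"
  obtain M' where M': "M' > 0" "\<And>k \<theta>. k \<in> lattice \<Longrightarrow> M' \<le> norm k \<Longrightarrow> u 0 k \<theta> \<noteq> 0"
    using elliptic_symbol_nonzero[OF ell] by blast
  \<comment> \<open>For \<open>s < N\<close> the truncation removes no triple of total order
    \<open>s\<close>, so the recursion applies in full. It needs \<open>norm k \<ge> M\<close>, and
    cancelling \<open>u 0\<close> needs \<open>norm k \<ge> M'\<close>.\<close>
  have G: "G s k \<theta> = (if s = 0 then 1 else 0)" if s: "s < N" and k: "k \<in> lattice" "max M M' \<le> norm k" for s k \<theta>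
  proof -
    have v0: "v 0 k \<theta> = 1 / u 0 k \<theta>" using rec k by (simp add: parametrix_recursion_def)
    have "{t. t \<in> T \<and> ord t = s} = Sigma {..s} (\<lambda>j. Sigma {..s} (\<lambda>l. {\<gamma>. mlen \<gamma> + j + l = s}))"
      using s by (auto simp: T_def ord_def)
    moreover have fin: "finite {\<gamma> :: 'n \<Rightarrow> nat. mlen \<gamma> + j + l = s}" for j l
      by (rule finite_subset[OF _ finite_mlen_less[of "Suc s"]]) auto
    moreover have "(\<Sum>j\<le>s. \<Sum>l\<le>s. \<Sum>\<gamma> | mlen \<gamma> + j + l = s. comp_term \<gamma> (v j) (u l) k \<theta>)
        = (\<Sum>j\<le>s. \<Sum>(l, \<gamma>)\<in>(SIGMA l:{..s}. {\<gamma>. mlen \<gamma> + j + l = s}). comp_term \<gamma> (v j) (u l) k \<theta>)"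
      by (intro sum.cong refl sum.Sigma) (auto simp: fin)
    moreover have "\<dots> = (\<Sum>(j, l, \<gamma>)\<in>(SIGMA j:{..s}. SIGMA l:{..s}. {\<gamma>. mlen \<gamma> + j + l = s}). comp_term \<gamma> (v j) (u l) k \<theta>)"
      by (rule sum.Sigma) (auto intro: finite_SigmaI fin)
    moreover have "\<dots> = (\<Sum>t\<in>(SIGMA j:{..s}. SIGMA l:{..s}. {\<gamma>. mlen \<gamma> + j + l = s}). F t k \<theta>)"
      by (intro sum.cong refl) (auto simp: F_def)
    ultimately have "G s k \<theta> = (\<Sum>j\<le>s. \<Sum>l\<le>s. \<Sum>\<gamma> | mlen \<gamma> + j + l = s. comp_term \<gamma> (v j) (u l) k \<theta>)"
      by (simp only: G_def)
    also have "{..s} = insert s {..<s}" by auto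
    also have "(\<Sum>j\<in>insert s {..<s}. \<Sum>l\<in>insert s {..<s}. \<Sum>\<gamma> | mlen \<gamma> + j + l = s. comp_term \<gamma> (v j) (u l) k \<theta>) =
        (\<Sum>l\<in>insert s {..<s}. \<Sum>\<gamma> | mlen \<gamma> + s + l = s. comp_term \<gamma> (v s) (u l) k \<theta>)
        + (\<Sum>j<s. \<Sum>l\<in>insert s {..<s}. \<Sum>\<gamma> | mlen \<gamma> + j + l = s. comp_term \<gamma> (v j) (u l) k \<theta>)"
      by (subst sum.insert) auto
    also have "insert s {..<s} = {..s}" by auto
    \<comment> \<open>With \<open>j = s\<close> only \<open>l = 0\<close> and
      \<open>\<gamma> = 0\<close> remain; this is the term for which the recursion is
      solved.\<close>
    also have "(\<Sum>l\<le>s. \<Sum>\<gamma> | mlen \<gamma> + s + l = s. comp_term \<gamma> (v s) (u l) k \<theta>) = v s k \<theta> * u 0 k \<theta>"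
    proof -
      have "(\<Sum>\<gamma> | mlen \<gamma> + s + l = s. comp_term \<gamma> (v s) (u l) k \<theta>) = (if l = 0 then v s k \<theta> * u 0 k \<theta> else 0)" for l
        by (cases "l = 0") (simp_all add: mlen_eq_0_iff comp_term_0)
      then show ?thesis by (simp add: sum.delta)
    qed
    finally have *: "G s k \<theta> = v s k \<theta> * u 0 k \<theta> + (\<Sum>j<s. \<Sum>l\<le>s. \<Sum>\<gamma> | mlen \<gamma> + j + l = s. comp_term \<gamma> (v j) (u l) k \<theta>)" .
    have nz: "u 0 k \<theta> \<noteq> 0" using M'(2) k by simp
    show ?thesis
    proof (cases "s = 0")
      case True
      with * v0 nz show ?thesis by simp
    next
      case False
      have "v s k \<theta> = - 1 / u 0 k \<theta> * (\<Sum>j<s. \<Sum>l\<le>s. \<Sum>\<gamma> | mlen \<gamma> + j + l = s. comp_term \<gamma> (v j) (u l) k \<theta>)"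
        using rec k False unfolding parametrix_recursion_def comp_term_def tor_ops_def lat_diffs_eq by simp
      then show ?thesis using * nz False by simp
    qed
  qed
  \<comment> \<open>The terms of total order at least \<open>N\<close> have the required symbol
    order one by one and need no cancellation.\<close>
  have split: "(\<Sum>j<N. \<Sum>l<N. \<Sum>\<gamma> | mlen \<gamma> < N. comp_term \<gamma> (v j) (u l) k \<theta>)
      = (\<Sum>s<N. G s k \<theta>) + (\<Sum>t | t \<in> T \<and> N \<le> ord t. F t k \<theta>)" for k \<theta>
  proof -
    have "(\<Sum>j<N. \<Sum>l<N. \<Sum>\<gamma> | mlen \<gamma> < N. comp_term \<gamma> (v j) (u l) k \<theta>) = (\<Sum>t\<in>T. F t k \<theta>)"
      unfolding T_def F_def by (simp add: sum.cartesian_product case_prod_unfold)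
    also have "T = {t. t \<in> T \<and> ord t < N} \<union> {t. t \<in> T \<and> N \<le> ord t}" by auto
    also have "(\<Sum>t\<in>\<dots>. F t k \<theta>) = (\<Sum>t | t \<in> T \<and> ord t < N. F t k \<theta>) + (\<Sum>t | t \<in> T \<and> N \<le> ord t. F t k \<theta>)"
      by (rule sum.union_disjoint) (auto intro: finite_subset[OF _ finT])
    also have "(\<Sum>t | t \<in> T \<and> ord t < N. F t k \<theta>) = (\<Sum>s<N. \<Sum>t\<in>{t \<in> {t. t \<in> T \<and> ord t < N}. ord t = s}. F t k \<theta>)"
      by (rule sum.group[symmetric]) (auto intro: finite_subset[OF _ finT])
    also have "\<dots> = (\<Sum>s<N. G s k \<theta>)"
      unfolding G_def by (intro sum.cong refl) auto
    finally show ?thesis .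
  qed
  \<comment> \<open>For large \<open>k\<close> the groups of order below \<open>N\<close> add up to
    exactly 1, so this difference lives on finitely many lattice points.\<close>
  have "S (- (\<rho> - \<delta>) * real N) (\<lambda>k \<theta>. (\<Sum>s<N. G s k \<theta>) - 1)"
  proof (rule sym_finite_support[OF h_pos less_imp_le[OF r_pos] d_nonneg, where R = "max M M'"])
    have "smooth_sym h (G s)" for s
      using sym_smooth_sym[OF F] unfolding G_def smooth_sym_def by (auto intro: torus_smooth_sum)
    then show "smooth_sym h (\<lambda>k \<theta>. (\<Sum>s<N. G s k \<theta>) - 1)"
      unfolding smooth_sym_def by (auto intro!: torus_smooth_diff torus_smooth_sum torus_smooth_const)
    show "(\<Sum>s<N. G s k \<theta>) - 1 = 0" if "k \<in> lattice" "max M M' \<le> norm k" for k \<theta>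
    proof -
      have "(\<Sum>s<N. G s k \<theta>) = (\<Sum>s<N. if s = 0 then 1 else 0)"
        using that by (intro sum.cong refl G) auto
      then show ?thesis using N by (simp add: sum.delta')
    qed
  qed
  moreover have "S (- (\<rho> - \<delta>) * real N) (\<lambda>k \<theta>. \<Sum>t | t \<in> T \<and> N \<le> ord t. F t k \<theta>)"
    using d_less by (intro sym_sum sym_mono[OF F]) (auto intro!: mult_left_mono_neg)
  ultimately have "S (- (\<rho> - \<delta>) * real N) (\<lambda>k \<theta>. ((\<Sum>s<N. G s k \<theta>) - 1) + (\<Sum>t | t \<in> T \<and> N \<le> ord t. F t k \<theta>))"
    by (rule sym_add)
  then show ?thesis by (simp add: split algebra_simps)
qed

text \<open>Three errors of order \<open>- (\<rho> - \<delta>) * N\<close> add up: the remainders of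
  the pairwise compositions, the truncated product minus 1, and the truncated sum composed with the
  remainder of the expansion of \<open>U\<close>.\<close>

lemma truncated_left_parametrix:
  fixes u v :: "nat \<Rightarrow> 'n::finite sym" and U :: "'n opr"
  assumes u: "\<And>l. S (\<mu> - (\<rho> - \<delta>) * real l) (u l)" "\<And>l. has_symbol h (Ul l) (u l)"
    and ell: "elliptic_symbol h \<mu> (u 0)" and rec: "parametrix_recursion h M u v"
    and U: "U \<in> R \<mu>" and W: "(\<lambda>f k. U f k - (\<Sum>l<N. Ul l f k)) \<in> R (\<mu> - (\<rho> - \<delta>) * real N)" and N: "N \<ge> 1"
  shows "(\<lambda>f k. (\<Sum>j<N. Op h (v j) (U f) k) - f k) \<in> R (- (\<rho> - \<delta>) * real N)"
proof -
  define \<epsilon> where "\<epsilon> = \<rho> - \<delta>"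
  have \<epsilon>: "\<epsilon> > 0" using d_less by (simp add: \<epsilon>_def)
  have uS: "S (\<mu> - \<epsilon> * real l) (u l)" for l using u(1) by (simp add: \<epsilon>_def)
  have v: "S (- \<mu> - \<epsilon> * real j) (v j)" for j unfolding \<epsilon>_def by (rule S_recursion[OF u(1) ell rec])
  have VR: "Op h (v j) \<in> R (- \<mu>)" for j
    using \<epsilon> by (intro R_mono[OF RI[OF v has_symbol_Op]]) simp
  have UlR: "Ul l \<in> R (\<mu> - \<epsilon> * real l)" for l by (rule RI[OF uS u(2)])
  define W where "W = (\<lambda>f k. U f k - (\<Sum>l<N. Ul l f k))"
  have WR: "W \<in> R (\<mu> - \<epsilon> * real N)" using W by (simp add: W_def \<epsilon>_def)
  define s where "s = (\<lambda>k \<theta>. \<Sum>j<N. \<Sum>l<N. comp_sym (v j) (u l) k \<theta>)"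
  have cS: "smooth_sym h (comp_sym (v j) (u l))" for j l by (rule smooth_sym_comp[OF v uS])
  have ss: "smooth_sym h (\<lambda>k \<theta>. \<Sum>l<N. comp_sym (v j) (u l) k \<theta>)" for j
    using cS by (auto simp: smooth_sym_def intro: torus_smooth_sum)
  have "has_symbol h (\<lambda>f k. (\<Sum>j<N. \<Sum>l<N. (Op h (v j) \<circ> Ul l) f k) - id f k) (\<lambda>k \<theta>. s k \<theta> - 1)"
    unfolding s_def
  proof (intro has_symbol_diff has_symbol_sum has_symbol_id smooth_sym_const cS ss has_symbol_comp[OF v has_symbol_Op uS u(2)])
    show "smooth_sym h (\<lambda>k \<theta>. \<Sum>j<N. \<Sum>l<N. comp_sym (v j) (u l) k \<theta>)"
      using ss by (auto simp: smooth_sym_def intro: torus_smooth_sum)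
  qed
  moreover have "S (- \<epsilon> * real N) (\<lambda>k \<theta>. s k \<theta> - 1)"
  proof -
    have "S (- \<epsilon> * real N) (\<lambda>k \<theta>. \<Sum>j<N. \<Sum>l<N. comp_rem N (v j) (u l) k \<theta>)"
    proof (intro sym_sum)
      fix j l
      have "\<epsilon> * real j \<ge> 0" "\<epsilon> * real l \<ge> 0" using \<epsilon> by simp_all
      then have "(- \<mu> - \<epsilon> * real j) + (\<mu> - \<epsilon> * real l) - \<epsilon> * real N \<le> - \<epsilon> * real N" by simp
      with S_comp_rem[OF v uS, of j l N, folded \<epsilon>_def] show "S (- \<epsilon> * real N) (comp_rem N (v j) (u l))"
        by (rule sym_mono)
    qed
    from sym_add[OF this truncated_product[OF u(1) ell rec N, folded \<epsilon>_def]]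
    show ?thesis by (simp add: s_def comp_rem_def sum_subtractf)
  qed
  ultimately have 1: "(\<lambda>f k. (\<Sum>j<N. \<Sum>l<N. (Op h (v j) \<circ> Ul l) f k) - id f k) \<in> R (- \<epsilon> * real N)"
    by (rule RI[rotated])
  have 2: "(\<lambda>f k. \<Sum>j<N. (Op h (v j) \<circ> W) f k) \<in> R (- \<epsilon> * real N)"
  proof (intro R_sum)
    fix j
    have "Op h (v j) \<circ> W \<in> R (- \<mu> + (\<mu> - \<epsilon> * real N))" by (rule R_comp[OF VR WR])
    then show "Op h (v j) \<circ> W \<in> R (- \<epsilon> * real N)" by simp
  qed
  have "(\<lambda>f k. (\<Sum>j<N. Op h (v j) (U f) k) - f k) \<in> R (- \<epsilon> * real N)"
  proof (rule R_cong[OF R_add[OF 1 2]])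
    fix f :: "real ^ 'n \<Rightarrow> complex" and k :: "real ^ 'n" assume f: "f \<in> schwartz h" and k: "k \<in> lattice"
    have Ulf: "Ul l f \<in> schwartz h" for l by (rule R_schwartz[OF UlR f])
    have Wf: "W f \<in> schwartz h" by (rule R_schwartz[OF WR f])
    have "Op h (v j) (U f) k = (\<Sum>l<N. Op h (v j) (Ul l f) k) + Op h (v j) (W f) k" for j
    proof -
      have "U f = (\<lambda>k. (\<Sum>l<N. Ul l f k) + W f k)" by (simp add: W_def)
      then have "Op h (v j) (U f) k = Op h (v j) (\<lambda>k. \<Sum>l<N. Ul l f k) k + Op h (v j) (W f) k"
        using R_add_fun[OF VR schwartz_sum[OF Ulf] Wf k] by simp
      then show ?thesis using R_sum_fun[OF VR[of j] k, of "{..<N}" "\<lambda>l. Ul l f"] Ulf by simp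
    qed
    then show "(\<Sum>j<N. Op h (v j) (U f) k) - f k = ((\<Sum>j<N. \<Sum>l<N. (Op h (v j) \<circ> Ul l) f k) - id f k) + (\<Sum>j<N. (Op h (v j) \<circ> W) f k)"
      by (simp add: sum.distrib)
  qed
  then show ?thesis by (simp add: \<epsilon>_def)
qed

text \<open>With \<open>E = VN U - I\<close> and \<open>Z = U V - I\<close> one has
  \<open>V - VN = VN Z - E V\<close>, where \<open>Z\<close> is smoothing. The case
  \<open>N = 0\<close> is separate because the truncated product needs its leading term.\<close>

lemma parametrix_expansion:
  fixes u v :: "nat \<Rightarrow> 'n::finite sym" and U :: "'n opr"
  assumes u: "\<And>l. S (\<mu> - (\<rho> - \<delta>) * real l) (u l)" "\<And>l. has_symbol h (Ul l) (u l)"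
    and ell: "elliptic_symbol h \<mu> (u 0)" and rec: "parametrix_recursion h M u v"
    and U: "U \<in> R \<mu>" and W: "\<And>N. (\<lambda>f k. U f k - (\<Sum>l<N. Ul l f k)) \<in> R (\<mu> - (\<rho> - \<delta>) * real N)"
    and V: "V \<in> R (- \<mu>)" and UV: "op_sim h (U \<circ> V) id"
  shows "(\<lambda>f k. V f k - (\<Sum>j<N. Op h (v j) f k)) \<in> R (- \<mu> - (\<rho> - \<delta>) * real N)"
proof (cases "N = 0")
  case True
  with V show ?thesis by simp
next
  case False
  define VN where "VN = (\<lambda>f k. \<Sum>j<N. Op h (v j) f k)"
  define E where "E = (\<lambda>f k. (\<Sum>j<N. Op h (v j) (U f) k) - f k)"
  define Z where "Z = (\<lambda>f k. (U \<circ> V) f k - id f k)"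
  have ER: "E \<in> R (- (\<rho> - \<delta>) * real N)"
    unfolding E_def by (rule truncated_left_parametrix[OF u ell rec U W]) (use False in simp)
  have Z: "smoothing Z" using UV by (simp add: op_sim_iff Z_def)
  have VN: "VN \<in> R (- \<mu>)"
    unfolding VN_def
  proof (rule R_sum)
    fix j
    show "Op h (v j) \<in> R (- \<mu>)"
      using d_less by (intro R_mono[OF RI[OF S_recursion[OF u(1) ell rec] has_symbol_Op]]) simp
  qed
  have "E \<circ> V \<in> R (- (\<rho> - \<delta>) * real N + - \<mu>)" by (rule R_comp[OF ER V])
  then have 1: "E \<circ> V \<in> R (- \<mu> - (\<rho> - \<delta>) * real N)" by (simp add: algebra_simps)
  have 2: "VN \<circ> Z \<in> R (- \<mu> - (\<rho> - \<delta>) * real N)"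
    using smoothing_comp_right[OF Z VN] by blast
  show ?thesis
  proof (rule R_cong[OF R_diff[OF 2 1]])
    fix f :: "real ^ 'n \<Rightarrow> complex" and k :: "real ^ 'n" assume f: "f \<in> schwartz h" and k: "k \<in> lattice"
    have Vf: "V f \<in> schwartz h" by (rule R_schwartz[OF V f])
    have "VN (Z f) k = VN (U (V f)) k - VN f k"
      unfolding Z_def using R_diff_fun[OF VN R_schwartz[OF U Vf] f k] by simp
    moreover have "E (V f) k = VN (U (V f)) k - V f k" by (simp add: E_def VN_def)
    ultimately show "V f k - (\<Sum>j<N. Op h (v j) f k) = (VN \<circ> Z) f k - (E \<circ> V) f k"
      by (simp add: VN_def)
  qed
qed

text \<open>\<open>v * u0 - 1 = (v * u - 1) - v * (u - u0)\<close>, and both terms on the right have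
  order \<open>- (\<rho> - \<delta>)\<close>.\<close>

lemma leading_symbol_elliptic:
  fixes U V U0 :: "'n::finite opr"
  assumes u: "S \<mu> u" "has_symbol h U u" and v: "S (- \<mu>) v" "has_symbol h V v" and VU: "op_sim h (V \<circ> U) id"
    and u0: "S \<mu> u0" "has_symbol h U0 u0" and d: "(\<lambda>f k. U f k - U0 f k) \<in> R (\<mu> - (\<rho> - \<delta>))"
  shows "elliptic_symbol h \<mu> u0"
proof (rule elliptic_symbolI[OF v(1)])
  obtain w where w: "S (\<mu> - (\<rho> - \<delta>)) w" "has_symbol h (\<lambda>f k. U f k - U0 f k) w" using d by (auto simp: R_iff)
  have "has_symbol h (\<lambda>f k. U f k - U0 f k) (\<lambda>k \<theta>. u k \<theta> - u0 k \<theta>)"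
    by (rule has_symbol_diff[OF sym_smooth_sym[OF u(1)] sym_smooth_sym[OF u0(1)] u(2) u0(2)])
  then have "(\<lambda>\<theta>. u k \<theta> - u0 k \<theta>) = w k" if "k \<in> lattice" for k
    using has_symbol_unique[OF sym_diff[OF u(1) u0(1)] w(1) _ w(2) that] by simp
  then have "S (\<mu> - (\<rho> - \<delta>)) (\<lambda>k \<theta>. u k \<theta> - u0 k \<theta>)"
    using sym_cong[of h "\<lambda>k \<theta>. u k \<theta> - u0 k \<theta>" w] w(1) by simp
  from sym_mult[OF v(1) this] have "S (- (\<rho> - \<delta>)) (\<lambda>k \<theta>. v k \<theta> * (u k \<theta> - u0 k \<theta>))" by simp
  from sym_diff[OF left_parametrix_symbol[OF u v VU] this]
  show "S (- (\<rho> - \<delta>)) (\<lambda>k \<theta>. v k \<theta> * u0 k \<theta> - 1)" by (simp add: algebra_simps)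
  show "\<rho> - \<delta> > 0" using d_less by simp
qed

end

theorem theorem4p7:
  fixes h \<mu> \<rho> \<delta> :: real and U :: "'n::finite opr"
  assumes "0 < h" "h \<le> 1"
    and "0 \<le> \<delta>" "\<delta> < \<rho>" "\<rho> \<le> 1"
    and "U \<in> OpS h (symbols h \<rho> \<delta> \<mu>)"
  shows "(elliptic h \<rho> \<delta> \<mu> U \<longleftrightarrow> (\<exists>V\<in>OpS h (symbols h \<rho> \<delta> (- \<mu>)). parametrix h V U)) \<and>
    (\<forall>Ul u. op_expansion h \<rho> \<delta> \<mu> U Ul \<and>
        (\<forall>l. u l \<in> symbols h \<rho> \<delta> (\<mu> - (\<rho> - \<delta>) * real l) \<and> has_symbol h (Ul l) (u l)) \<longrightarrow>
      (\<forall>V\<in>OpS h (symbols h \<rho> \<delta> (- \<mu>)). parametrix h V U \<longrightarrow>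
        (\<exists>M. nonvanishing_from h M (u 0)) \<and>
        (\<forall>M. nonvanishing_from h M (u 0) \<longrightarrow>
          (\<exists>v. parametrix_recursion h M u v) \<and>
          (\<forall>v. parametrix_recursion h M u v \<longrightarrow>
            (\<forall>j. v j \<in> symbols h \<rho> \<delta> (- \<mu> - (\<rho> - \<delta>) * real j)) \<and>
            op_expansion h \<rho> \<delta> (- \<mu>) V (\<lambda>j. Op h (v j))))))"
proof -
  interpret toroidal_calculus h \<rho> \<delta> using assms by unfold_locales
  note sym_iff = symbols_iff[OF h_pos d_nonneg]
  obtain u where u: "S \<mu> u" "has_symbol h U u" using assms(6) by (auto simp: R_iff)
  have 1: "elliptic h \<rho> \<delta> \<mu> U \<longleftrightarrow> (\<exists>V\<in>R (- \<mu>). parametrix h V U)"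
  proof
    assume "elliptic h \<rho> \<delta> \<mu> U"
    then show "\<exists>V\<in>R (- \<mu>). parametrix h V U"
      by (auto simp: elliptic_def sym_iff intro: parametrix_exists)
  next
    assume "\<exists>V\<in>R (- \<mu>). parametrix h V U"
    then obtain V v where v: "S (- \<mu>) v" "has_symbol h V v" and VU: "op_sim h (V \<circ> U) id"
      by (auto simp: parametrix_def R_iff)
    have "elliptic_symbol h \<mu> u"
      by (rule elliptic_symbolI[OF v(1) left_parametrix_symbol[OF u v VU]]) (use d_less in simp)
    with u show "elliptic h \<rho> \<delta> \<mu> U" by (auto simp: elliptic_def sym_iff)
  qed
  have 2: "(\<exists>M. nonvanishing_from h M (u' 0)) \<and>
      (\<forall>M. nonvanishing_from h M (u' 0) \<longrightarrow>
        (\<exists>v. parametrix_recursion h M u' v) \<and>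
        (\<forall>v. parametrix_recursion h M u' v \<longrightarrow>
          (\<forall>j. v j \<in> symbols h \<rho> \<delta> (- \<mu> - (\<rho> - \<delta>) * real j)) \<and>
          op_expansion h \<rho> \<delta> (- \<mu>) V (\<lambda>j. Op h (v j))))"
    if exp: "op_expansion h \<rho> \<delta> \<mu> U Ul"
      and u': "\<And>l. u' l \<in> symbols h \<rho> \<delta> (\<mu> - (\<rho> - \<delta>) * real l)" "\<And>l. has_symbol h (Ul l) (u' l)"
      and V: "V \<in> R (- \<mu>)" and par: "parametrix h V U" for Ul u' V
  proof -
    have uS: "S (\<mu> - (\<rho> - \<delta>) * real l) (u' l)" for l using u'(1) by (simp add: sym_iff)
    have W: "(\<lambda>f k. U f k - (\<Sum>l<N. Ul l f k)) \<in> R (\<mu> - (\<rho> - \<delta>) * real N)" for N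
      using exp by (simp add: op_expansion_def)
    obtain v where v: "S (- \<mu>) v" "has_symbol h V v" using V by (auto simp: R_iff)
    have VU: "op_sim h (V \<circ> U) id" and UV: "op_sim h (U \<circ> V) id" using par by (auto simp: parametrix_def)
    \<comment> \<open>The expansion at \<open>N = 1\<close> says that \<open>U\<close> and its
      leading term differ by order \<open>\<mu> - (\<rho> - \<delta>)\<close>.\<close>
    have ell: "elliptic_symbol h \<mu> (u' 0)"
      by (rule leading_symbol_elliptic[OF u v VU _ u'(2)[of 0]]) (use uS[of 0] W[of 1] in simp_all)
    have nv: "\<exists>M. nonvanishing_from h M (u' 0)"
      using elliptic_symbol_nonzero[OF ell] unfolding nonvanishing_from_def by blast
    have ex: "\<exists>v. parametrix_recursion h M u' v" if "nonvanishing_from h M (u' 0)" for M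
      by (rule recursion_exists[of u' M, OF sym_smooth_sym[OF uS] that])
    have "v j \<in> symbols h \<rho> \<delta> (- \<mu> - (\<rho> - \<delta>) * real j)" if "parametrix_recursion h M u' v" for M v j
      using S_recursion[OF uS ell that] by (simp add: sym_iff)
    moreover have "op_expansion h \<rho> \<delta> (- \<mu>) V (\<lambda>j. Op h (v j))" if "parametrix_recursion h M u' v" for M v
      unfolding op_expansion_def
      using RI[OF S_recursion[OF uS ell that] has_symbol_Op]
        parametrix_expansion[OF uS u'(2) ell that assms(6) W V UV] by blast
    ultimately show ?thesis using nv ex by blast
  qed
  show ?thesis using 1 2 by blast
qed

end
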